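(* Let $f$ be a density on the unit square $S=[0,1]^2$ such that $\epsilon_1\le\inf_S f\le\sup_S f\le\epsilon_2$ for some constants $0<\epsilon_1\le\epsilon_2<\infty$. Let $X_1,X_2,\dots$ be independent random points of $S$, each with density $f$, and let $MST_n$ be the length of the minimum spanning tree of $\{X_1,\dots,X_n\}$. Then there is a constant $C>0$ such that $$\mathbb{E}\left(MST_n-\mathbb{E}MST_n\right)^2\le C(\log n)^3\quad\text{for all } n\ge1,$$ and $$\frac1{\sqrt n}\left(MST_n-\mathbb{E}MST_n\right)\longrightarrow0\quad\text{almost surely as } n\to\infty.$$ There are positive constants $\theta_1,\theta_2,\theta_3$ such that for all sufficiently large $n$, $$\theta_1\sqrt n\le\mathbb{E}MST_n\le3\sqrt n,$$ $$\mathbb{P}\left(MST_n\le3\sqrt n\right)=1,$$ $$\mathbb{P}\left(MST_n\ge\theta_2\sqrt n\right)\ge1-\exp\left(-\frac{\theta_3n}{\log n}\right).$$ Moreover, if the nodes are uniformly distributed in $S$ (i.e. $f\equiv1$), then $$\frac{\mathbb{E}MST_n}{\sqrt n}\longrightarrow\beta\quad\text{as } n\to\infty$$ for some constant $\beta>0$.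
   Context: $MST_n$ is the minimum, over all spanning trees $\mathcal{T}$ of the complete graph with vertex set $\{X_1,\dots,X_n\}$, of the sum of the Euclidean lengths of the edges of $\mathcal{T}$ (so $MST_1=0$). *)

theory Defs
  imports "HOL-Probability.Probability"
begin

definition unit_square :: "(real \<times> real) set" where
  "unit_square = {0..1} \<times> {0..1}"

text \<open>
  A graph on a vertex set \<open>V\<close> is given by its set of edges, an undirected edge being a
  two-element set of vertices.
\<close>

definition complete_edges :: "'a set \<Rightarrow> 'a set set" where
  "complete_edges V = {{u, v} | u v. u \<in> V \<and> v \<in> V \<and> u \<noteq> v}"

definition connected_graph :: "'a set \<Rightarrow> 'a set set \<Rightarrow> bool" where
  "connected_graph V E \<longleftrightarrow> (\<forall>u\<in>V. \<forall>v\<in>V. (u, v) \<in> {(x, y). {x, y} \<in> E}\<^sup>*)"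

text \<open>
  A cycle is listed without repeating its first vertex; the index \<open>Suc i mod length p\<close>
  closes it up.
\<close>

definition is_cycle :: "'a set set \<Rightarrow> 'a list \<Rightarrow> bool" where
  "is_cycle E p \<longleftrightarrow> 3 \<le> length p \<and> distinct p \<and>
     (\<forall>i<length p. {p ! i, p ! (Suc i mod length p)} \<in> E)"

definition spanning_tree :: "'a set \<Rightarrow> 'a set set \<Rightarrow> bool" where
  "spanning_tree V T \<longleftrightarrow>
     T \<subseteq> complete_edges V \<and> connected_graph V T \<and> (\<nexists>p. is_cycle T p)"

text \<open>The length of an edge is the distance of its endpoints, i.e. its diameter as a set.\<close>

lemma diameter_edge: "diameter {u, v} = dist u (v :: 'a :: metric_space)"
proof -
  have "(SUP (x, y)\<in>{u, v} \<times> {u, v}. dist x y) = dist u v"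
    by (rule cSup_eq_maximum) (auto simp: dist_commute)
  then show ?thesis by (simp add: diameter_def)
qed

definition edges_length :: "'a :: metric_space set set \<Rightarrow> real" where
  "edges_length T = (\<Sum>e\<in>T. diameter e)"

text \<open>For finite \<open>V\<close> the minimum is over a finite nonempty set.\<close>

definition mst_length :: "'a :: metric_space set \<Rightarrow> real" where
  "mst_length V = Min (edges_length ` {T. spanning_tree V T})"

definition MST :: "(nat \<Rightarrow> 'w \<Rightarrow> 'a :: metric_space) \<Rightarrow> nat \<Rightarrow> 'w \<Rightarrow> real" where
  "MST X n \<omega> = mst_length ((\<lambda>i. X i \<omega>) ` {1..n})"

end

theory Submission
  imports Defs "HOL-Real_Asymp.Real_Asymp"
begin

text \<open>
  Everything rests on one remark: \<open>mst_length V\<close> is at most the length of \<^emph>\<open>any\<close> connected graph on \<open>V\<close>.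
  Upper bounds are obtained by exhibiting graphs, lower bounds by comparing a shortest graph with a
  modification of it.

  \<^emph>\<open>Growth.\<close>  Walking through the points row by row gives a path of length at most
  \<open>2 * m + 2 + n / m\<close> for every number \<open>m\<close> of rows (\<open>mst_length_square_le\<close>), hence
  \<open>MST X n \<le> 3 * sqrt n\<close> with certainty for large \<open>n\<close>.  Conversely, take a grid with about \<open>n\<close> cells.  The
  density is bounded, so a union bound over sets of cells shows that the sample occupies a positive
  fraction of the cells except with probability \<open>(1 / 3) ^ n\<close> (\<open>measure_crowded_le\<close>).  A tree that visits
  \<open>k\<close> cells of side \<open>1 / m\<close> has, for large \<open>k\<close>, length at least of order \<open>k / m\<close>, because each of \<open>k\<close> Lipschitz bumps has to
  vary along it (\<open>mst_length_ge_bumps\<close>).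

  \<^emph>\<open>Variance.\<close>  By the inequality \<open>Efron_Stein\<close>, the variance is at most the sum of the mean squared changes of
  the length when one point is left out.  Leaving out \<open>v\<close> changes the length by at most the sum of the edges
  at \<open>v\<close> (\<open>abs_mst_length_delete_le\<close>).  A vertex has at most eight edges, one for each octant, so the sum of the
  squared changes is at most 16 times the sum of the squared edge lengths.  Tree edges of length about
  \<open>r\<close> cannot run close to each other, so there are \<open>O (1 / r\<^sup>2)\<close> of them; summing over the dyadic scales down to
  \<open>1 / n\<close> yields a sure bound of order \<open>ln n\<close> (\<open>sum_square_mst_length_delete_le\<close>), which is better than the cube
  of the logarithm.

  \<^emph>\<open>Almost sure convergence.\<close>  The variance bound makes the normalised deviations at the indices \<open>k\<^sup>2\<close> square
  summable.  Other indices are compared with the neighbouring squares: \<open>j\<close> further points cost at most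
  \<open>7 * sqrt j + 2\<close>.

  \<^emph>\<open>Uniform points.\<close>  Cut the square into \<open>m\<^sup>2\<close> cells.  The points of \<open>m\<^sup>2 * k\<close> uniform ones that fall into a cell
  are a scaled sample of about \<open>k\<close> points, and joining the trees of all cells costs \<open>O (m)\<close>.  As the mean
  length depends on the number of points in a \<open>1/2\<close>-Hoelder fashion (\<open>abs_mean_mst_diff_le\<close>), the binomial
  fluctuations are harmless.  Hence the mean length divided by \<open>sqrt n\<close> nearly does not increase from \<open>k\<close> to
  \<open>m\<^sup>2 * k\<close> (\<open>mean_mst_scaling\<close>), and therefore converges (\<open>scaling_subadditive_convergent\<close>).  The limit is
  positive by the lower bound on the mean.
\<close>

section \<open>Connectivity\<close>

definition joined :: "'a set set \<Rightarrow> 'a rel" where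
  "joined E = {(x, y). {x, y} \<in> E}\<^sup>*"

lemma connected_graph_joined: "connected_graph V E \<longleftrightarrow> (\<forall>u\<in>V. \<forall>v\<in>V. (u, v) \<in> joined E)"
  by (simp add: connected_graph_def joined_def)

lemma joined_refl [simp, intro]: "(x, x) \<in> joined E"
  by (simp add: joined_def)

lemma joined_sym: "(x, y) \<in> joined E \<Longrightarrow> (y, x) \<in> joined E"
proof -
  have "sym {(x, y). {x, y} \<in> E}"
    by (auto simp: sym_def insert_commute)
  then show "(x, y) \<in> joined E \<Longrightarrow> (y, x) \<in> joined E"
    unfolding joined_def by (meson sym_rtrancl symD)
qed

lemma joined_trans [trans]: "(x, y) \<in> joined E \<Longrightarrow> (y, z) \<in> joined E \<Longrightarrow> (x, z) \<in> joined E"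
  unfolding joined_def by (rule rtrancl_trans)

lemma joined_edge: "{x, y} \<in> E \<Longrightarrow> (x, y) \<in> joined E"
  unfolding joined_def by auto

lemma joined_induct [consumes 1, case_names base step]:
  assumes "(x, y) \<in> joined E" "P x"
    and "\<And>y z. (x, y) \<in> joined E \<Longrightarrow> {y, z} \<in> E \<Longrightarrow> P y \<Longrightarrow> P z"
  shows "P y"
  using assms(1) unfolding joined_def
  by (induction rule: rtrancl_induct) (use assms(2,3) in \<open>auto simp: joined_def\<close>)

lemma joined_subst:
  assumes "(x, y) \<in> joined E" "\<And>a b. {a, b} \<in> E \<Longrightarrow> (h a, h b) \<in> joined F"
  shows "(h x, h y) \<in> joined F"
  using assms(1) by (induction rule: joined_induct) (auto intro: joined_trans assms(2))

lemma joined_mono: "(x, y) \<in> joined E \<Longrightarrow> E \<subseteq> F \<Longrightarrow> (x, y) \<in> joined F"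
  using joined_subst[of x y E "\<lambda>x. x" F] by (auto intro: joined_edge)

lemma joined_image:
  assumes "(x, y) \<in> joined E"
  shows "(h x, h y) \<in> joined ((`) h ` E)"
proof (rule joined_subst[OF assms])
  fix a b assume "{a, b} \<in> E"
  then have "h ` {a, b} \<in> (`) h ` E" by blast
  then show "(h a, h b) \<in> joined ((`) h ` E)" by (intro joined_edge) simp
qed

lemma joined_insertD:
  assumes "(x, y) \<in> joined (insert {a, b} E)"
  shows "(x, y) \<in> joined E \<or> (x, a) \<in> joined E \<and> (b, y) \<in> joined E
    \<or> (x, b) \<in> joined E \<and> (a, y) \<in> joined E"
  using assms
proof (induction rule: joined_induct)
  case base
  then show ?case by simp
next
  case (step y z)
  from step(2) consider "{y, z} \<in> E" | "y = a" "z = b" | "y = b" "z = a"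
    by (auto simp: doubleton_eq_iff)
  then show ?case
  proof cases
    case 1
    then show ?thesis using step(3) by (meson joined_edge joined_trans)
  next
    case 2
    then show ?thesis using step(3) by (auto dest: joined_sym intro: joined_trans)
  next
    case 3
    then show ?thesis using step(3) by (auto dest: joined_sym intro: joined_trans)
  qed
qed

lemma joined_bridge:
  assumes "(x, y) \<in> joined (insert {a, b} E)" "(a, b) \<in> joined F" "E \<subseteq> F"
  shows "(x, y) \<in> joined F"
proof (rule joined_subst[OF assms(1), of "\<lambda>x. x"])
  fix c d assume "{c, d} \<in> insert {a, b} E"
  then show "(c, d) \<in> joined F"
    using assms(2,3) by (auto simp: doubleton_eq_iff intro: joined_edge joined_sym)
qed

lemma finite_complete_edges: "finite V \<Longrightarrow> finite (complete_edges V)"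
proof -
  assume "finite V"
  moreover have "complete_edges V \<subseteq> Pow V" by (auto simp: complete_edges_def)
  ultimately show ?thesis by (meson finite_Pow_iff finite_subset)
qed

lemma diameter_edge_nonneg: "e \<in> complete_edges V \<Longrightarrow> 0 \<le> diameter e"
  by (auto simp: complete_edges_def diameter_edge)

section \<open>The minimum spanning tree as a minimal connected graph\<close>

text \<open>An edge of a cycle is redundant, since the rest of the cycle joins its endpoints; discarding
  such edges as long as there are any leaves a tree.\<close>

lemma connected_graph_contains_spanning_tree:
  assumes "finite E" "E \<subseteq> complete_edges V" "connected_graph V E"
  shows "\<exists>T\<subseteq>E. spanning_tree V T"
  using assms
proof (induction E rule: finite_psubset_induct)
  case (psubset E)
  show ?case
  proof (cases "\<exists>p. is_cycle E p")
    case False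
    then show ?thesis using psubset by (auto simp: spanning_tree_def)
  next
    case True
    then obtain p where p: "3 \<le> length p" "distinct p"
      and edge: "\<And>i. i < length p \<Longrightarrow> {p ! i, p ! (Suc i mod length p)} \<in> E"
      by (auto simp: is_cycle_def)
    define e where "e = {p ! 0, p ! 1}"
    have "p \<noteq> []" using p(1) by auto
    then have eE: "e \<in> E" using edge[of 0] p by (simp add: e_def)
    have lp: "0 < length p" "1 < length p" using p(1) by auto
    have neq: "p ! i = p ! j \<longleftrightarrow> i = j" if "i < length p" "j < length p" for i j
      using p(2) that by (simp add: nth_eq_iff_index_eq)
    have walk: "(p ! 1, p ! Suc i) \<in> joined (E - {e})" if "Suc i < length p" for i
      using that
    proof (induction i)
      case 0 then show ?case by simp
    next
      case (Suc i)
      have "{p ! Suc i, p ! Suc (Suc i)} \<noteq> e"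
        using Suc.prems lp neq[of 0 "Suc i"] neq[of 1 "Suc i"] neq[of 0 "Suc (Suc i)"]
          neq[of 1 "Suc (Suc i)"] by (auto simp: e_def doubleton_eq_iff)
      then have "{p ! Suc i, p ! Suc (Suc i)} \<in> E - {e}"
        using edge[of "Suc i"] Suc.prems by simp
      then show ?case using Suc by (meson Suc_lessD joined_edge joined_trans)
    qed
    define l where "l = length p - 2"
    have l: "length p = Suc (Suc l)" "l \<noteq> 0" using p(1) by (auto simp: l_def)
    have "{p ! Suc l, p ! 0} \<noteq> e"
      using l neq[of 0 "Suc l"] neq[of 1 "Suc l"] neq[of 1 0] by (auto simp: e_def doubleton_eq_iff)
    moreover have "{p ! Suc l, p ! 0} \<in> E" using edge[of "Suc l"] l by simp
    ultimately have "(p ! Suc l, p ! 0) \<in> joined (E - {e})" by (intro joined_edge) simp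
    with walk[of l] l have "(p ! 1, p ! 0) \<in> joined (E - {e})"
      by (auto intro: joined_trans)
    then have "(p ! 0, p ! 1) \<in> joined (E - {e})" by (rule joined_sym)
    moreover have "E = insert {p ! 0, p ! 1} (E - {e})" using eE by (auto simp: e_def)
    ultimately have "(x, y) \<in> joined (E - {e})" if "(x, y) \<in> joined E" for x y
      using that joined_bridge[of x y "p ! 0" "p ! 1" "E - {e}" "E - {e}"] by auto
    then have "connected_graph V (E - {e})"
      using psubset.prems by (auto simp: connected_graph_joined)
    moreover have "E - {e} \<subset> E" using eE by blast
    ultimately have "\<exists>T\<subseteq>E - {e}. spanning_tree V T"
      using psubset.IH[of "E - {e}"] psubset.prems by blast
    then show ?thesis by blast
  qed
qed

lemma edges_length_nonneg: "T \<subseteq> complete_edges V \<Longrightarrow> 0 \<le> edges_length T"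
  unfolding edges_length_def by (rule sum_nonneg) (auto dest: diameter_edge_nonneg)

lemma edges_length_mono:
  "finite F \<Longrightarrow> F \<subseteq> complete_edges V \<Longrightarrow> E \<subseteq> F \<Longrightarrow> edges_length E \<le> edges_length F"
  unfolding edges_length_def by (rule sum_mono2) (auto dest: diameter_edge_nonneg)

lemma finite_spanning_trees: "finite V \<Longrightarrow> finite {T. spanning_tree V T}"
  by (rule finite_subset[of _ "Pow (complete_edges V)"])
    (auto simp: spanning_tree_def finite_complete_edges)

text \<open>A minimum spanning tree is a connected graph of least total length, so a competitor only has to be
  connected, and every inequality below comes from exhibiting one.\<close>

definition minimal_connected :: "'a :: metric_space set \<Rightarrow> 'a set set \<Rightarrow> bool" where
  "minimal_connected V T \<longleftrightarrow>
     T \<subseteq> complete_edges V \<and> connected_graph V T \<and> edges_length T = mst_length V"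

lemma minimal_connected_exists:
  assumes "finite V"
  shows "\<exists>T. minimal_connected V T"
proof -
  have "connected_graph V (complete_edges V)"
    unfolding connected_graph_joined
  proof safe
    fix u v assume "u \<in> V" "v \<in> V"
    then show "(u, v) \<in> joined (complete_edges V)"
      by (cases "u = v") (auto simp: complete_edges_def intro!: joined_edge)
  qed
  then obtain T where "spanning_tree V T"
    using connected_graph_contains_spanning_tree[of "complete_edges V" V] assms
    by (auto simp: finite_complete_edges)
  then have "{T. spanning_tree V T} \<noteq> {}" by blast
  then have "mst_length V \<in> edges_length ` {T. spanning_tree V T}"
    unfolding mst_length_def using assms by (intro Min_in) (auto simp: finite_spanning_trees)
  then show ?thesis by (auto simp: minimal_connected_def spanning_tree_def)
qed

lemma mst_length_nonneg: "finite V \<Longrightarrow> 0 \<le> mst_length V"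
  using minimal_connected_exists edges_length_nonneg by (metis minimal_connected_def)

lemma mst_length_le_connected:
  assumes "finite V" "E \<subseteq> complete_edges V" "connected_graph V E"
  shows "mst_length V \<le> edges_length E"
proof -
  have fin: "finite E" using assms by (meson finite_complete_edges finite_subset)
  obtain T where T: "T \<subseteq> E" "spanning_tree V T"
    using connected_graph_contains_spanning_tree[OF fin assms(2,3)] by blast
  have "mst_length V \<le> edges_length T"
    unfolding mst_length_def using T assms(1) by (intro Min_le) (auto simp: finite_spanning_trees)
  also have "\<dots> \<le> edges_length E"
    using edges_length_mono[OF fin assms(2) T(1)] .
  finally show ?thesis .
qed

text \<open>Allowing a family of edges with repetitions and loops makes images of graphs easy to handle:
  loops have length zero and repetitions only increase the right-hand side.\<close>

lemma mst_length_le_family: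
  fixes V :: "'a :: metric_space set"
  assumes V: "finite V" and A: "finite A"
    and edge: "\<And>a. a \<in> A \<Longrightarrow> \<exists>u\<in>V. \<exists>v\<in>V. g a = {u, v}"
    and conn: "\<And>u v. u \<in> V \<Longrightarrow> v \<in> V \<Longrightarrow> (u, v) \<in> joined (g ` A)"
  shows "mst_length V \<le> (\<Sum>a\<in>A. diameter (g a))"
proof -
  define E where "E = g ` A \<inter> complete_edges V"
  have diam: "0 \<le> diameter (g a)" if "a \<in> A" for a
    using edge[OF that] by (auto simp: diameter_edge)
  have step: "(c, d) \<in> joined E" if cd: "{c, d} \<in> g ` A" for c d
  proof (cases "c = d")
    case False
    from cd edge have "\<exists>u\<in>V. \<exists>v\<in>V. {c, d} = {u, v}" by fastforce
    with False have "{c, d} \<in> complete_edges V"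
      by (auto simp: complete_edges_def doubleton_eq_iff)
    then show ?thesis using cd by (auto simp: E_def intro: joined_edge)
  qed simp
  have "connected_graph V E"
    unfolding connected_graph_joined
    using joined_subst[of _ _ "g ` A" "\<lambda>x. x" E] conn step by blast
  then have "mst_length V \<le> edges_length E"
    using V by (intro mst_length_le_connected) (auto simp: E_def)
  also have "\<dots> \<le> (\<Sum>e\<in>g ` A. diameter e)"
    unfolding edges_length_def by (rule sum_mono2) (use A diam in \<open>auto simp: E_def\<close>)
  also have "\<dots> \<le> (\<Sum>a\<in>A. diameter (g a))"
    using sum_image_le[of A diameter g] A diam by (simp add: comp_def)
  finally show ?thesis .
qed

lemma complete_edgesE:
  assumes "e \<in> complete_edges V"
  obtains u v where "e = {u, v}" "u \<in> V" "v \<in> V" "u \<noteq> v"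
  using assms by (auto simp: complete_edges_def)

text \<open>The image of a connected graph under \<open>h\<close> connects the image of its vertices, whether \<open>h\<close> moves
  vertices or identifies them.\<close>

lemma mst_length_image_le:
  assumes "finite V" "T \<subseteq> complete_edges V" "connected_graph V T"
  shows "mst_length (h ` V) \<le> (\<Sum>e\<in>T. diameter (h ` e))"
proof (rule mst_length_le_family)
  show "finite T" using assms by (meson finite_complete_edges finite_subset)
  fix e assume "e \<in> T"
  then obtain u v where "e = {u, v}" "u \<in> V" "v \<in> V"
    using assms(2) by (blast elim: complete_edgesE)
  then show "\<exists>x\<in>h ` V. \<exists>y\<in>h ` V. h ` e = {x, y}" by auto
next
  fix x y assume "x \<in> h ` V" "y \<in> h ` V"
  then show "(x, y) \<in> joined ((`) h ` T)"
    using assms(3) by (auto simp: connected_graph_joined intro: joined_image)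
qed (use assms in auto)

lemma mst_length_singleton [simp]: "mst_length ({x} :: 'a :: metric_space set) = 0"
proof -
  have "mst_length {x} \<le> edges_length ({} :: 'a set set)"
    by (rule mst_length_le_connected) (auto simp: connected_graph_joined)
  then show ?thesis using mst_length_nonneg[of "{x} :: 'a set"] by (simp add: edges_length_def)
qed

lemma mst_length_empty [simp]: "mst_length ({} :: 'a :: metric_space set) = 0"
proof -
  have "mst_length ({} :: 'a set) \<le> edges_length ({} :: 'a set set)"
    by (rule mst_length_le_connected) (auto simp: connected_graph_joined)
  then show ?thesis using mst_length_nonneg[of "{} :: 'a set"] by (simp add: edges_length_def)
qed

lemma mst_length_lipschitz_image:
  assumes "finite V" "\<And>x y. x \<in> V \<Longrightarrow> y \<in> V \<Longrightarrow> dist (h x) (h y) \<le> c * dist x y"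
  shows "mst_length (h ` V) \<le> c * mst_length V"
proof -
  obtain T where T: "T \<subseteq> complete_edges V" "connected_graph V T" "edges_length T = mst_length V"
    using minimal_connected_exists[OF assms(1)] by (auto simp: minimal_connected_def)
  have "mst_length (h ` V) \<le> (\<Sum>e\<in>T. diameter (h ` e))"
    by (rule mst_length_image_le[OF assms(1) T(1,2)])
  also have "\<dots> \<le> (\<Sum>e\<in>T. c * diameter e)"
  proof (rule sum_mono)
    fix e assume "e \<in> T"
    with T(1) obtain u v where "e = {u, v}" "u \<in> V" "v \<in> V" by (blast elim: complete_edgesE)
    then show "diameter (h ` e) \<le> c * diameter e" using assms(2) by (simp add: diameter_edge)
  qed
  also have "\<dots> = c * mst_length V" using T(3) by (simp add: edges_length_def flip: sum_distrib_left)
  finally show ?thesis .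
qed

text \<open>Minimum spanning trees of the parts, together with one of a set of representatives, connect
  the whole set.\<close>

lemma mst_length_partition_le:
  fixes V :: "'i \<Rightarrow> 'a :: metric_space set"
  assumes Q: "finite Q" and V: "\<And>q. q \<in> Q \<Longrightarrow> finite (V q)" and r: "\<And>q. q \<in> Q \<Longrightarrow> r q \<in> V q"
  shows "mst_length (\<Union>q\<in>Q. V q) \<le> (\<Sum>q\<in>Q. mst_length (V q)) + mst_length (r ` Q)"
proof -
  have "\<exists>T. minimal_connected (V q) T" if "q \<in> Q" for q
    using minimal_connected_exists[OF V[OF that]] .
  then obtain T where T: "\<And>q. q \<in> Q \<Longrightarrow> minimal_connected (V q) (T q)" by metis
  obtain R where R: "R \<subseteq> complete_edges (r ` Q)" "connected_graph (r ` Q) R"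
    "edges_length R = mst_length (r ` Q)"
    using minimal_connected_exists[of "r ` Q"] Q by (auto simp: minimal_connected_def)
  have finT: "finite (T q)" if "q \<in> Q" for q
    using T[OF that] finite_complete_edges[OF V[OF that]]
    by (auto simp: minimal_connected_def intro: finite_subset)
  have finR: "finite R" using R(1) finite_complete_edges[of "r ` Q"] Q by (auto intro: finite_subset)
  define A where "A = (SIGMA q:Q. T q) <+> R"
  define g where "g = case_sum (snd :: 'i \<times> 'a set \<Rightarrow> 'a set) (\<lambda>e. e)"
  have gA: "g ` A = (\<Union>q\<in>Q. T q) \<union> R"
    unfolding A_def g_def Plus_def by (simp add: image_Un image_image snd_image_Sigma)
  have "mst_length (\<Union>q\<in>Q. V q) \<le> (\<Sum>a\<in>A. diameter (g a))"
  proof (rule mst_length_le_family)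
    show "finite (\<Union>q\<in>Q. V q)" using Q V by blast
    show "finite A" using Q finT finR by (auto simp: A_def)
  next
    fix a assume "a \<in> A"
    then have "g a \<in> (\<Union>q\<in>Q. T q) \<union> R" using gA by blast
    then consider q where "q \<in> Q" "g a \<in> complete_edges (V q)" | "g a \<in> complete_edges (r ` Q)"
      using T R(1) by (auto simp: minimal_connected_def)
    then show "\<exists>u\<in>\<Union>q\<in>Q. V q. \<exists>v\<in>\<Union>q\<in>Q. V q. g a = {u, v}"
    proof cases
      case 1
      obtain u v where "g a = {u, v}" "u \<in> V q" "v \<in> V q" using 1(2) by (rule complete_edgesE)
      moreover have "V q \<subseteq> (\<Union>q\<in>Q. V q)" using 1(1) by blast
      ultimately have "u \<in> (\<Union>q\<in>Q. V q)" "v \<in> (\<Union>q\<in>Q. V q)" by (meson subsetD)+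
      with \<open>g a = {u, v}\<close> show ?thesis by metis
    next
      case 2
      then obtain u v where "g a = {u, v}" "u \<in> r ` Q" "v \<in> r ` Q" by (rule complete_edgesE)
      moreover have "r ` Q \<subseteq> (\<Union>q\<in>Q. V q)" using r by blast
      ultimately have "u \<in> (\<Union>q\<in>Q. V q)" "v \<in> (\<Union>q\<in>Q. V q)" by (meson subsetD)+
      with \<open>g a = {u, v}\<close> show ?thesis by metis
    qed
  next
    fix u v assume "u \<in> (\<Union>q\<in>Q. V q)" "v \<in> (\<Union>q\<in>Q. V q)"
    then obtain q p where q: "q \<in> Q" "u \<in> V q" and p: "p \<in> Q" "v \<in> V p" by blast
    have loc: "(x, y) \<in> joined (g ` A)" if "q \<in> Q" "x \<in> V q" "y \<in> V q" for q x y
    proof (rule joined_mono)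
      show "(x, y) \<in> joined (T q)"
        using T[OF that(1)] that by (auto simp: minimal_connected_def connected_graph_joined)
      show "T q \<subseteq> g ` A" using that gA by blast
    qed
    have "(u, r q) \<in> joined (g ` A)" using loc[OF q r[OF q(1)]] .
    also have "(r q, r p) \<in> joined (g ` A)"
      by (rule joined_mono[of _ _ R]) (use R(2) q p gA in \<open>auto simp: connected_graph_joined\<close>)
    also have "(r p, v) \<in> joined (g ` A)" using loc[OF p(1) r[OF p(1)] p(2)] .
    finally show "(u, v) \<in> joined (g ` A)" .
  qed
  also have "\<dots> = (\<Sum>a\<in>(SIGMA q:Q. T q). diameter (g (Inl a))) + (\<Sum>a\<in>R. diameter (g (Inr a)))"
    unfolding A_def using Q finT finR by (subst sum.Plus) auto
  also have "(\<Sum>a\<in>(SIGMA q:Q. T q). diameter (g (Inl a))) = (\<Sum>q\<in>Q. \<Sum>e\<in>T q. diameter e)"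
    using Q finT by (subst sum.Sigma) (auto simp: g_def case_prod_beta)
  also have "(\<Sum>q\<in>Q. \<Sum>e\<in>T q. diameter e) = (\<Sum>q\<in>Q. mst_length (V q))"
    using T by (intro sum.cong) (auto simp: minimal_connected_def edges_length_def)
  also have "(\<Sum>a\<in>R. diameter (g (Inr a))) = mst_length (r ` Q)"
    using R(3) by (simp add: g_def edges_length_def)
  finally show ?thesis .
qed

lemma mst_length_pair: "mst_length {u, v} \<le> dist u v"
proof -
  have "mst_length {u, v} \<le> (\<Sum>e\<in>{{u, v}}. diameter e)"
    by (rule mst_length_le_family) (auto intro: joined_edge simp: insert_commute)
  then show ?thesis by (simp add: diameter_edge)
qed

lemma mst_length_union_le:
  assumes "finite V" "finite W" "v \<in> V" "w \<in> W"
  shows "mst_length (V \<union> W) \<le> mst_length V + mst_length W + dist v w"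
proof -
  have "mst_length (\<Union>q\<in>UNIV. if q then V else W)
      \<le> (\<Sum>q\<in>UNIV. mst_length (if q then V else W)) + mst_length ((\<lambda>q. if q then v else w) ` UNIV)"
    using assms by (intro mst_length_partition_le) auto
  then show ?thesis using mst_length_pair[of w v] by (auto simp: UNIV_bool dist_commute Un_commute)
qed

lemma mst_length_insert_le:
  "finite V \<Longrightarrow> v \<in> V \<Longrightarrow> mst_length (insert w V) \<le> mst_length V + dist v w"
  using mst_length_union_le[of V "{w}" v w] by simp

text \<open>Deleting a vertex amounts to contracting it to its nearest neighbour \<open>y\<^sub>0\<close> in the tree:
  an edge \<open>{v, y}\<close> becomes \<open>{y\<^sub>0, y}\<close>, of length at most twice that of \<open>{v, y}\<close>.\<close>

lemma mst_length_delete_le: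
  assumes V: "finite V" and T: "minimal_connected V T" and v: "v \<in> V"
  shows "mst_length (V - {v}) \<le> mst_length V + (\<Sum>e\<in>{e\<in>T. v \<in> e}. diameter e)"
proof (cases "V = {v}")
  case True
  then show ?thesis using T by (auto simp: minimal_connected_def intro!: sum_nonneg
    dest: diameter_edge_nonneg)
next
  case False
  have T': "T \<subseteq> complete_edges V" "connected_graph V T" "edges_length T = mst_length V"
    using T by (auto simp: minimal_connected_def)
  have fin: "finite T" using T'(1) V by (meson finite_complete_edges finite_subset)
  define N where "N = {y. {v, y} \<in> T}"
  have NV: "N \<subseteq> V - {v}"
    using T'(1) by (auto simp: N_def complete_edges_def doubleton_eq_iff)
  have finN: "finite N" using NV V by (meson finite_Diff finite_subset)
  obtain w where w: "w \<in> V" "w \<noteq> v" using False v by auto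
  then have "(v, w) \<in> joined T" using T'(2) v by (auto simp: connected_graph_joined)
  then obtain y where "(v, y) \<in> {(x, y). {x, y} \<in> T}"
    unfolding joined_def using w(2) by (metis converse_rtranclE)
  then have "N \<noteq> {}" by (auto simp: N_def)
  then obtain y0 where y0: "y0 \<in> N" "\<And>y. y \<in> N \<Longrightarrow> dist v y0 \<le> dist v y"
    using finN ex_min_if_finite[of "dist v ` N"] by (force simp: not_less)
  define h where "h = (\<lambda>x. if x = v then y0 else x)"
  have hV: "h ` V = V - {v}" using y0(1) NV v by (force simp: h_def)
  have "mst_length (V - {v}) \<le> (\<Sum>e\<in>T. diameter (h ` e))"
    using mst_length_image_le[OF V T'(1,2), of h] by (simp add: hV)
  also have "\<dots> \<le> (\<Sum>e\<in>T. diameter e + (if v \<in> e then diameter e else 0))"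
  proof (rule sum_mono)
    fix e assume e: "e \<in> T"
    show "diameter (h ` e) \<le> diameter e + (if v \<in> e then diameter e else 0)"
    proof (cases "v \<in> e")
      case True
      obtain a b where "e = {a, b}" "a \<noteq> b" using e T'(1) by (blast elim: complete_edgesE)
      with True obtain y where y: "e = {v, y}" "y \<noteq> v" by auto
      then have "y \<in> N" using e by (simp add: N_def)
      then have "dist y0 y \<le> 2 * dist v y"
        using y0(2)[of y] dist_triangle3[of y0 y v] by simp
      then show ?thesis using y by (simp add: h_def diameter_edge dist_commute)
    next
      case False
      then have "h ` e = e" by (auto simp: h_def image_iff)
      then show ?thesis using False by simp
    qed
  qed
  also have "\<dots> = mst_length V + (\<Sum>e\<in>{e\<in>T. v \<in> e}. diameter e)"
    using T'(3) fin by (simp add: sum.distrib edges_length_def sum.If_cases Int_def)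
  finally show ?thesis .
qed

text \<open>If \<open>{c, d}\<close> closes the gap that removing \<open>{a, b}\<close> might leave, then the exchanged graph is
  connected and thus at least as long.\<close>

lemma mst_length_edge_exchange:
  fixes V :: "'a :: metric_space set"
  assumes V: "finite V" and T: "minimal_connected V T" and e: "{a, b} \<in> T" and cd: "c \<in> V" "d \<in> V"
    and conn: "(a, b) \<in> joined (insert {c, d} (T - {{a, b}}))"
  shows "dist a b \<le> dist c d"
proof -
  have T': "T \<subseteq> complete_edges V" "connected_graph V T" "edges_length T = mst_length V"
    using T by (auto simp: minimal_connected_def)
  have fin: "finite T" using T'(1) V by (meson finite_complete_edges finite_subset)
  have T_eq: "insert {a, b} (T - {{a, b}}) = T" using e by blast
  let ?E = "insert {c, d} (T - {{a, b}})"
  have "mst_length V \<le> (\<Sum>e\<in>?E. diameter e)"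
  proof (rule mst_length_le_family[of V ?E "\<lambda>e. e"])
    fix e assume "e \<in> ?E"
    then show "\<exists>u\<in>V. \<exists>v\<in>V. e = {u, v}"
      using T'(1) cd by (auto elim!: complete_edgesE)
  next
    fix u v assume "u \<in> V" "v \<in> V"
    then have "(u, v) \<in> joined (insert {a, b} (T - {{a, b}}))"
      using T'(2) unfolding T_eq by (auto simp: connected_graph_joined)
    then show "(u, v) \<in> joined ((\<lambda>e. e) ` ?E)"
      using joined_bridge[OF _ conn, of u v "T - {{a, b}}"] by auto
  qed (use V fin in auto)
  also have "\<dots> \<le> dist c d + (\<Sum>e\<in>T - {{a, b}}. diameter e)"
    using fin by (simp add: sum.insert_if diameter_edge)
  also have "(\<Sum>e\<in>T - {{a, b}}. diameter e) = mst_length V - dist a b"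
    using fin e T'(3) by (simp add: sum_diff1 edges_length_def diameter_edge)
  finally show ?thesis by simp
qed

text \<open>Each edge may be counted only once although a walk may repeat it.  This is why the induction removes
  the first edge of the walk from the graph before looking at the rest of the walk.\<close>

lemma joined_variation:
  fixes \<phi> :: "'a \<Rightarrow> real"
  assumes "finite E" "E \<subseteq> complete_edges V" "(x, y) \<in> joined E"
  shows "\<phi> y - \<phi> x \<le> (\<Sum>e\<in>E. diameter (\<phi> ` e))"
  using assms
proof (induction E arbitrary: x rule: finite_psubset_induct)
  case (psubset E)
  have diam: "0 \<le> diameter (\<phi> ` e)" if "e \<in> E" for e
    using that psubset.prems(1) by (auto elim!: complete_edgesE simp: diameter_edge)
  have sum: "(\<Sum>e\<in>E. diameter (\<phi> ` e)) = diameter (\<phi> ` e) + (\<Sum>e\<in>E - {e}. diameter (\<phi> ` e))"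
    if "e \<in> E" for e
    using that psubset.hyps by (simp add: sum.remove)
  show ?case
  proof (cases "x = y")
    case True
    then show ?thesis using diam by (simp add: sum_nonneg)
  next
    case False
    then obtain z where xz: "{x, z} \<in> E" and zy: "(z, y) \<in> joined E"
      using psubset.prems(2) unfolding joined_def by (auto elim: converse_rtranclE)
    let ?F = "E - {{x, z}}"
    have "insert {x, z} ?F = E" using xz by blast
    with zy have "(z, y) \<in> joined (insert {x, z} ?F)" by simp
    \<comment> \<open>Either the rest of the walk does without this edge, or the edge was used in vain.\<close>
    from joined_insertD[OF this] have "(z, y) \<in> joined ?F \<or> (x, y) \<in> joined ?F" by blast
    then show ?thesis
    proof
      assume "(z, y) \<in> joined ?F"
      then have "\<phi> y - \<phi> z \<le> (\<Sum>e\<in>?F. diameter (\<phi> ` e))"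
        using psubset.prems xz by (intro psubset.IH) auto
      moreover have "diameter (\<phi> ` {x, z}) = \<bar>\<phi> x - \<phi> z\<bar>"
        by (simp add: diameter_edge dist_real_def)
      ultimately show ?thesis using sum[OF xz] by linarith
    next
      assume "(x, y) \<in> joined ?F"
      then have "\<phi> y - \<phi> x \<le> (\<Sum>e\<in>?F. diameter (\<phi> ` e))"
        using psubset.prems xz by (intro psubset.IH) auto
      then show ?thesis using sum[OF xz] diam[OF xz] by linarith
    qed
  qed
qed

text \<open>The bumps \<open>x \<mapsto> max 0 (\<rho> - dist w x)\<close>, \<open>w \<in> W\<close>, are 1-Lipschitz, and each of them varies by
  \<open>\<rho>\<close> along the tree as soon as the tree leaves its support.  If no point lies in more than \<open>K\<close>
  supports, then an edge changes at most \<open>2 K\<close> bumps, those whose support contains an endpoint.\<close>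

lemma mst_length_ge_bumps:
  fixes V :: "'a :: metric_space set" and \<rho> :: real and K :: nat
  assumes V: "finite V" and W: "W \<subseteq> V" and \<rho>: "0 \<le> \<rho>"
    and overlap: "\<And>x. x \<in> V \<Longrightarrow> card {w\<in>W. dist w x < \<rho>} \<le> K"
    and large: "K < card W"
  shows "card W * \<rho> \<le> 2 * K * mst_length V"
proof -
  obtain T where T: "T \<subseteq> complete_edges V" "connected_graph V T" "edges_length T = mst_length V"
    using minimal_connected_exists[OF V] by (auto simp: minimal_connected_def)
  have fin: "finite T" using T(1) V by (meson finite_complete_edges finite_subset)
  have finW: "finite W" using W V by (rule finite_subset)
  define \<phi> where "\<phi> w x = max 0 (\<rho> - dist w x)" for w x :: 'a
  have variation: "\<rho> \<le> (\<Sum>e\<in>T. diameter (\<phi> w ` e))" if w: "w \<in> W" for w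
  proof -
    have "\<exists>v\<in>W. \<not> dist v w < \<rho>"
    proof (rule ccontr)
      assume "\<not> ?thesis"
      then have "{v\<in>W. dist v w < \<rho>} = W" by auto
      then show False using overlap[of w] large w W by auto
    qed
    then obtain v where v: "v \<in> W" "\<phi> w v = 0" by (auto simp: \<phi>_def dist_commute)
    have "(v, w) \<in> joined T" using T(2) v w W by (auto simp: connected_graph_joined)
    from joined_variation[OF fin T(1) this, of "\<phi> w"] show ?thesis
      using v \<rho> by (simp add: \<phi>_def)
  qed
  have edge: "(\<Sum>w\<in>W. diameter (\<phi> w ` e)) \<le> 2 * K * diameter e" if "e \<in> T" for e
  proof -
    from that T(1) obtain u v where e: "e = {u, v}" "u \<in> V" "v \<in> V" by (blast elim: complete_edgesE)
    define S where "S = {w\<in>W. dist w u < \<rho>} \<union> {w\<in>W. dist w v < \<rho>}"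
    have S: "S \<subseteq> W" by (auto simp: S_def)
    have "card S \<le> 2 * K"
      using card_Un_le[of "{w\<in>W. dist w u < \<rho>}" "{w\<in>W. dist w v < \<rho>}"] overlap[OF e(2)]
        overlap[OF e(3)] by (simp add: S_def)
    have lip: "\<bar>\<phi> w u - \<phi> w v\<bar> \<le> dist u v" for w
      using dist_triangle[of w u v] dist_triangle[of w v u]
      by (auto simp: \<phi>_def dist_commute)
    have "(\<Sum>w\<in>W. diameter (\<phi> w ` e)) = (\<Sum>w\<in>S. diameter (\<phi> w ` e))"
      by (rule sum.mono_neutral_right) (use finW S in \<open>auto simp: S_def e(1) diameter_edge \<phi>_def\<close>)
    also have "\<dots> \<le> (\<Sum>w\<in>S. diameter e)"
      by (rule sum_mono) (use lip in \<open>simp add: e(1) diameter_edge dist_real_def\<close>)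
    also have "\<dots> = card S * diameter e" by simp
    also have "\<dots> \<le> (2 * K) * diameter e"
      using \<open>card S \<le> 2 * K\<close> by (intro mult_right_mono) (auto simp: e(1) diameter_edge)
    finally show ?thesis by simp
  qed
  have "card W * \<rho> = (\<Sum>w\<in>W. \<rho>)" by simp
  also have "\<dots> \<le> (\<Sum>w\<in>W. \<Sum>e\<in>T. diameter (\<phi> w ` e))" by (rule sum_mono) (rule variation)
  also have "\<dots> = (\<Sum>e\<in>T. \<Sum>w\<in>W. diameter (\<phi> w ` e))" by (rule sum.swap)
  also have "\<dots> \<le> (\<Sum>e\<in>T. 2 * K * diameter e)" by (rule sum_mono) (rule edge)
  also have "\<dots> = 2 * K * mst_length V"
    using T(3) by (simp add: edges_length_def flip: sum_distrib_left)
  finally show ?thesis .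
qed

text \<open>Measurability of the length in the vertices: over a finite index set, it is the minimum of
  finitely many sums of distances, one for each connected graph on the \<^emph>\<open>indices\<close>.  Vertices may
  coincide; a tree on the vertices is lifted to the indices by joining the indices of equal
  vertices by edges of length zero.\<close>

lemma mst_length_eq_Min_index_graphs:
  fixes x :: "'i \<Rightarrow> 'a :: metric_space"
  assumes I: "finite I"
  shows "mst_length (x ` I) =
    Min ((\<lambda>E. \<Sum>e\<in>E. diameter (x ` e)) ` {E. E \<subseteq> complete_edges I \<and> connected_graph I E})"
    (is "_ = Min (?L ` ?G)")
proof (rule Min_eqI[symmetric])
  have "?G \<subseteq> Pow (complete_edges I)" by blast
  then show "finite (?L ` ?G)"
    using finite_complete_edges[OF I] by (meson finite_Pow_iff finite_imageI finite_subset)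
  show "mst_length (x ` I) \<le> y" if "y \<in> ?L ` ?G" for y
    using that mst_length_image_le[OF I] by auto
  obtain T where T: "T \<subseteq> complete_edges (x ` I)" "connected_graph (x ` I) T"
    "edges_length T = mst_length (x ` I)"
    using minimal_connected_exists[of "x ` I"] I by (auto simp: minimal_connected_def)
  have finT: "finite T" using T(1) finite_complete_edges[of "x ` I"] I by (auto intro: finite_subset)
  define s where "s v = (SOME i. i \<in> I \<and> x i = v)" for v
  have s: "s v \<in> I" "x (s v) = v" if "v \<in> x ` I" for v
    using that someI_ex[of "\<lambda>i. i \<in> I \<and> x i = v"] by (auto simp: s_def)
  define Z where "Z = {{i, s (x i)} | i. i \<in> I \<and> i \<noteq> s (x i)}"
  define E where "E = (`) s ` T \<union> Z"
  have sT: "\<exists>u v. e = {u, v} \<and> u \<in> x ` I \<and> v \<in> x ` I \<and> s u \<noteq> s v" if "e \<in> T" for e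
    using that T(1) s(2) by (metis complete_edgesE subsetD)
  have Esub: "E \<subseteq> complete_edges I"
  proof
    fix e assume "e \<in> E"
    then consider e' where "e = s ` e'" "e' \<in> T" | "e \<in> Z" by (auto simp: E_def)
    then show "e \<in> complete_edges I"
    proof cases
      case 1
      obtain u v where "e' = {u, v}" "u \<in> x ` I" "v \<in> x ` I" "s u \<noteq> s v"
        using sT[OF 1(2)] by blast
      then have "e = {s u, s v}" "s u \<in> I" "s v \<in> I" "s u \<noteq> s v" using 1(1) s(1) by auto
      then show ?thesis unfolding complete_edges_def by blast
    next
      case 2
      then show ?thesis using s(1) by (auto simp: Z_def complete_edges_def)
    qed
  qed
  have to_s: "(i, s (x i)) \<in> joined E" if "i \<in> I" for i
    using that by (cases "i = s (x i)") (auto simp: E_def Z_def intro!: joined_edge)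
  have conn: "connected_graph I E"
    unfolding connected_graph_joined
  proof safe
    fix i j assume ij: "i \<in> I" "j \<in> I"
    note to_s[OF ij(1)]
    also have "(s (x i), s (x j)) \<in> joined ((`) s ` T)"
      using T(2) ij by (auto simp: connected_graph_joined intro: joined_image)
    then have "(s (x i), s (x j)) \<in> joined E" by (rule joined_mono) (auto simp: E_def)
    also have "(s (x j), j) \<in> joined E" using joined_sym[OF to_s[OF ij(2)]] .
    finally show "(i, j) \<in> joined E" .
  qed
  have "?L E = (\<Sum>e\<in>(`) s ` T. diameter (x ` e))"
  proof (rule sum.mono_neutral_right)
    show "finite E" using Esub finite_complete_edges[OF I] by (rule finite_subset)
    show "\<forall>e\<in>E - (`) s ` T. diameter (x ` e) = 0"
      using s(2) by (auto simp: E_def Z_def diameter_edge)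
  qed (auto simp: E_def)
  also have "\<dots> \<le> (\<Sum>e\<in>T. diameter (x ` s ` e))"
    using sum_image_le[OF finT, of "\<lambda>e. diameter (x ` e)" "(`) s"] sT
    by (fastforce simp: comp_def diameter_edge)
  also have "\<dots> = (\<Sum>e\<in>T. diameter e)"
  proof (rule sum.cong)
    fix e assume "e \<in> T"
    then obtain u v where "e = {u, v}" "u \<in> x ` I" "v \<in> x ` I" using sT by blast
    then show "diameter (x ` s ` e) = diameter e" using s(2) by simp
  qed simp
  also have "\<dots> = mst_length (x ` I)" using T(3) by (simp add: edges_length_def)
  finally have "?L E \<le> mst_length (x ` I)" .
  moreover have "mst_length (x ` I) \<le> ?L E" by (rule mst_length_image_le[OF I Esub conn])
  ultimately show "mst_length (x ` I) \<in> ?L ` ?G"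
    using Esub conn by (intro image_eqI[of _ _ E]) auto
qed

lemma borel_measurable_mst_length:
  fixes x :: "'w \<Rightarrow> 'i \<Rightarrow> 'a :: {metric_space, second_countable_topology}"
  assumes "finite I" "\<And>i. i \<in> I \<Longrightarrow> (\<lambda>\<omega>. x \<omega> i) \<in> borel_measurable M"
  shows "(\<lambda>\<omega>. mst_length (x \<omega> ` I)) \<in> borel_measurable M"
proof -
  have "(\<lambda>\<omega>. \<Sum>e\<in>E. diameter (x \<omega> ` e)) \<in> borel_measurable M" if "E \<subseteq> complete_edges I" for E
  proof (rule borel_measurable_sum)
    fix e assume "e \<in> E"
    with that obtain i j where ij: "e = {i, j}" "i \<in> I" "j \<in> I" by (blast elim: complete_edgesE)
    show "(\<lambda>\<omega>. diameter (x \<omega> ` e)) \<in> borel_measurable M"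
      using assms(2)[OF ij(2)] assms(2)[OF ij(3)] by (simp add: ij(1) diameter_edge)
  qed
  moreover have "finite {E. E \<subseteq> complete_edges I \<and> connected_graph I E}"
    using finite_complete_edges[OF assms(1)] by (auto intro: finite_subset[of _ "Pow (complete_edges I)"])
  ultimately show ?thesis
    unfolding mst_length_eq_Min_index_graphs[OF assms(1)]
    by (intro borel_measurable_Min) auto
qed

section \<open>Upper bounds in the unit square\<close>

lemma dist_le_abs: "dist p q \<le> \<bar>fst p - fst q\<bar> + \<bar>snd p - snd q\<bar>" for p q :: "real \<times> real"
  unfolding dist_prod_def dist_real_def using sqrt_sum_squares_le_sum_abs by simp

text \<open>Insert the points in increasing order of \<open>\<psi>\<close>, joining each one to its predecessor.  The differences of
  \<open>\<psi>\<close> telescope.\<close>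

lemma mst_length_le_ordering_key:
  fixes V :: "'a :: metric_space set" and \<psi> :: "'a \<Rightarrow> real"
  assumes V: "finite V" and h: "0 \<le> h" and lo: "\<And>p. p \<in> V \<Longrightarrow> lo \<le> \<psi> p"
    and hi: "\<And>p. p \<in> V \<Longrightarrow> \<psi> p \<le> hi" and lohi: "lo \<le> hi"
    and key: "\<And>p q. p \<in> V \<Longrightarrow> q \<in> V \<Longrightarrow> \<psi> p \<le> \<psi> q \<Longrightarrow> dist p q \<le> \<psi> q - \<psi> p + h"
  shows "mst_length V \<le> hi - lo + h * card V"
proof -
  have "W \<noteq> {} \<longrightarrow> (\<exists>p\<in>W. (\<forall>q\<in>W. \<psi> q \<le> \<psi> p) \<and> mst_length W \<le> \<psi> p - lo + h * card W)"
    if "W \<subseteq> V" for W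
    using finite_subset[OF that V] that
  proof (induction W rule: finite_ranking_induct[where f = \<psi>])
    case empty
    then show ?case by simp
  next
    case (insert x S)
    show ?case
    proof (cases "S = {} \<or> x \<in> S")
      case True
      then show ?thesis
        using insert.IH insert.prems h lo[of x] by (auto simp: insert_absorb)
    next
      case False
      then obtain p where p: "p \<in> S" "mst_length S \<le> \<psi> p - lo + h * card S"
        using insert.IH insert.prems by auto
      have "mst_length (insert x S) \<le> mst_length S + dist p x"
        using insert.hyps p by (intro mst_length_insert_le)
      also have "dist p x \<le> \<psi> x - \<psi> p + h"
        using insert.prems insert.hyps p by (intro key) auto
      also have "mst_length S + (\<psi> x - \<psi> p + h) \<le> \<psi> x - lo + h * card (insert x S)"
        using p(2) insert.hyps False by (simp add: algebra_simps)
      finally show ?thesis using insert.hyps by auto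
    qed
  qed
  from this[of V] obtain p where "V \<noteq> {} \<Longrightarrow> p \<in> V \<and> mst_length V \<le> \<psi> p - lo + h * card V"
    by blast
  then show ?thesis using hi[of p] lohi by (cases "V = {}") auto
qed

lemma abs_scaled_diff: "0 < c \<Longrightarrow> \<bar>c * s - c * t\<bar> = c * \<bar>s - t\<bar>" for c s t :: real
  by (simp add: abs_mult flip: right_diff_distrib)

lemma floor_scaled_diff_le:
  fixes m s t :: real
  assumes "0 < m"
  shows "\<bar>s - t\<bar> \<le> (\<bar>real_of_int (\<lfloor>m * s\<rfloor> - \<lfloor>m * t\<rfloor>)\<bar> + 1) / m"
proof -
  have "\<bar>m * s - m * t\<bar> \<le> \<bar>real_of_int (\<lfloor>m * s\<rfloor> - \<lfloor>m * t\<rfloor>)\<bar> + 1"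
    by linarith
  moreover have "\<bar>m * s - m * t\<bar> = m * \<bar>s - t\<bar>"
    using assms by (rule abs_scaled_diff)
  ultimately show ?thesis using assms by (simp add: field_simps)
qed

text \<open>Cut the square into rows of height \<open>1 / m\<close> and walk through each of them from left to right.  In the
  key \<open>\<psi>\<close> a row counts \<open>2 + 1 / m\<close>: the horizontal distance \<open>\<bar>s - t\<bar>\<close> to a point of a higher row is at most
  \<open>2 + (t - s)\<close>, which includes the way back to the left side.\<close>

lemma mst_length_square_le:
  fixes V :: "(real \<times> real) set" and m :: nat
  assumes V: "finite V" "V \<subseteq> unit_square" and m: "0 < m"
  shows "mst_length V \<le> 2 * m + 2 + card V / m"
proof -
  define h where "h = 1 / real m"
  have h: "0 < h" using m by (simp add: h_def)
  define row where "row p = \<lfloor>m * snd p\<rfloor>" for p :: "real \<times> real"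
  define \<psi> where "\<psi> p = (2 + h) * row p + fst p" for p
  have S: "0 \<le> fst p" "fst p \<le> 1" "0 \<le> snd p" "snd p \<le> 1" if "p \<in> V" for p
    using that V(2) by (auto simp: unit_square_def)
  have row: "0 \<le> row p" "row p \<le> m" if "p \<in> V" for p
  proof -
    show "0 \<le> row p" using S[OF that] by (simp add: row_def)
    have "real m * snd p \<le> real m * 1" using S[OF that] by (intro mult_left_mono) auto
    then show "row p \<le> m" unfolding row_def by linarith
  qed
  have "mst_length V \<le> ((2 + h) * m + 1) - 0 + h * card V"
  proof (rule mst_length_le_ordering_key[where \<psi> = \<psi>])
    fix p assume p: "p \<in> V"
    then show "0 \<le> \<psi> p" using S[OF p] row[OF p] h by (simp add: \<psi>_def)
    have "(2 + h) * row p \<le> (2 + h) * m" using row[OF p] h by (intro mult_left_mono) auto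
    then show "\<psi> p \<le> (2 + h) * m + 1" using S[OF p] by (simp add: \<psi>_def)
  next
    fix p q assume pq: "p \<in> V" "q \<in> V" "\<psi> p \<le> \<psi> q"
    define d where "d = row q - row p"
    have diff: "\<psi> q - \<psi> p = (2 + h) * d + (fst q - fst p)"
      by (simp add: \<psi>_def d_def algebra_simps)
    have "0 \<le> d"
    proof (rule ccontr)
      assume "\<not> 0 \<le> d"
      then have "(2 + h) * real_of_int d \<le> (2 + h) * - 1" using h by (intro mult_left_mono) auto
      also have "\<dots> < - 2" using h by simp
      finally show False using diff pq(3) S[OF pq(1)] S[OF pq(2)] by linarith
    qed
    have "\<bar>snd p - snd q\<bar> \<le> (\<bar>real_of_int (row p - row q)\<bar> + 1) / m"
      unfolding row_def by (rule floor_scaled_diff_le) (use m in simp)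
    also have "\<dots> = h * d + h" using \<open>0 \<le> d\<close> by (simp add: d_def h_def add_divide_distrib)
    finally have snd: "\<bar>snd p - snd q\<bar> \<le> h * d + h" .
    have "\<bar>fst p - fst q\<bar> \<le> 2 * d + (fst q - fst p)"
    proof (cases "d = 0")
      case True
      then show ?thesis using diff pq by simp
    next
      case False
      then have "1 \<le> real_of_int d" using \<open>0 \<le> d\<close> by linarith
      then show ?thesis using S[OF pq(1)] S[OF pq(2)] by linarith
    qed
    with snd show "dist p q \<le> \<psi> q - \<psi> p + h"
      using dist_le_abs[of p q] diff by (simp add: algebra_simps)
  qed (use V h in auto)
  also have "\<dots> = 2 * m + 2 + card V / m" using m by (simp add: h_def field_simps)
  finally show ?thesis .
qed

lemma mst_length_square_le_sqrt:
  fixes V :: "(real \<times> real) set"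
  assumes V: "finite V" "V \<subseteq> unit_square" and n: "card V \<le> n"
  shows "mst_length V \<le> 7 * sqrt n"
proof (cases "n = 0")
  case True
  then show ?thesis using V n by simp
next
  case False
  define s where "s = sqrt (real n)"
  have s: "1 \<le> s" "real n = s * s" using False by (auto simp: s_def)
  define m where "m = nat \<lceil>s\<rceil>"
  have m: "s \<le> m" "m \<le> s + 1" using s(1) unfolding m_def by linarith+
  then have "0 < m" using s(1) by linarith
  have "mst_length V \<le> 2 * m + 2 + card V / m"
    by (rule mst_length_square_le[OF V \<open>0 < m\<close>])
  also have "card V / m \<le> n / s"
    using n m s by (intro frac_le) auto
  also have "n / s = s" using s by simp
  finally show ?thesis using m s unfolding s_def[symmetric] by linarith
qed

text \<open>The bound \<open>2 * m + n / m\<close> is least for \<open>m = sqrt (n / 2)\<close>, with value \<open>2 * sqrt 2 * sqrt n\<close>.  The choice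
  \<open>m = 7 / 10 * sqrt n\<close> is close enough to stay below \<open>3 * sqrt n\<close>.\<close>

lemma mst_length_square_le_3_sqrt:
  fixes V :: "(real \<times> real) set"
  assumes V: "finite V" "V \<subseteq> unit_square" and n: "card V \<le> n" and large: "n \<ge> 600"
  shows "mst_length V \<le> 3 * sqrt n"
proof -
  define s where "s = sqrt (real n)"
  have "24 \<le> s" unfolding s_def by (rule real_le_rsqrt) (use large in simp)
  have s2: "real n = s * s" by (simp add: s_def)
  define m where "m = nat \<lceil>(7 / 10) * s\<rceil>"
  have m: "(7 / 10) * s \<le> m" "m \<le> (7 / 10) * s + 1" using \<open>24 \<le> s\<close> unfolding m_def by linarith+
  then have "0 < m" using \<open>24 \<le> s\<close> by linarith
  have "mst_length V \<le> 2 * m + 2 + card V / m"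
    by (rule mst_length_square_le[OF V \<open>0 < m\<close>])
  also have "card V / m \<le> n / ((7 / 10) * s)"
    using n m \<open>24 \<le> s\<close> by (intro frac_le) auto
  also have "n / ((7 / 10) * s) = (10 / 7) * s" using s2 \<open>24 \<le> s\<close> by simp
  finally show ?thesis using m \<open>24 \<le> s\<close> unfolding s_def[symmetric] by linarith
qed

lemma dist_unit_square_le:
  assumes "p \<in> unit_square" "q \<in> unit_square"
  shows "dist p q \<le> sqrt 2"
proof -
  have "\<bar>fst p - fst q\<bar> \<le> 1" "\<bar>snd p - snd q\<bar> \<le> 1" using assms by (auto simp: unit_square_def)
  then have "(fst p - fst q)\<^sup>2 + (snd p - snd q)\<^sup>2 \<le> 1 + 1"
    by (intro add_mono) (simp_all add: abs_square_le_1)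
  then show ?thesis by (simp add: dist_prod_def dist_real_def)
qed

section \<open>Deleting a vertex\<close>

lemma sum_incident_edges:
  fixes g :: "'a set \<Rightarrow> real"
  assumes "finite V" "T \<subseteq> complete_edges V"
  shows "(\<Sum>v\<in>V. \<Sum>e\<in>{e\<in>T. v \<in> e}. g e) = 2 * (\<Sum>e\<in>T. g e)"
proof -
  have fin: "finite T" using assms by (meson finite_complete_edges finite_subset)
  have "(\<Sum>v\<in>V. \<Sum>e\<in>{e\<in>T. v \<in> e}. g e) = (\<Sum>e\<in>T. \<Sum>v\<in>{v\<in>V. v \<in> e}. g e)"
    by (rule sum.swap_restrict) (use assms fin in auto)
  also have "\<dots> = (\<Sum>e\<in>T. 2 * g e)"
  proof (rule sum.cong)
    fix e assume "e \<in> T"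
    with assms(2) obtain u v where "e = {u, v}" "u \<in> V" "v \<in> V" "u \<noteq> v"
      by (blast elim: complete_edgesE)
    moreover from this have "{v\<in>V. v \<in> e} = {u, v}" by auto
    ultimately show "(\<Sum>v\<in>{v\<in>V. v \<in> e}. g e) = 2 * g e" by simp
  qed simp
  finally show ?thesis by (simp add: sum_distrib_left)
qed

lemma abs_mst_length_delete_le:
  assumes V: "finite V" and T: "minimal_connected V T" and v: "v \<in> V"
  shows "\<bar>mst_length V - mst_length (V - {v})\<bar> \<le> (\<Sum>e\<in>{e\<in>T. v \<in> e}. diameter e)"
proof -
  have T': "T \<subseteq> complete_edges V" "connected_graph V T"
    using T by (auto simp: minimal_connected_def)
  have fin: "finite T" using T'(1) V by (meson finite_complete_edges finite_subset)
  have nonneg: "0 \<le> diameter e" if "e \<in> T" for e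
    using that T'(1) by (auto dest: diameter_edge_nonneg)
  have "mst_length V \<le> mst_length (V - {v}) + (\<Sum>e\<in>{e\<in>T. v \<in> e}. diameter e)"
  proof (cases "V = {v}")
    case True
    then show ?thesis using nonneg by (auto intro: sum_nonneg)
  next
    case False
    then obtain w where w: "w \<in> V" "w \<noteq> v" using v by auto
    then have "(v, w) \<in> joined T" using T'(2) v by (auto simp: connected_graph_joined)
    then obtain y where "(v, y) \<in> {(x, y). {x, y} \<in> T}"
      unfolding joined_def using w(2) by (metis converse_rtranclE)
    then have y: "{v, y} \<in> T" by simp
    then have "y \<in> V - {v}" using T'(1) by (auto simp: complete_edges_def doubleton_eq_iff)
    then have "mst_length (insert v (V - {v})) \<le> mst_length (V - {v}) + dist y v"
      using V by (intro mst_length_insert_le) auto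
    also have "dist y v \<le> (\<Sum>e\<in>{e\<in>T. v \<in> e}. diameter e)"
      using member_le_sum[of "{v, y}" "{e\<in>T. v \<in> e}" diameter] y fin nonneg
      by (simp add: diameter_edge dist_commute)
    finally show ?thesis using v by (simp add: insert_absorb)
  qed
  moreover have "mst_length (V - {v}) \<le> mst_length V + (\<Sum>e\<in>{e\<in>T. v \<in> e}. diameter e)"
    using V T v by (rule mst_length_delete_le)
  ultimately show ?thesis by linarith
qed

text \<open>An index whose point also occurs at another index can be left out without changing the set of points;
  the other indices correspond to distinct points.\<close>

lemma sum_delete_index_le:
  fixes x :: "'i \<Rightarrow> 'a" and g :: "'a set \<Rightarrow> real"
  assumes "finite I" "\<And>W. 0 \<le> g W" "g (x ` I) = 0"
  shows "(\<Sum>i\<in>I. g (x ` (I - {i}))) \<le> (\<Sum>v\<in>x ` I. g (x ` I - {v}))"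
proof -
  define J where "J = {i\<in>I. x i \<notin> x ` (I - {i})}"
  have J: "J \<subseteq> I" by (auto simp: J_def)
  have inj: "inj_on x J" by (rule inj_onI) (auto simp: J_def)
  have "(\<Sum>i\<in>I. g (x ` (I - {i}))) = (\<Sum>i\<in>J. g (x ` (I - {i})))"
  proof (rule sum.mono_neutral_right)
    show "\<forall>i\<in>I - J. g (x ` (I - {i})) = 0"
    proof
      fix i assume "i \<in> I - J"
      then have "x ` (I - {i}) = x ` I" by (auto simp: J_def)
      then show "g (x ` (I - {i})) = 0" using assms(3) by simp
    qed
  qed (use J assms in auto)
  also have "\<dots> = (\<Sum>i\<in>J. g (x ` I - {x i}))"
  proof (rule sum.cong)
    fix i assume "i \<in> J"
    then have "x ` I = insert (x i) (x ` (I - {i}))" "x i \<notin> x ` (I - {i})" by (auto simp: J_def)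
    then have "x ` (I - {i}) = x ` I - {x i}" by simp
    then show "g (x ` (I - {i})) = g (x ` I - {x i})" by simp
  qed simp
  also have "\<dots> = (\<Sum>v\<in>x ` J. g (x ` I - {v}))" using inj by (simp add: sum.reindex)
  also have "\<dots> \<le> (\<Sum>v\<in>x ` I. g (x ` I - {v}))"
    by (rule sum_mono2) (use assms J in auto)
  finally show ?thesis .
qed

lemma sum_abs_mst_length_delete_le:
  fixes x :: "'i \<Rightarrow> 'a :: metric_space"
  assumes I: "finite I"
  shows "(\<Sum>i\<in>I. \<bar>mst_length (x ` I) - mst_length (x ` (I - {i}))\<bar>) \<le> 2 * mst_length (x ` I)"
proof -
  obtain T where T: "minimal_connected (x ` I) T"
    using minimal_connected_exists[of "x ` I"] I by auto
  have "(\<Sum>i\<in>I. \<bar>mst_length (x ` I) - mst_length (x ` (I - {i}))\<bar>)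
      \<le> (\<Sum>v\<in>x ` I. \<bar>mst_length (x ` I) - mst_length (x ` I - {v})\<bar>)"
    by (rule sum_delete_index_le[where g = "\<lambda>W. \<bar>mst_length (x ` I) - mst_length W\<bar>"]) (use I in auto)
  also have "\<dots> \<le> (\<Sum>v\<in>x ` I. \<Sum>e\<in>{e\<in>T. v \<in> e}. diameter e)"
    by (rule sum_mono) (use I T in \<open>auto intro: abs_mst_length_delete_le\<close>)
  also have "\<dots> = 2 * mst_length (x ` I)"
    using sum_incident_edges[of "x ` I" T diameter] T I
    by (auto simp: minimal_connected_def edges_length_def)
  finally show ?thesis .
qed

section \<open>The squared edge lengths\<close>

lemma same_octant_closer:
  fixes p q s t :: real
  assumes "(0 \<le> p) = (0 \<le> s)" "(0 \<le> q) = (0 \<le> t)" "(\<bar>q\<bar> \<le> \<bar>p\<bar>) = (\<bar>t\<bar> \<le> \<bar>s\<bar>)"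
    and "s\<^sup>2 + t\<^sup>2 \<le> p\<^sup>2 + q\<^sup>2" "s \<noteq> 0 \<or> t \<noteq> 0"
  shows "(p - s)\<^sup>2 + (q - t)\<^sup>2 < p\<^sup>2 + q\<^sup>2"
proof -
  have key: "s\<^sup>2 + t\<^sup>2 < 2 * (p * s + q * t)"
    if nn: "0 \<le> p" "0 \<le> q" "0 \<le> s" "0 \<le> t" and le: "q \<le> p" "t \<le> s"
      and N: "s\<^sup>2 + t\<^sup>2 \<le> p\<^sup>2 + q\<^sup>2" and nz: "s \<noteq> 0 \<or> t \<noteq> 0" for p q s t :: real
  proof (cases "s \<le> p")
    case True
    have "0 < s" using nz nn le by auto
    have ps: "s\<^sup>2 \<le> p * s" using True nn by (simp add: power2_eq_square mult_right_mono)
    have ts: "t\<^sup>2 \<le> s\<^sup>2" using le nn by (simp add: power_mono)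
    have qt: "0 \<le> q * t" using nn by simp
    show ?thesis
    proof (rule ccontr)
      assume "\<not> ?thesis"
      then have "2 * (p * s) + 2 * (q * t) \<le> s\<^sup>2 + t\<^sup>2" by (simp add: algebra_simps)
      with ps ts qt have eq: "s\<^sup>2 = p * s" "t\<^sup>2 = s\<^sup>2" "q * t = 0" by linarith+
      then have "p = s" "t = s"
        using \<open>0 < s\<close> nn power2_eq_imp_eq[OF eq(2)] by (auto simp: power2_eq_square)
      then have "q = 0" using eq(3) \<open>0 < s\<close> by simp
      then show False using N \<open>p = s\<close> \<open>t = s\<close> \<open>0 < s\<close> by simp
    qed
  next
    case False
    then have "p\<^sup>2 < s\<^sup>2" using nn by (intro power_strict_mono) auto
    then have "t\<^sup>2 < q\<^sup>2" using N by linarith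
    then have "t < q" using nn by (simp add: power_less_imp_less_base)
    then have "0 < p" using nn le by linarith
    then have "p\<^sup>2 < p * s" using False by (simp add: power2_eq_square)
    moreover have "q\<^sup>2 \<le> p\<^sup>2" using le nn by (intro power_mono) auto
    moreover have "0 \<le> q * t" using nn by simp
    ultimately show ?thesis using N unfolding distrib_left by linarith
  qed
  have "p * s = \<bar>p\<bar> * \<bar>s\<bar>" "q * t = \<bar>q\<bar> * \<bar>t\<bar>"
    using assms(1,2) by (auto simp: abs_if not_le)
  moreover have "s\<^sup>2 + t\<^sup>2 < 2 * (\<bar>p\<bar> * \<bar>s\<bar> + \<bar>q\<bar> * \<bar>t\<bar>)"
  proof (cases "\<bar>q\<bar> \<le> \<bar>p\<bar>")
    case True
    then show ?thesis using key[of "\<bar>p\<bar>" "\<bar>q\<bar>" "\<bar>s\<bar>" "\<bar>t\<bar>"] assms by simp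
  next
    case False
    then show ?thesis using key[of "\<bar>q\<bar>" "\<bar>p\<bar>" "\<bar>t\<bar>" "\<bar>s\<bar>"] assms by (simp add: add.commute)
  qed
  ultimately have "s\<^sup>2 + t\<^sup>2 < 2 * (p * s + q * t)" by simp
  then show ?thesis by (simp add: power2_eq_square algebra_simps)
qed

text \<open>Two edges \<open>{v, y}\<close> and \<open>{v, z}\<close> with \<open>y - v\<close> and \<open>z - v\<close> in the same octant span an angle
  of at most 45 degrees, so that \<open>{y, z}\<close> is shorter than the longer one of them and would
  replace it.\<close>

lemma minimal_connected_degree_le:
  fixes V :: "(real \<times> real) set"
  assumes V: "finite V" and T: "minimal_connected V T"
  shows "card {e\<in>T. v \<in> e} \<le> 8"
proof -
  have T': "T \<subseteq> complete_edges V" using T by (auto simp: minimal_connected_def)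
  define N where "N = {y. {v, y} \<in> T}"
  have NV: "y \<in> V" "y \<noteq> v" if "y \<in> N" for y
    using that T' by (auto simp: N_def complete_edges_def doubleton_eq_iff)
  define octant where "octant y = (0 \<le> fst y - fst v, 0 \<le> snd y - snd v,
    \<bar>snd y - snd v\<bar> \<le> \<bar>fst y - fst v\<bar>)" for y :: "real \<times> real"
  have closer: False if yz: "y \<in> N" "z \<in> N" "octant y = octant z" "y \<noteq> z"
    "dist z v \<le> dist y v" for y z
  proof -
    have "(fst z - fst v)\<^sup>2 + (snd z - snd v)\<^sup>2 \<le> (fst y - fst v)\<^sup>2 + (snd y - snd v)\<^sup>2"
      using yz(5) by (simp add: dist_prod_def dist_real_def)
    moreover have "fst z - fst v \<noteq> 0 \<or> snd z - snd v \<noteq> 0"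
      using NV(2)[OF yz(2)] by (auto simp: prod_eq_iff)
    ultimately have "((fst y - fst v) - (fst z - fst v))\<^sup>2 + ((snd y - snd v) - (snd z - snd v))\<^sup>2
        < (fst y - fst v)\<^sup>2 + (snd y - snd v)\<^sup>2"
      using yz(3) by (intro same_octant_closer) (auto simp: octant_def)
    then have "dist z y < dist v y"
      by (simp add: dist_prod_def dist_real_def power2_commute)
    moreover have "(v, y) \<in> joined (insert {z, y} (T - {{v, y}}))"
    proof (rule joined_trans)
      show "(v, z) \<in> joined (insert {z, y} (T - {{v, y}}))"
        using yz by (intro joined_edge) (auto simp: N_def doubleton_eq_iff)
    qed (auto intro: joined_edge)
    then have "dist v y \<le> dist z y"
      using yz NV by (intro mst_length_edge_exchange[OF V T]) (auto simp: N_def)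
    ultimately show False by simp
  qed
  have "inj_on octant N"
    using closer by (intro inj_onI) (metis linear)
  then have "card N \<le> card (UNIV :: (bool \<times> bool \<times> bool) set)"
    by (intro card_inj_on_le[of octant]) auto
  moreover have "finite N" using NV(1) V by (meson finite_subset subsetI)
  moreover have "{e\<in>T. v \<in> e} \<subseteq> (\<lambda>y. {v, y}) ` N"
  proof
    fix e assume e: "e \<in> {e\<in>T. v \<in> e}"
    then obtain a b where "e = {a, b}" using T' by (blast elim: complete_edgesE)
    with e have "e = {v, a} \<or> e = {v, b}" by auto
    then have "\<exists>y. e = {v, y}" by blast
    with e show "e \<in> (\<lambda>y. {v, y}) ` N" by (auto simp: N_def)
  qed
  ultimately show ?thesis
    using surj_card_le[of N "{e\<in>T. v \<in> e}" "\<lambda>y. {v, y}"] by (simp add: card_UNIV_bool)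
qed

text \<open>Two edges of length at least \<open>r\<close> cannot run in parallel at distance below \<open>r\<close>: if the
  endpoints of \<open>{a, b}\<close> are closer than \<open>r\<close> to those of \<open>{c, d}\<close>, then \<open>{a, b}\<close> can be replaced by
  \<open>{a, c}\<close> or \<open>{b, d}\<close>, since after removing \<open>{a, b}\<close> the edge \<open>{c, d}\<close> still hangs together
  with \<open>a\<close> or with \<open>b\<close>.\<close>

lemma minimal_connected_no_parallel_edges:
  fixes V :: "'a :: metric_space set"
  assumes V: "finite V" and T: "minimal_connected V T" and e: "{a, b} \<in> T" and f: "{c, d} \<in> T"
    and neq: "{a, b} \<noteq> {c, d}"
  shows "dist a b \<le> max (dist a c) (dist b d)"
proof -
  have T': "T \<subseteq> complete_edges V" "connected_graph V T"
    using T by (auto simp: minimal_connected_def)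
  have mem: "a \<in> V" "b \<in> V" "c \<in> V" "d \<in> V"
    using T'(1) e f by (auto simp: complete_edges_def doubleton_eq_iff)
  let ?F = "T - {{a, b}}"
  have "insert {a, b} ?F = T" using e by blast
  moreover have "(c, a) \<in> joined T" using T'(2) mem by (auto simp: connected_graph_joined)
  ultimately have "(c, a) \<in> joined (insert {a, b} ?F)" by simp
  from joined_insertD[OF this] have "(c, a) \<in> joined ?F \<or> (c, b) \<in> joined ?F"
    by blast
  then show ?thesis
  proof
    assume "(c, a) \<in> joined ?F"
    then have "(a, c) \<in> joined (insert {b, d} ?F)"
      by (intro joined_sym[of c a]) (auto intro: joined_mono)
    also have "(c, d) \<in> joined (insert {b, d} ?F)" using f neq by (intro joined_edge) auto
    also have "(d, b) \<in> joined (insert {b, d} ?F)" by (intro joined_edge) (auto simp: insert_commute)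
    finally have "dist a b \<le> dist b d" using mem by (intro mst_length_edge_exchange[OF V T e])
    then show ?thesis by simp
  next
    assume "(c, b) \<in> joined ?F"
    have "(a, c) \<in> joined (insert {a, c} ?F)" by (intro joined_edge) auto
    also have "(c, b) \<in> joined (insert {a, c} ?F)"
      using \<open>(c, b) \<in> joined ?F\<close> by (rule joined_mono) auto
    finally have "dist a b \<le> dist a c" using mem by (intro mst_length_edge_exchange[OF V T e])
    then show ?thesis by simp
  qed
qed

text \<open>There are only \<open>O (1 / r\<^sup>2)\<close> edges of length about \<open>r\<close>: with a grid of side \<open>r / 2\<close>, two such edges whose
  endpoints share their cells would be parallel at distance below \<open>r\<close>.  So an edge is determined by the cell of
  one endpoint and by the offset to the cell of the other, for which 81 values are possible.\<close>

lemma sum_squares_scale_le: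
  fixes V :: "(real \<times> real) set" and r :: real
  assumes V: "finite V" "V \<subseteq> unit_square" and T: "minimal_connected V T" and r: "0 < r" "r \<le> 2"
  shows "(\<Sum>e\<in>{e\<in>T. r \<le> diameter e \<and> diameter e < 2 * r}. (diameter e)\<^sup>2) \<le> 5184"
proof -
  have T': "T \<subseteq> complete_edges V" using T by (auto simp: minimal_connected_def)
  define F where "F = {e\<in>T. r \<le> diameter e \<and> diameter e < 2 * r}"
  have "\<forall>e\<in>F. \<exists>p. e = {fst p, snd p}"
  proof
    fix e assume "e \<in> F"
    then obtain u v where "e = {u, v}" using T' unfolding F_def by (blast elim: complete_edgesE)
    then show "\<exists>p. e = {fst p, snd p}" by (intro exI[of _ "(u, v)"]) simp
  qed
  then obtain p where p: "\<And>e. e \<in> F \<Longrightarrow> e = {fst (p e), snd (p e)}" by metis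
  define a where "a e = fst (p e)" for e
  define b where "b e = snd (p e)" for e
  have ab: "e = {a e, b e}" "a e \<in> V" "b e \<in> V" "diameter e = dist (a e) (b e)" if "e \<in> F" for e
  proof -
    show *: "e = {a e, b e}" using p[OF that] by (simp add: a_def b_def)
    show "diameter e = dist (a e) (b e)" by (subst *) (rule diameter_edge)
    have "{a e, b e} \<in> complete_edges V" using * that T' by (auto simp: F_def)
    then show "a e \<in> V" "b e \<in> V" by (auto simp: complete_edges_def doubleton_eq_iff)
  qed
  define cell where "cell x = (\<lfloor>(2 / r) * fst x\<rfloor>, \<lfloor>(2 / r) * snd x\<rfloor>)" for x :: "real \<times> real"
  have near: "dist x y < r" if "cell x = cell y" for x y
  proof -
    have "\<bar>(2 / r) * fst x - (2 / r) * fst y\<bar> < 1" "\<bar>(2 / r) * snd x - (2 / r) * snd y\<bar> < 1"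
      using that unfolding cell_def prod.inject by linarith+
    then have "(2 / r) * \<bar>fst x - fst y\<bar> < 1" "(2 / r) * \<bar>snd x - snd y\<bar> < 1"
      using r by (simp_all only: abs_scaled_diff divide_pos_pos zero_less_numeral)
    then have "\<bar>fst x - fst y\<bar> < r / 2" "\<bar>snd x - snd y\<bar> < r / 2"
      using r by (simp_all add: field_simps)
    then show ?thesis using dist_le_abs[of x y] by linarith
  qed
  have far: "\<lfloor>(2 / r) * s\<rfloor> - \<lfloor>(2 / r) * t\<rfloor> \<in> {-4..4}" if "\<bar>s - t\<bar> < 2 * r" for s t
  proof -
    have "(2 / r) * \<bar>s - t\<bar> < 4" using that r by (simp add: field_simps)
    then have "\<bar>(2 / r) * s - (2 / r) * t\<bar> < 4"
      using r by (simp only: abs_scaled_diff divide_pos_pos zero_less_numeral)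
    then show ?thesis by (simp; linarith)
  qed
  define K where "K = \<lfloor>2 / r\<rfloor>"
  define code where "code e = (cell (a e), fst (cell (b e)) - fst (cell (a e)),
    snd (cell (b e)) - snd (cell (a e)))" for e
  let ?C = "({0..K} \<times> {0..K}) \<times> {-4..4::int} \<times> {-4..4::int}"
  have "code ` F \<subseteq> ?C"
  proof
    fix c assume "c \<in> code ` F"
    then obtain e where e: "e \<in> F" "c = code e" by blast
    have "a e \<in> unit_square" using ab(2)[OF e(1)] V(2) by blast
    then have A: "0 \<le> fst (a e)" "fst (a e) \<le> 1" "0 \<le> snd (a e)" "snd (a e) \<le> 1"
      by (auto simp: unit_square_def)
    have in_range: "\<lfloor>(2 / r) * s\<rfloor> \<in> {0..K}" if "0 \<le> s" "s \<le> 1" for s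
    proof -
      have "(2 / r) * s \<le> (2 / r) * 1" using that r by (intro mult_left_mono) auto
      then have "\<lfloor>(2 / r) * s\<rfloor> \<le> K" unfolding K_def mult_1_right by (rule floor_mono)
      moreover have "0 \<le> \<lfloor>(2 / r) * s\<rfloor>" using that r by simp
      ultimately show ?thesis unfolding atLeastAtMost_iff by blast
    qed
    have "dist (a e) (b e) < 2 * r" using e(1) ab(4)[OF e(1)] by (simp add: F_def)
    moreover have "\<bar>fst (b e) - fst (a e)\<bar> \<le> dist (a e) (b e)" "\<bar>snd (b e) - snd (a e)\<bar> \<le> dist (a e) (b e)"
      using dist_fst_le[of "b e" "a e"] dist_snd_le[of "b e" "a e"]
      by (simp_all add: dist_real_def dist_commute)
    ultimately have "\<bar>fst (b e) - fst (a e)\<bar> < 2 * r" "\<bar>snd (b e) - snd (a e)\<bar> < 2 * r"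
      by linarith+
    then show "c \<in> ?C"
      unfolding e(2) code_def cell_def fst_conv snd_conv mem_Times_iff
      using A by (intro conjI in_range far)
  qed
  moreover have "inj_on code F"
  proof (rule inj_onI, rule ccontr)
    fix e f assume ef: "e \<in> F" "f \<in> F" "code e = code f" "e \<noteq> f"
    then have "cell (a e) = cell (a f)" "cell (b e) = cell (b f)"
      by (auto simp: code_def prod_eq_iff)
    then have "dist (a e) (a f) < r" "dist (b e) (b f) < r" by (auto intro: near)
    moreover have "dist (a e) (b e) \<le> max (dist (a e) (a f)) (dist (b e) (b f))"
      using ef ab[OF ef(1)] ab[OF ef(2)]
      by (intro minimal_connected_no_parallel_edges[OF V(1) T]) (auto simp: F_def)
    moreover have "r \<le> dist (a e) (b e)" using ef(1) ab(4)[OF ef(1)] by (auto simp: F_def)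
    ultimately show False by linarith
  qed
  ultimately have "card F \<le> card ?C" by (intro card_inj_on_le[of code]) auto
  also have "card ?C = nat (K + 1) * nat (K + 1) * 81" by (simp add: card_cartesian_product)
  finally have "real (card F) \<le> real (nat (K + 1) * nat (K + 1) * 81)" by (rule of_nat_mono)
  also have "\<dots> \<le> (4 / r) * (4 / r) * 81"
  proof -
    have "0 \<le> K" using r by (simp add: K_def)
    have "real_of_int K + 1 \<le> 2 / r + 1" by (simp add: K_def)
    also have "\<dots> \<le> 4 / r" using r by (simp add: field_simps)
    finally have "real (nat (K + 1)) \<le> 4 / r" using \<open>0 \<le> K\<close> by simp
    then have "real (nat (K + 1)) * real (nat (K + 1)) \<le> (4 / r) * (4 / r)"
      using r by (intro mult_mono) auto
    then show ?thesis by simp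
  qed
  finally have card: "card F \<le> (4 / r) * (4 / r) * 81" .
  have "(\<Sum>e\<in>F. (diameter e)\<^sup>2) \<le> (\<Sum>e\<in>F. (2 * r)\<^sup>2)"
    by (rule sum_mono, rule power_mono) (use r in \<open>auto simp: F_def\<close>)
  also have "\<dots> = card F * (2 * r)\<^sup>2" by simp
  also have "\<dots> \<le> (4 / r) * (4 / r) * 81 * (2 * r)\<^sup>2" using card by (rule mult_right_mono) simp
  also have "\<dots> = 5184" using r by (simp add: power2_eq_square)
  finally show ?thesis by (simp add: F_def)
qed

text \<open>Each dyadic scale contributes a bounded amount, and only the scales from 1 down to \<open>1 / n\<close> matter: the
  at most \<open>n\<^sup>2\<close> edges shorter than \<open>1 / n\<close> contribute at most 1 altogether.\<close>

lemma sum_squares_edges_le: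
  fixes V :: "(real \<times> real) set"
  assumes V: "finite V" "V \<subseteq> unit_square" and T: "minimal_connected V T" and n: "card V \<le> n" "2 \<le> n"
  shows "(\<Sum>e\<in>T. (diameter e)\<^sup>2) \<le> 15553 * log 2 n"
proof -
  have T': "T \<subseteq> complete_edges V" using T by (auto simp: minimal_connected_def)
  have fin: "finite T" using T' V by (meson finite_complete_edges finite_subset)
  have "T \<subseteq> (\<lambda>(u, v). {u, v}) ` (V \<times> V)"
  proof
    fix e assume "e \<in> T"
    then show "e \<in> (\<lambda>(u, v). {u, v}) ` (V \<times> V)"
      using T' by (auto dest!: subsetD[OF T'] simp: complete_edges_def)
  qed
  then have "card T \<le> card (V \<times> V)" using V(1) by (intro surj_card_le) auto
  also have "\<dots> \<le> n * n" using n(1) by (simp add: card_cartesian_product mult_mono)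
  finally have "card T \<le> n * n" .
  then have cardT: "card T \<le> real n * real n" by (metis of_nat_le_iff of_nat_mult)
  have "1 \<le> log 2 n" using n(2) by (simp add: one_le_log_cancel_iff)
  define K where "K = nat \<lceil>log 2 n\<rceil>"
  have K: "log 2 n \<le> K" "K \<le> log 2 n + 1" using \<open>1 \<le> log 2 n\<close> unfolding K_def by linarith+
  have "real n = 2 powr (log 2 n)" using n(2) by simp
  also have "\<dots> \<le> 2 powr K" using K(1) by (intro powr_mono) auto
  also have "\<dots> = 2 ^ K" by (simp add: powr_realpow)
  finally have nK: "real n \<le> 2 ^ K" .
  define sc where "sc k e \<longleftrightarrow> (1 / 2) ^ k \<le> diameter e \<and> diameter e < 2 * (1 / 2) ^ k"
    for k and e :: "(real \<times> real) set"
  have edge: "(diameter e)\<^sup>2 \<le> 1 / (real n)\<^sup>2 + (\<Sum>k\<in>{k\<in>{..K}. sc k e}. (diameter e)\<^sup>2)" if eT: "e \<in> T" for e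
  proof (cases "(1 / 2) ^ K \<le> diameter e")
    case False
    have "(1 / 2) ^ K \<le> 1 / real n" using nK n(2) by (simp add: power_one_over field_simps)
    then have "(diameter e)\<^sup>2 \<le> (1 / real n)\<^sup>2"
      using False eT T' by (intro power_mono) (auto dest: diameter_edge_nonneg)
    then show ?thesis by (simp add: power_one_over sum_nonneg add_increasing2)
  next
    case True
    obtain u v where "e = {u, v}" "u \<in> V" "v \<in> V" by (rule complete_edgesE[OF subsetD[OF T' eT]])
    then have "diameter e \<le> sqrt 2" using V(2) by (auto simp: diameter_edge intro: dist_unit_square_le)
    then have lt2: "diameter e < 2" using sqrt2_less_2 by linarith
    define k where "k = (LEAST k. (1 / 2) ^ k \<le> diameter e)"
    have k: "(1 / 2) ^ k \<le> diameter e" unfolding k_def using True by (rule LeastI)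
    have "k \<le> K" unfolding k_def using True by (rule Least_le)
    have "diameter e < 2 * (1 / 2) ^ k"
    proof (cases k)
      case 0
      then show ?thesis using lt2 by simp
    next
      case (Suc j)
      then have "\<not> (1 / 2) ^ j \<le> diameter e" unfolding k_def by (metis lessI not_less_Least)
      then show ?thesis using Suc by simp
    qed
    with k \<open>k \<le> K\<close> have "k \<in> {k\<in>{..K}. sc k e}" by (simp add: sc_def)
    then have "(diameter e)\<^sup>2 \<le> (\<Sum>k\<in>{k\<in>{..K}. sc k e}. (diameter e)\<^sup>2)"
      by (intro member_le_sum[of k _ "\<lambda>_. (diameter e)\<^sup>2"]) auto
    then show ?thesis by (simp add: add_increasing)
  qed
  have "(\<Sum>e\<in>T. (diameter e)\<^sup>2)
      \<le> (\<Sum>e\<in>T. 1 / (real n)\<^sup>2 + (\<Sum>k\<in>{k\<in>{..K}. sc k e}. (diameter e)\<^sup>2))"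
    by (rule sum_mono) (rule edge)
  also have "\<dots> = card T / (real n)\<^sup>2 + (\<Sum>k\<in>{..K}. \<Sum>e\<in>{e\<in>T. sc k e}. (diameter e)\<^sup>2)"
    using fin by (simp add: sum.distrib sum.swap_restrict)
  also have "\<dots> \<le> 1 + (\<Sum>k\<in>{..K}. 5184)"
  proof (rule add_mono)
    show "card T / (real n)\<^sup>2 \<le> 1" using cardT n(2) by (simp add: power2_eq_square field_simps)
    show "(\<Sum>k\<in>{..K}. \<Sum>e\<in>{e\<in>T. sc k e}. (diameter e)\<^sup>2) \<le> (\<Sum>k\<in>{..K}. 5184)"
      unfolding sc_def
      by (intro sum_mono sum_squares_scale_le[OF V T]) (auto intro: order_trans[OF power_le_one])
  qed
  also have "\<dots> = 1 + 5184 * (real K + 1)" by simp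
  also have "\<dots> \<le> 1 + 5184 * (log 2 n + 2)" using K(2) by simp
  also have "\<dots> \<le> 15553 * log 2 n" using \<open>1 \<le> log 2 n\<close> by argo
  finally show ?thesis .
qed

lemma square_sum_le: "(\<Sum>i\<in>A. f i)\<^sup>2 \<le> card A * (\<Sum>i\<in>A. (f i)\<^sup>2)" for f :: "'a \<Rightarrow> real"
  using sum_squared_le_sum_of_squares[of f A] by (cases "finite A") (auto simp: mult.commute)

lemma sum_square_mst_length_delete_le:
  fixes x :: "'i \<Rightarrow> real \<times> real"
  assumes I: "finite I" "x ` I \<subseteq> unit_square" and n: "card I \<le> n" "2 \<le> n"
  shows "(\<Sum>i\<in>I. (mst_length (x ` I) - mst_length (x ` (I - {i})))\<^sup>2) \<le> 248848 * log 2 n"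
proof -
  obtain T where T: "minimal_connected (x ` I) T"
    using minimal_connected_exists[of "x ` I"] I by auto
  have "(\<Sum>i\<in>I. (mst_length (x ` I) - mst_length (x ` (I - {i})))\<^sup>2)
      \<le> (\<Sum>v\<in>x ` I. (mst_length (x ` I) - mst_length (x ` I - {v}))\<^sup>2)"
    by (rule sum_delete_index_le[where g = "\<lambda>W. (mst_length (x ` I) - mst_length W)\<^sup>2"]) (use I in auto)
  also have "\<dots> \<le> (\<Sum>v\<in>x ` I. 8 * (\<Sum>e\<in>{e\<in>T. v \<in> e}. (diameter e)\<^sup>2))"
  proof (rule sum_mono)
    fix v assume "v \<in> x ` I"
    then have "\<bar>mst_length (x ` I) - mst_length (x ` I - {v})\<bar> \<le> (\<Sum>e\<in>{e\<in>T. v \<in> e}. diameter e)"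
      using I T by (intro abs_mst_length_delete_le) auto
    then have "(mst_length (x ` I) - mst_length (x ` I - {v}))\<^sup>2 \<le> (\<Sum>e\<in>{e\<in>T. v \<in> e}. diameter e)\<^sup>2"
      using power_mono[of "\<bar>mst_length (x ` I) - mst_length (x ` I - {v})\<bar>" _ 2] by simp
    also have "\<dots> \<le> card {e\<in>T. v \<in> e} * (\<Sum>e\<in>{e\<in>T. v \<in> e}. (diameter e)\<^sup>2)"
      by (rule square_sum_le)
    also have "\<dots> \<le> 8 * (\<Sum>e\<in>{e\<in>T. v \<in> e}. (diameter e)\<^sup>2)"
      using minimal_connected_degree_le[OF _ T, of v] I
      by (intro mult_right_mono) (auto intro: sum_nonneg)
    finally show "(mst_length (x ` I) - mst_length (x ` I - {v}))\<^sup>2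
      \<le> 8 * (\<Sum>e\<in>{e\<in>T. v \<in> e}. (diameter e)\<^sup>2)" .
  qed
  also have "\<dots> = 16 * (\<Sum>e\<in>T. (diameter e)\<^sup>2)"
    using sum_incident_edges[of "x ` I" T "\<lambda>e. (diameter e)\<^sup>2"] T I
    by (simp add: minimal_connected_def flip: sum_distrib_left)
  also have "\<dots> \<le> 16 * (15553 * log 2 n)"
    using I n T card_image_le[of I x] by (intro mult_left_mono sum_squares_edges_le) auto
  finally show ?thesis by simp
qed

section \<open>The Efron--Stein inequality\<close>

text \<open>This class is closed under all operations used below, including partial integration, and consists of
  integrable functions for every probability measure.\<close>

definition bounded_measurable :: "'a measure \<Rightarrow> ('a \<Rightarrow> real) \<Rightarrow> bool" where
  "bounded_measurable M f \<longleftrightarrow> f \<in> borel_measurable M \<and> (\<exists>B. \<forall>x\<in>space M. \<bar>f x\<bar> \<le> B)"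

lemma bounded_measurableI:
  "f \<in> borel_measurable M \<Longrightarrow> (\<And>x. x \<in> space M \<Longrightarrow> \<bar>f x\<bar> \<le> B) \<Longrightarrow> bounded_measurable M f"
  by (auto simp: bounded_measurable_def)

lemma bounded_measurable_const [intro]: "bounded_measurable M (\<lambda>x. c)"
  by (auto simp: bounded_measurable_def)

lemma bounded_measurable_diff [intro]:
  assumes "bounded_measurable M f" "bounded_measurable M g"
  shows "bounded_measurable M (\<lambda>x. f x - g x)"
proof -
  from assms obtain A B where "\<And>x. x \<in> space M \<Longrightarrow> \<bar>f x\<bar> \<le> A" "\<And>x. x \<in> space M \<Longrightarrow> \<bar>g x\<bar> \<le> B"
    by (auto simp: bounded_measurable_def)
  then have "\<bar>f x - g x\<bar> \<le> A + B" if "x \<in> space M" for x using that by fastforce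
  then show ?thesis using assms by (intro bounded_measurableI) (auto simp: bounded_measurable_def)
qed

lemma bounded_measurable_square [intro]:
  assumes "bounded_measurable M f"
  shows "bounded_measurable M (\<lambda>x. (f x)\<^sup>2)"
proof -
  from assms obtain A where "\<And>x. x \<in> space M \<Longrightarrow> \<bar>f x\<bar> \<le> A" by (auto simp: bounded_measurable_def)
  then have "\<bar>(f x)\<^sup>2\<bar> \<le> A\<^sup>2" if "x \<in> space M" for x
    using power_mono[of "\<bar>f x\<bar>" A 2] that by simp
  then show ?thesis using assms by (intro bounded_measurableI) (auto simp: bounded_measurable_def)
qed

context prob_space
begin

lemma integrable_bounded_measurable:
  assumes "bounded_measurable M f"
  shows "integrable M f"
proof -
  from assms obtain B where "f \<in> borel_measurable M" "\<And>x. x \<in> space M \<Longrightarrow> \<bar>f x\<bar> \<le> B"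
    by (auto simp: bounded_measurable_def)
  then show ?thesis by (intro integrable_const_bound[of _ B]) auto
qed

lemma abs_integral_le:
  assumes "bounded_measurable M f" "\<And>x. x \<in> space M \<Longrightarrow> \<bar>f x\<bar> \<le> B"
  shows "\<bar>\<integral>x. f x \<partial>M\<bar> \<le> B"
proof -
  have int: "integrable M f" using assms(1) by (rule integrable_bounded_measurable)
  have "f x \<le> B" "- B \<le> f x" if "x \<in> space M" for x using assms(2)[OF that] by linarith+
  then have "(\<integral>x. f x \<partial>M) \<le> (\<integral>x. B \<partial>M)" "(\<integral>x. - B \<partial>M) \<le> (\<integral>x. f x \<partial>M)"
    by (intro integral_mono int integrable_const; simp)+
  then show ?thesis by (simp add: prob_space)
qed

lemma mean_square_shift:
  assumes f: "bounded_measurable M f"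
  shows "(\<integral>x. (f x - c)\<^sup>2 \<partial>M) = (\<integral>x. (f x - (\<integral>x. f x \<partial>M))\<^sup>2 \<partial>M) + ((\<integral>x. f x \<partial>M) - c)\<^sup>2"
proof -
  have int: "integrable M f" "integrable M (\<lambda>x. (f x)\<^sup>2)"
    using f by (auto intro!: integrable_bounded_measurable)
  have "(\<integral>x. (f x - c)\<^sup>2 \<partial>M) = (\<integral>x. (f x)\<^sup>2 \<partial>M) - 2 * (\<integral>x. f x \<partial>M) * c + c\<^sup>2" for c
    using int by (simp add: power2_diff prob_space)
  from this[of c] this[of "\<integral>x. f x \<partial>M"] show ?thesis
    by (simp add: power2_eq_square algebra_simps)
qed

lemma square_mean_le:
  assumes f: "bounded_measurable M f"
  shows "(\<integral>x. f x \<partial>M)\<^sup>2 \<le> (\<integral>x. (f x)\<^sup>2 \<partial>M)"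
  using mean_square_shift[OF f, of 0] by simp

end

lemma space_PiM_fun_upd:
  "x \<in> space (PiM I (\<lambda>_. N)) \<Longrightarrow> y \<in> space N \<Longrightarrow> x(i := y) \<in> space (PiM (insert i I) (\<lambda>_. N))"
  by (auto simp: space_PiM PiE_def extensional_def)

lemma bounded_measurable_section:
  assumes "bounded_measurable (PiM (insert i I) (\<lambda>_. N)) f" "x \<in> space (PiM I (\<lambda>_. N))"
  shows "bounded_measurable N (\<lambda>y. f (x(i := y)))"
proof -
  have "(\<lambda>y. x(i := y)) \<in> measurable N (PiM (insert i I) (\<lambda>_. N))"
    using assms(2) by simp
  moreover from assms(1) obtain B where "f \<in> borel_measurable (PiM (insert i I) (\<lambda>_. N))"
    "\<And>x. x \<in> space (PiM (insert i I) (\<lambda>_. N)) \<Longrightarrow> \<bar>f x\<bar> \<le> B"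
    by (auto simp: bounded_measurable_def)
  ultimately show ?thesis
    using space_PiM_fun_upd[OF assms(2)]
    by (intro bounded_measurableI[where B = B] measurable_compose[of "\<lambda>y. x(i := y)" N _ f borel]) simp_all
qed

lemma bounded_measurable_partial_integral:
  assumes "prob_space N" and f: "bounded_measurable (PiM (insert i I) (\<lambda>_. N)) f"
  shows "bounded_measurable (PiM I (\<lambda>_. N)) (\<lambda>x. \<integral>y. f (x(i := y)) \<partial>N)"
proof -
  interpret prob_space N by fact
  from f obtain B where B: "\<And>x. x \<in> space (PiM (insert i I) (\<lambda>_. N)) \<Longrightarrow> \<bar>f x\<bar> \<le> B"
    and [measurable]: "f \<in> borel_measurable (PiM (insert i I) (\<lambda>_. N))"
    by (auto simp: bounded_measurable_def)
  show ?thesis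
  proof (rule bounded_measurableI)
    show "(\<lambda>x. \<integral>y. f (x(i := y)) \<partial>N) \<in> borel_measurable (PiM I (\<lambda>_. N))" by measurable
    show "\<bar>\<integral>y. f (x(i := y)) \<partial>N\<bar> \<le> B" if "x \<in> space (PiM I (\<lambda>_. N))" for x
      using that by (intro abs_integral_le bounded_measurable_section[OF f] B space_PiM_fun_upd)
  qed
qed

text \<open>Conditioning on all coordinates but \<open>j\<close> splits the variance of \<open>F\<close> into the mean of the
  conditional variance and the variance of the conditional mean \<open>F'\<close>.  The former is at most the mean
  square of \<open>F - G j\<close>, as \<open>G j\<close> is constant in the coordinate \<open>j\<close> and the mean is the best constant
  approximation; the latter is bounded by
  induction, with the conditional means of the \<open>G i\<close> as approximations of \<open>F'\<close>.\<close>

lemma Efron_Stein: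
  fixes N :: "'a measure" and F :: "('i \<Rightarrow> 'a) \<Rightarrow> real" and G :: "'i \<Rightarrow> ('i \<Rightarrow> 'a) \<Rightarrow> real"
  assumes N: "prob_space N" and I: "finite I"
    and F: "bounded_measurable (PiM I (\<lambda>_. N)) F"
    and G: "\<And>i. i \<in> I \<Longrightarrow> bounded_measurable (PiM I (\<lambda>_. N)) (G i)"
    and indep: "\<And>i x y. i \<in> I \<Longrightarrow> x \<in> space (PiM I (\<lambda>_. N)) \<Longrightarrow> y \<in> space N \<Longrightarrow> G i (x(i := y)) = G i x"
  shows "(\<integral>x. (F x - (\<integral>x. F x \<partial>PiM I (\<lambda>_. N)))\<^sup>2 \<partial>PiM I (\<lambda>_. N))
    \<le> (\<Sum>i\<in>I. \<integral>x. (F x - G i x)\<^sup>2 \<partial>PiM I (\<lambda>_. N))"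
  using I F G indep
proof (induction I arbitrary: F G rule: finite_induct)
  case empty
  interpret N: prob_space N by fact
  show ?case by (simp add: PiM_empty lebesgue_integral_count_space_finite)
next
  case (insert j I)
  interpret N: prob_space N by fact
  interpret PP: product_prob_space "\<lambda>_::'i. N" UNIV by standard
  interpret P: prob_space "PiM I (\<lambda>_. N)" by (intro prob_space_PiM N)
  interpret Q: prob_space "PiM (insert j I) (\<lambda>_. N)" by (intro prob_space_PiM N)
  let ?P = "PiM I (\<lambda>_. N)" and ?Q = "PiM (insert j I) (\<lambda>_. N)"
  note F = insert.prems(1) and G = insert.prems(2)
  have Fubini: "(\<integral>x. f x \<partial>?Q) = (\<integral>x. (\<integral>y. f (x(j := y)) \<partial>N) \<partial>?P)"
    if "bounded_measurable ?Q f" for f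
    using insert.hyps Q.integrable_bounded_measurable[OF that]
    by (rule PP.product_integral_insert)
  define F' where "F' x = (\<integral>y. F (x(j := y)) \<partial>N)" for x
  define G' where "G' i x = (\<integral>y. G i (x(j := y)) \<partial>N)" for i x
  have F': "bounded_measurable ?P F'" unfolding F'_def
    by (rule bounded_measurable_partial_integral[OF N F])
  have G': "bounded_measurable ?P (G' i)" if "i \<in> I" for i unfolding G'_def
    using that by (intro bounded_measurable_partial_integral[OF N] G) auto
  define c where "c = (\<integral>x. F x \<partial>?Q)"
  have c: "c = (\<integral>x. F' x \<partial>?P)" unfolding c_def F'_def by (rule Fubini[OF F])
  have diff: "bounded_measurable ?Q (\<lambda>x. (F x - G i x)\<^sup>2)" if "i \<in> insert j I" for i
    by (intro bounded_measurable_square bounded_measurable_diff F G that)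
  have int_diff: "integrable ?P (\<lambda>x. \<integral>y. (F (x(j := y)) - G i (x(j := y)))\<^sup>2 \<partial>N)"
    if "i \<in> insert j I" for i
    using bounded_measurable_partial_integral[OF N diff[OF that]]
    by (rule P.integrable_bounded_measurable)
  have split: "(\<integral>y. (F (x(j := y)) - c)\<^sup>2 \<partial>N)
      \<le> (\<integral>y. (F (x(j := y)) - G j (x(j := y)))\<^sup>2 \<partial>N) + (F' x - c)\<^sup>2" if x: "x \<in> space ?P" for x
  proof -
    note Fx = bounded_measurable_section[OF F x]
    obtain y0 where y0: "y0 \<in> space N" using N.not_empty by blast
    define g where "g = G j (x(j := y0))"
    have "G j (x(j := y)) = g" if "y \<in> space N" for y
    proof -
      have "G j ((x(j := y0))(j := y)) = G j (x(j := y0))"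
        by (rule insert.prems(3)[OF insertI1 space_PiM_fun_upd[OF x y0] that])
      then show ?thesis by (simp only: fun_upd_upd g_def)
    qed
    then have "(\<integral>y. (F (x(j := y)) - G j (x(j := y)))\<^sup>2 \<partial>N) = (\<integral>y. (F (x(j := y)) - g)\<^sup>2 \<partial>N)"
      by (intro Bochner_Integration.integral_cong) auto
    then show ?thesis
      using N.mean_square_shift[OF Fx, of c] N.mean_square_shift[OF Fx, of g]
        zero_le_power2[of "F' x - g"] unfolding F'_def by linarith
  qed
  have "(\<integral>x. (F x - c)\<^sup>2 \<partial>?Q) = (\<integral>x. (\<integral>y. (F (x(j := y)) - c)\<^sup>2 \<partial>N) \<partial>?P)"
    by (intro Fubini bounded_measurable_square bounded_measurable_diff F bounded_measurable_const)
  also have "\<dots> \<le> (\<integral>x. (\<integral>y. (F (x(j := y)) - G j (x(j := y)))\<^sup>2 \<partial>N) + (F' x - c)\<^sup>2 \<partial>?P)"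
  proof (rule integral_mono)
    have "bounded_measurable ?Q (\<lambda>x. (F x - c)\<^sup>2)"
      by (intro bounded_measurable_square bounded_measurable_diff F bounded_measurable_const)
    from bounded_measurable_partial_integral[OF N this]
    show "integrable ?P (\<lambda>x. \<integral>y. (F (x(j := y)) - c)\<^sup>2 \<partial>N)"
      by (rule P.integrable_bounded_measurable)
    show "integrable ?P (\<lambda>x. (\<integral>y. (F (x(j := y)) - G j (x(j := y)))\<^sup>2 \<partial>N) + (F' x - c)\<^sup>2)"
      by (intro Bochner_Integration.integrable_add int_diff P.integrable_bounded_measurable
          bounded_measurable_square bounded_measurable_diff F' bounded_measurable_const) simp
  qed (rule split)
  also have "\<dots> = (\<integral>x. (\<integral>y. (F (x(j := y)) - G j (x(j := y)))\<^sup>2 \<partial>N) \<partial>?P) + (\<integral>x. (F' x - c)\<^sup>2 \<partial>?P)"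
    by (intro Bochner_Integration.integral_add int_diff P.integrable_bounded_measurable
        bounded_measurable_square bounded_measurable_diff F' bounded_measurable_const) simp
  also have "(\<integral>x. (\<integral>y. (F (x(j := y)) - G j (x(j := y)))\<^sup>2 \<partial>N) \<partial>?P) = (\<integral>x. (F x - G j x)\<^sup>2 \<partial>?Q)"
    by (rule Fubini[symmetric, OF diff]) simp
  also have "(\<integral>x. (F' x - c)\<^sup>2 \<partial>?P) \<le> (\<Sum>i\<in>I. \<integral>x. (F' x - G' i x)\<^sup>2 \<partial>?P)"
    unfolding c
  proof (rule insert.IH[OF F' G'])
    fix i x y assume i: "i \<in> I" and x: "x \<in> space ?P" and y: "y \<in> space N"
    have "i \<noteq> j" using i insert.hyps by auto
    then have "G i (x(i := y, j := z)) = G i (x(j := z))" if "z \<in> space N" for z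
      using insert.prems(3)[OF insertI2[OF i] space_PiM_fun_upd[OF x that] y]
      by (simp only: fun_upd_twist[OF \<open>i \<noteq> j\<close>])
    then show "G' i (x(i := y)) = G' i x"
      unfolding G'_def by (intro Bochner_Integration.integral_cong) auto
  qed
  also have "\<dots> \<le> (\<Sum>i\<in>I. \<integral>x. (F x - G i x)\<^sup>2 \<partial>?Q)"
  proof (rule sum_mono)
    fix i assume i: "i \<in> I"
    have "(\<integral>x. (F' x - G' i x)\<^sup>2 \<partial>?P) \<le> (\<integral>x. (\<integral>y. (F (x(j := y)) - G i (x(j := y)))\<^sup>2 \<partial>N) \<partial>?P)"
    proof (rule integral_mono)
      show "integrable ?P (\<lambda>x. (F' x - G' i x)\<^sup>2)"
        by (intro P.integrable_bounded_measurable bounded_measurable_square bounded_measurable_diff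
          F' G' i)
      show "integrable ?P (\<lambda>x. \<integral>y. (F (x(j := y)) - G i (x(j := y)))\<^sup>2 \<partial>N)"
        using i by (intro int_diff) simp
      fix x assume x: "x \<in> space ?P"
      have Fx: "bounded_measurable N (\<lambda>y. F (x(j := y)))" "bounded_measurable N (\<lambda>y. G i (x(j := y)))"
        using bounded_measurable_section[OF F x] bounded_measurable_section[OF G[OF insertI2[OF i]] x] .
      then have "F' x - G' i x = (\<integral>y. F (x(j := y)) - G i (x(j := y)) \<partial>N)"
        unfolding F'_def G'_def
        by (intro Bochner_Integration.integral_diff[symmetric] N.integrable_bounded_measurable)
      then show "(F' x - G' i x)\<^sup>2 \<le> (\<integral>y. (F (x(j := y)) - G i (x(j := y)))\<^sup>2 \<partial>N)"
        using N.square_mean_le[OF bounded_measurable_diff[OF Fx]] by (simp only:)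
    qed
    also have "\<dots> = (\<integral>x. (F x - G i x)\<^sup>2 \<partial>?Q)"
      using i by (intro Fubini[symmetric] diff) simp
    finally show "(\<integral>x. (F' x - G' i x)\<^sup>2 \<partial>?P) \<le> (\<integral>x. (F x - G i x)\<^sup>2 \<partial>?Q)" .
  qed
  finally show ?case using insert.hyps unfolding c_def[symmetric] by simp
qed

section \<open>Splitting samples over cells\<close>

lemma sum_PiE_insert:
  assumes "i \<notin> I"
  shows "(\<Sum>J\<in>insert i I \<rightarrow>\<^sub>E C. f J) = (\<Sum>j\<in>C. \<Sum>J\<in>I \<rightarrow>\<^sub>E C. f (J(i := j)))"
proof -
  have "(\<Sum>J\<in>insert i I \<rightarrow>\<^sub>E C. f J) = (\<Sum>(j, J)\<in>C \<times> (I \<rightarrow>\<^sub>E C). f (J(i := j)))"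
    unfolding PiE_insert_eq using assms
    by (subst sum.reindex) (auto intro: inj_combinator simp: case_prod_beta comp_def)
  then show ?thesis by (simp add: sum.cartesian_product)
qed

text \<open>For a uniformly random \<open>J\<close>, the number of \<open>i\<close> with \<open>J i = q\<close> is binomial; the right-hand side is the
  squared distance of its mean from \<open>c\<close> plus its variance, multiplied by the number of all \<open>J\<close>.\<close>

lemma sum_square_count_deviation:
  fixes C :: "'b set" and c :: real
  assumes C: "finite C" "q \<in> C" and I: "finite I"
  shows "(\<Sum>J\<in>I \<rightarrow>\<^sub>E C. (card {i\<in>I. J i = q} - c)\<^sup>2) = real (card C) ^ card I *
    ((card I / card C - c)\<^sup>2 + card I * (1 / card C * (1 - 1 / card C)))"
  using I
proof (induction I arbitrary: c rule: finite_induct)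
  case empty
  then show ?case by simp
next
  case (insert i I)
  define K where "K = real (card C)"
  have "card C > 0" using C by (auto simp: card_gt_0_iff)
  then have K: "0 < K" by (simp add: K_def)
  define n where "n = real (card I)"
  define v where "v = n * (1 / K * (1 - 1 / K))"
  have count: "real (card {i'\<in>insert i I. (J(i := j)) i' = q}) = card {i\<in>I. J i = q} + of_bool (j = q)"
    for J and j :: 'b
  proof -
    have "{i'\<in>insert i I. (J(i := j)) i' = q} = (if j = q then insert i {i\<in>I. J i = q} else {i\<in>I. J i = q})"
      using insert.hyps by auto
    then show ?thesis using insert.hyps by simp
  qed
  have "(\<Sum>J\<in>insert i I \<rightarrow>\<^sub>E C. (card {i'\<in>insert i I. J i' = q} - c)\<^sup>2)
      = (\<Sum>j\<in>C. \<Sum>J\<in>I \<rightarrow>\<^sub>E C. (card {i\<in>I. J i = q} - (c - of_bool (j = q)))\<^sup>2)"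
    by (subst sum_PiE_insert[OF insert.hyps(2)], subst count) (simp add: algebra_simps)
  also have "\<dots> = (\<Sum>j\<in>C. K ^ card I * ((n / K - (c - of_bool (j = q)))\<^sup>2 + v))"
    by (subst insert.IH) (simp add: K_def n_def v_def)
  also have "\<dots> = K ^ card I * ((n / K - (c - 1))\<^sup>2 + v)
      + (\<Sum>j\<in>C - {q}. K ^ card I * ((n / K - c)\<^sup>2 + v))"
    using C by (subst sum.remove[of C q]) auto
  also have "\<dots> = K ^ card I * (((n / K - (c - 1))\<^sup>2 + v) + (K - 1) * ((n / K - c)\<^sup>2 + v))"
    using C \<open>card C > 0\<close> by (simp add: K_def of_nat_diff algebra_simps)
  also have "((n / K - (c - 1))\<^sup>2 + v) + (K - 1) * ((n / K - c)\<^sup>2 + v)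
      = K * (((n + 1) / K - c)\<^sup>2 + (n + 1) * (1 / K * (1 - 1 / K)))"
    using K by (simp add: v_def power2_eq_square field_simps)
  finally show ?case using insert.hyps by (simp add: K_def n_def algebra_simps)
qed

text \<open>With equality and \<open>p = 1 / card C\<close>, the hypothesis \<open>mixture\<close> says that a point can be drawn by first choosing
  \<open>j\<close> in \<open>C\<close> and then applying \<open>h j\<close> to a new point.  For a whole sample, \<open>J\<close> records these choices.  Given \<open>J\<close>, the new points are
  again a sample, whatever \<open>J\<close> is; this makes conditioning on the cells occupied by the points elementary.\<close>

lemma nn_integral_PiM_le_mixture:
  fixes N :: "'a measure" and h :: "'c \<Rightarrow> 'a \<Rightarrow> 'a" and p :: ennreal
  assumes N: "prob_space N" and C: "finite C" and h: "\<And>j. j \<in> C \<Longrightarrow> h j \<in> measurable N N"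
    and mixture: "\<And>F. F \<in> borel_measurable N \<Longrightarrow>
      (\<integral>\<^sup>+y. F y \<partial>N) \<le> (\<Sum>j\<in>C. p * (\<integral>\<^sup>+u. F (h j u) \<partial>N))"
    and I: "finite I" and F: "F \<in> borel_measurable (PiM I (\<lambda>_. N))"
  shows "(\<integral>\<^sup>+x. F x \<partial>PiM I (\<lambda>_. N))
    \<le> (\<Sum>J\<in>I \<rightarrow>\<^sub>E C. p ^ card I * (\<integral>\<^sup>+u. F (\<lambda>i\<in>I. h (J i) (u i)) \<partial>PiM I (\<lambda>_. N)))"
  using I F
proof (induction I arbitrary: F rule: finite_induct)
  case empty
  interpret N: prob_space N by fact
  interpret P: product_sigma_finite "\<lambda>_. N" by standard
  interpret PE: prob_space "PiM {} (\<lambda>_. N)" by (intro prob_space_PiM N)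
  show ?case by (simp add: P.nn_integral_empty PE.emeasure_space_1)
next
  case (insert i I)
  interpret N: prob_space N by fact
  interpret P: product_sigma_finite "\<lambda>_. N" by standard
  interpret PI: prob_space "PiM I (\<lambda>_. N)" by (intro prob_space_PiM N)
  note [measurable] = insert.prems h
  have meas: "(\<lambda>u. \<lambda>i\<in>I. h (J i) (u i)) \<in> measurable (PiM I (\<lambda>_. N)) (PiM I (\<lambda>_. N))"
    if "J \<in> I \<rightarrow>\<^sub>E C" for J
    using that by (intro measurable_restrict) (auto intro!: measurable_compose[OF measurable_component_singleton] h)
  have "(\<integral>\<^sup>+x. F x \<partial>PiM (insert i I) (\<lambda>_. N)) = (\<integral>\<^sup>+y. (\<integral>\<^sup>+x. F (x(i := y)) \<partial>PiM I (\<lambda>_. N)) \<partial>N)"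
    using insert by (intro P.product_nn_integral_insert_rev) auto
  also have "\<dots> \<le> (\<Sum>j\<in>C. p * (\<integral>\<^sup>+u. (\<integral>\<^sup>+x. F (x(i := h j u)) \<partial>PiM I (\<lambda>_. N)) \<partial>N))"
    by (rule mixture) measurable
  also have "\<dots> \<le> (\<Sum>j\<in>C. p * (\<integral>\<^sup>+u. (\<Sum>J\<in>I \<rightarrow>\<^sub>E C. p ^ card I *
      (\<integral>\<^sup>+x. F ((\<lambda>i\<in>I. h (J i) (x i))(i := h j u)) \<partial>PiM I (\<lambda>_. N))) \<partial>N))"
  proof (intro sum_mono mult_left_mono nn_integral_mono)
    fix j u assume "j \<in> C" "u \<in> space N"
    then have [measurable]: "h j u \<in> space N" using measurable_space[OF h] by blast
    show "(\<integral>\<^sup>+x. F (x(i := h j u)) \<partial>PiM I (\<lambda>_. N)) \<le> (\<Sum>J\<in>I \<rightarrow>\<^sub>E C. p ^ card I *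
      (\<integral>\<^sup>+x. F ((\<lambda>i\<in>I. h (J i) (x i))(i := h j u)) \<partial>PiM I (\<lambda>_. N)))"
      by (rule insert.IH) measurable
  qed simp
  also have "\<dots> = (\<Sum>j\<in>C. \<Sum>J\<in>I \<rightarrow>\<^sub>E C. p ^ card (insert i I) *
      (\<integral>\<^sup>+u. (\<integral>\<^sup>+x. F ((\<lambda>i\<in>I. h (J i) (x i))(i := h j u)) \<partial>PiM I (\<lambda>_. N)) \<partial>N))"
  proof (rule sum.cong)
    fix j assume j: "j \<in> C"
    have m: "(\<lambda>u. \<integral>\<^sup>+x. F ((\<lambda>i\<in>I. h (J i) (x i))(i := h j u)) \<partial>PiM I (\<lambda>_. N)) \<in> borel_measurable N"
      if "J \<in> I \<rightarrow>\<^sub>E C" for J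
      using j that meas[OF that] by measurable
    show "p * (\<integral>\<^sup>+u. (\<Sum>J\<in>I \<rightarrow>\<^sub>E C. p ^ card I *
        (\<integral>\<^sup>+x. F ((\<lambda>i\<in>I. h (J i) (x i))(i := h j u)) \<partial>PiM I (\<lambda>_. N))) \<partial>N)
      = (\<Sum>J\<in>I \<rightarrow>\<^sub>E C. p ^ card (insert i I) *
        (\<integral>\<^sup>+u. (\<integral>\<^sup>+x. F ((\<lambda>i\<in>I. h (J i) (x i))(i := h j u)) \<partial>PiM I (\<lambda>_. N)) \<partial>N))"
      using insert.hyps m
      by (simp add: nn_integral_sum nn_integral_cmult sum_distrib_left mult.assoc)
  qed simp
  also have "\<dots> = (\<Sum>J\<in>insert i I \<rightarrow>\<^sub>E C. p ^ card (insert i I) *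
      (\<integral>\<^sup>+x. F (\<lambda>i'\<in>insert i I. h (J i') (x i')) \<partial>PiM (insert i I) (\<lambda>_. N)))"
    unfolding sum_PiE_insert[OF insert.hyps(2)]
  proof (intro sum.cong refl arg_cong[where f = "\<lambda>t. p ^ card (insert i I) * t"])
    fix j J assume jJ: "j \<in> C" "J \<in> I \<rightarrow>\<^sub>E C"
    have J': "(J(i := j)) i' \<in> C" if "i' \<in> insert i I" for i' using jJ that by auto
    have "(\<lambda>x. \<lambda>i'\<in>insert i I. h ((J(i := j)) i') (x i'))
        \<in> measurable (PiM (insert i I) (\<lambda>_. N)) (PiM (insert i I) (\<lambda>_. N))"
      using J' by (intro measurable_restrict) (auto intro!: measurable_compose[OF measurable_component_singleton] h)
    then have "(\<integral>\<^sup>+x. F (\<lambda>i'\<in>insert i I. h ((J(i := j)) i') (x i')) \<partial>PiM (insert i I) (\<lambda>_. N))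
      = (\<integral>\<^sup>+u. (\<integral>\<^sup>+x. F (\<lambda>i'\<in>insert i I. h ((J(i := j)) i') ((x(i := u)) i')) \<partial>PiM I (\<lambda>_. N)) \<partial>N)"
      using insert.hyps insert.prems by (intro P.product_nn_integral_insert_rev) (auto intro: measurable_compose)
    moreover have "(\<lambda>i'\<in>insert i I. h ((J(i := j)) i') ((x(i := u)) i')) = (\<lambda>i\<in>I. h (J i) (x i))(i := h j u)"
      for x u using insert.hyps by (auto simp: fun_eq_iff)
    ultimately show "(\<integral>\<^sup>+u. (\<integral>\<^sup>+x. F ((\<lambda>i\<in>I. h (J i) (x i))(i := h j u)) \<partial>PiM I (\<lambda>_. N)) \<partial>N)
      = (\<integral>\<^sup>+x. F (\<lambda>i'\<in>insert i I. h ((J(i := j)) i') (x i')) \<partial>PiM (insert i I) (\<lambda>_. N))"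
      by simp
  qed
  finally show ?case .
qed

section \<open>A subadditivity criterion for convergence\<close>

text \<open>Up to errors that vanish, the first hypothesis says that \<open>a n / sqrt n\<close> does not increase from \<open>k\<close>
  to \<open>m\<^sup>2 * k\<close>, and the second that it hardly changes between these sparse indices; hence the
  limit is the infimum of \<open>(a k + c k) / sqrt k\<close>.\<close>

lemma scaling_subadditive_convergent:
  fixes a c :: "nat \<Rightarrow> real" and B D :: real
  assumes a: "\<And>n. 0 \<le> a n" and c: "\<And>n. 0 \<le> c n" and c0: "(\<lambda>n. c n / sqrt n) \<longlonglongrightarrow> 0"
    and scaling: "\<And>m k. 0 < m \<Longrightarrow> 0 < k \<Longrightarrow> a (m\<^sup>2 * k) \<le> m * (a k + c k)"
    and step: "\<And>l n. 0 < l \<Longrightarrow> l \<le> n \<Longrightarrow> a n \<le> a l + B * sqrt (real (n - l)) + D" and B: "0 \<le> B"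
  shows "\<exists>L. (\<lambda>n. a n / sqrt n) \<longlonglongrightarrow> L"
proof -
  define \<gamma> where "\<gamma> k = (a k + c k) / sqrt k" for k :: nat
  define L where "L = (INF k\<in>{0<..}. \<gamma> k)"
  have \<gamma>0: "0 \<le> \<gamma> k" for k using a[of k] c[of k] by (simp add: \<gamma>_def)
  have bdd: "bdd_below (\<gamma> ` {0<..})" using \<gamma>0 by (intro bdd_belowI2[of _ 0]) auto
  have upper: "a n / sqrt n \<le> \<gamma> k + (B * sqrt (3 * sqrt k) * sqrt (sqrt n) + \<bar>D\<bar>) / sqrt n"
    if k: "0 < k" and n: "k \<le> n" for k n :: nat
  proof -
    define s where "s = sqrt n / sqrt k"
    \<comment> \<open>The largest \<open>m\<close> with \<open>m\<^sup>2 * k \<le> n\<close>.\<close>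
    define m where "m = nat \<lfloor>s\<rfloor>"
    have "1 \<le> s" using k n by (simp add: s_def)
    then have m: "1 \<le> m" "real m \<le> s" "s < m + 1" unfolding m_def by linarith+
    have sk: "s * s * k = n" using k by (simp add: s_def)
    have "(real m)\<^sup>2 * k \<le> s * s * k"
      unfolding power2_eq_square using m by (intro mult_mono mult_right_mono) auto
    then have "real (m\<^sup>2 * k) \<le> real n" by (simp add: sk)
    then have mn: "m\<^sup>2 * k \<le> n" by (rule of_nat_le_iff[THEN iffD1])
    have "s * s * k \<le> (real m + 1) * (real m + 1) * k"
      using m by (intro mult_mono mult_right_mono) auto
    then have "real n \<le> (real m + 1) * (real m + 1) * k" by (simp add: sk)
    then have "real (n - m\<^sup>2 * k) \<le> (2 * real m + 1) * k"
      using mn by (simp add: of_nat_diff power2_eq_square algebra_simps)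
    also have "\<dots> \<le> 3 * s * k" using m by (intro mult_right_mono) auto
    also have "\<dots> = 3 * sqrt k * sqrt n" using k by (simp add: s_def real_div_sqrt field_simps)
    finally have gap: "real (n - m\<^sup>2 * k) \<le> 3 * sqrt k * sqrt n" .
    have "a n \<le> a (m\<^sup>2 * k) + B * sqrt (real (n - m\<^sup>2 * k)) + D"
      using m k mn by (intro step) auto
    also have "\<dots> \<le> m * (a k + c k) + B * sqrt (3 * sqrt k * sqrt n) + \<bar>D\<bar>"
      using scaling[of m k] m k gap B mn
      by (intro add_mono mult_left_mono) auto
    also have "m * (a k + c k) \<le> s * (a k + c k)"
      using m a[of k] c[of k] by (intro mult_right_mono) auto
    also have "s * (a k + c k) = \<gamma> k * sqrt n" by (simp add: s_def \<gamma>_def)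
    finally have "a n \<le> \<gamma> k * sqrt n + (B * sqrt (3 * sqrt k) * sqrt (sqrt n) + \<bar>D\<bar>)"
      by (simp add: real_sqrt_mult)
    then show ?thesis using k n by (simp add: field_simps)
  qed
  have "(\<lambda>n. a n / sqrt n) \<longlonglongrightarrow> L"
  proof (rule order_tendstoI)
    fix y assume "y < L"
    then have "eventually (\<lambda>n. c n / sqrt n < L - y) sequentially"
      using c0 by (intro order_tendstoD) auto
    then show "eventually (\<lambda>n. y < a n / sqrt n) sequentially"
      using eventually_gt_at_top[of 0]
    proof eventually_elim
      case (elim n)
      have "L \<le> \<gamma> n" unfolding L_def using elim by (intro cINF_lower bdd) auto
      then show ?case using elim by (simp add: \<gamma>_def add_divide_distrib)
    qed
  next
    fix y assume "L < y"
    then obtain k where k: "0 < k" "\<gamma> k < y"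
      unfolding L_def by (subst (asm) cINF_less_iff[OF _ bdd]) auto
    define E where "E = B * sqrt (3 * sqrt k)"
    have "(\<lambda>n. (E * sqrt (sqrt (real n)) + \<bar>D\<bar>) / sqrt (real n)) \<longlonglongrightarrow> 0" by real_asymp
    then have "eventually (\<lambda>n. (E * sqrt (sqrt (real n)) + \<bar>D\<bar>) / sqrt (real n) < y - \<gamma> k) sequentially"
      using k by (intro order_tendstoD) auto
    then show "eventually (\<lambda>n. a n / sqrt n < y) sequentially"
      using eventually_ge_at_top[of k]
    proof eventually_elim
      case (elim n)
      then show ?case using upper[OF k(1), of n] unfolding E_def by linarith
    qed
  qed
  then show ?thesis ..
qed

section \<open>The mean length of the tree of a random sample\<close>

locale square_distribution = prob_space N for N :: "(real \<times> real) measure" +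
  assumes sets_N: "sets N = sets (restrict_space lborel unit_square)"
begin

lemma space_N: "space N = unit_square"
  using sets_eq_imp_space_eq[OF sets_N] by (simp add: space_restrict_space)

lemma borel_measurable_ident [measurable]: "(\<lambda>x. x) \<in> borel_measurable N"
proof -
  have "(\<lambda>x. x) \<in> borel_measurable (restrict_space lborel unit_square)"
    by (rule measurable_restrict_space1) simp
  then show ?thesis using measurable_cong_sets[OF sets_N refl] by blast
qed

abbreviation sample :: "nat set \<Rightarrow> (nat \<Rightarrow> real \<times> real) measure" where
  "sample I \<equiv> PiM I (\<lambda>_. N)"

lemma prob_space_sample: "prob_space (sample I)"
  by (intro prob_space_PiM) unfold_locales

lemma measure_space_sample [simp]: "measure (sample I) (space (sample I)) = 1"
  using prob_space.prob_space[OF prob_space_sample] .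

lemma integrable_sample_const [simp]: "integrable (sample I) (\<lambda>x. c :: real)"
proof -
  interpret S: prob_space "sample I" by (rule prob_space_sample)
  show ?thesis by simp
qed

lemma sample_in_square: "x \<in> space (sample I) \<Longrightarrow> A \<subseteq> I \<Longrightarrow> x ` A \<subseteq> unit_square"
  by (auto simp: space_PiM space_N PiE_def Pi_def)

lemma mst_length_sample_le:
  assumes "finite I" "x \<in> space (sample I)" "A \<subseteq> I"
  shows "mst_length (x ` A) \<le> 7 * sqrt (card A)"
  using assms finite_subset[OF assms(3,1)] sample_in_square[OF assms(2,3)]
  by (intro mst_length_square_le_sqrt card_image_le) auto

lemma bounded_measurable_mst_length:
  assumes "finite I" "A \<subseteq> I"
  shows "bounded_measurable (sample I) (\<lambda>x. mst_length (x ` A))"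
proof (rule bounded_measurableI)
  have fin: "finite A" using assms by (rule finite_subset[rotated])
  show "(\<lambda>x. mst_length (x ` A)) \<in> borel_measurable (sample I)"
  proof (rule borel_measurable_mst_length[OF fin])
    fix i assume "i \<in> A"
    then show "(\<lambda>x. x i) \<in> borel_measurable (sample I)"
      using assms
      by (intro measurable_compose[OF _ borel_measurable_ident] measurable_component_singleton) auto
  qed
  show "\<bar>mst_length (x ` A)\<bar> \<le> 7 * sqrt (card A)" if "x \<in> space (sample I)" for x
    using mst_length_sample_le[OF assms(1) that assms(2)] mst_length_nonneg[of "x ` A"] fin by simp
qed

lemma integrable_mst_length:
  "finite I \<Longrightarrow> A \<subseteq> I \<Longrightarrow> integrable (sample I) (\<lambda>x. mst_length (x ` A))"
  by (intro prob_space.integrable_bounded_measurable prob_space_sample bounded_measurable_mst_length)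

definition mean_mst :: "nat \<Rightarrow> real" where
  "mean_mst n = (\<integral>x. mst_length (x ` {1..n}) \<partial>sample {1..n})"

text \<open>The points are exchangeable, so that only the number of indices in \<open>A\<close> matters.\<close>

lemma integral_mst_length:
  assumes "finite I" "A \<subseteq> I"
  shows "(\<integral>x. mst_length (x ` A) \<partial>sample I) = mean_mst (card A)"
proof -
  have fin: "finite A" using assms by (rule finite_subset[rotated])
  obtain f where f: "bij_betw f {1..card A} A"
    using finite_same_card_bij[of "{1..card A}" A] fin by auto
  define t where "t x = (\<lambda>n\<in>{1..card A}. x (f n))" for x :: "nat \<Rightarrow> real \<times> real"
  have "distr (sample I) (sample {1..card A}) t = sample {1..card A}"
    unfolding t_def using f assms(2) prob_space_axioms
    by (intro distr_PiM_reindex) (auto simp: bij_betw_def)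
  then have "mean_mst (card A) = (\<integral>x. mst_length (x ` {1..card A}) \<partial>distr (sample I) (sample {1..card A}) t)"
    by (simp add: mean_mst_def)
  also have "\<dots> = (\<integral>x. mst_length (t x ` {1..card A}) \<partial>sample I)"
  proof (rule integral_distr)
    show "t \<in> measurable (sample I) (sample {1..card A})"
      unfolding t_def using f assms(2)
      by (intro measurable_restrict measurable_component_singleton) (auto simp: bij_betw_def)
    show "(\<lambda>x. mst_length (x ` {1..card A})) \<in> borel_measurable (sample {1..card A})"
      using bounded_measurable_mst_length[of "{1..card A}" "{1..card A}"]
      by (auto simp: bounded_measurable_def)
  qed
  also have "(\<lambda>x. mst_length (t x ` {1..card A})) = (\<lambda>x. mst_length (x ` A))"
  proof -
    have "t x ` {1..card A} = x ` (f ` {1..card A})" for x by (simp add: t_def image_image)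
    then show ?thesis using f by (simp add: bij_betw_def)
  qed
  finally show ?thesis by simp
qed

lemma mean_mst_nonneg: "0 \<le> mean_mst n"
  unfolding mean_mst_def by (intro Bochner_Integration.integral_nonneg mst_length_nonneg) auto

lemma mean_mst_le: "mean_mst n \<le> 7 * sqrt n"
proof -
  interpret S: prob_space "sample {1..n}" by (rule prob_space_sample)
  have "mean_mst n \<le> (\<integral>x. 7 * sqrt (card {1..n}) \<partial>sample {1..n})"
    unfolding mean_mst_def
    by (intro integral_mono integrable_mst_length mst_length_sample_le S.integrable_const) auto
  then show ?thesis by simp
qed

text \<open>Leaving out one point changes the length by at most the total length of the edges at
  that point, so that the Efron--Stein bound is controlled by the sum of the squared edge lengths.\<close>

lemma variance_mst_length_le:
  assumes "2 \<le> n"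
  shows "(\<integral>x. (mst_length (x ` {1..n}) - mean_mst n)\<^sup>2 \<partial>sample {1..n}) \<le> 248848 * log 2 n"
proof -
  interpret S: prob_space "sample {1..n}" by (rule prob_space_sample)
  define F where "F x = mst_length (x ` {1..n})" for x :: "nat \<Rightarrow> real \<times> real"
  define G where "G i x = mst_length (x ` ({1..n} - {i}))" for i and x :: "nat \<Rightarrow> real \<times> real"
  have F: "bounded_measurable (sample {1..n}) F"
    unfolding F_def by (rule bounded_measurable_mst_length) auto
  have G: "bounded_measurable (sample {1..n}) (G i)" for i
    unfolding G_def by (rule bounded_measurable_mst_length) auto
  have diff: "integrable (sample {1..n}) (\<lambda>x. (F x - G i x)\<^sup>2)" for i
    by (intro S.integrable_bounded_measurable bounded_measurable_square bounded_measurable_diff F G)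
  have "(\<integral>x. (F x - (\<integral>x. F x \<partial>sample {1..n}))\<^sup>2 \<partial>sample {1..n})
      \<le> (\<Sum>i\<in>{1..n}. \<integral>x. (F x - G i x)\<^sup>2 \<partial>sample {1..n})"
  proof (rule Efron_Stein)
    fix i y and x :: "nat \<Rightarrow> real \<times> real"
    have "(x(i := y)) ` ({1..n} - {i}) = x ` ({1..n} - {i})" by auto
    then show "G i (x(i := y)) = G i x" by (simp only: G_def)
  qed (use F G prob_space_axioms in auto)
  also have "\<dots> = (\<integral>x. (\<Sum>i\<in>{1..n}. (F x - G i x)\<^sup>2) \<partial>sample {1..n})"
    by (rule Bochner_Integration.integral_sum[symmetric]) (rule diff)
  also have "\<dots> \<le> (\<integral>x. 248848 * log 2 n \<partial>sample {1..n})"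
  proof (rule integral_mono)
    fix x assume "x \<in> space (sample {1..n})"
    then have "x ` {1..n} \<subseteq> unit_square" by (rule sample_in_square) simp
    then show "(\<Sum>i\<in>{1..n}. (F x - G i x)\<^sup>2) \<le> 248848 * log 2 n"
      unfolding F_def G_def using assms by (intro sum_square_mst_length_delete_le) auto
  qed (intro Bochner_Integration.integrable_sum diff S.integrable_const)+
  also have "\<dots> = 248848 * log 2 n" by simp
  finally show ?thesis by (simp add: F_def mean_mst_def)
qed

lemma mst_length_sample_step:
  fixes x :: "nat \<Rightarrow> real \<times> real"
  assumes x: "x ` {1..n} \<subseteq> unit_square" and l: "0 < l" "l \<le> n"
  shows "mst_length (x ` {1..n}) \<le> mst_length (x ` {1..l}) + 7 * sqrt (real (n - l)) + 2"
proof (cases "l = n")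
  case False
  have split: "{1..n} = {1..l} \<union> {Suc l..n}" using l by auto
  have in_square: "x i \<in> unit_square" if "i \<in> {1..n}" for i using x that by blast
  have "mst_length (x ` {1..n}) \<le> mst_length (x ` {1..l}) + mst_length (x ` {Suc l..n}) + dist (x 1) (x n)"
    unfolding split image_Un using l False by (intro mst_length_union_le) auto
  also have "mst_length (x ` {Suc l..n}) \<le> 7 * sqrt (real (n - l))"
    using x split card_image_le[of "{Suc l..n}" x] by (intro mst_length_square_le_sqrt) auto
  also have "dist (x 1) (x n) \<le> 2"
    using dist_unit_square_le[of "x 1" "x n"] in_square[of 1] in_square[of n] l sqrt2_less_2 by auto
  finally show ?thesis by simp
qed simp

lemma mean_mst_step:
  assumes "0 < l" "l \<le> n"
  shows "mean_mst n \<le> mean_mst l + 7 * sqrt (real (n - l)) + 2"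
proof -
  interpret S: prob_space "sample {1..n}" by (rule prob_space_sample)
  have sub: "{1..l} \<subseteq> {1..n}" using assms by auto
  have "mean_mst n \<le> (\<integral>x. mst_length (x ` {1..l}) + (7 * sqrt (real (n - l)) + 2) \<partial>sample {1..n})"
    unfolding mean_mst_def
  proof (rule integral_mono)
    fix x assume "x \<in> space (sample {1..n})"
    then show "mst_length (x ` {1..n}) \<le> mst_length (x ` {1..l}) + (7 * sqrt (real (n - l)) + 2)"
      using mst_length_sample_step[of x n l] sample_in_square[of x "{1..n}" "{1..n}"] assms by simp
  qed (intro Bochner_Integration.integrable_add integrable_mst_length sub S.integrable_const; simp)+
  also have "\<dots> = mean_mst l + (7 * sqrt (real (n - l)) + 2)"
    using sub integral_mst_length[of "{1..n}" "{1..l}"]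
    by (subst Bochner_Integration.integral_add) (auto intro!: integrable_mst_length)
  finally show ?thesis by simp
qed

text \<open>In the other direction, deletion inequalities are available only on average: deleting each
  of the points in turn costs \<open>2 * mst_length\<close> in total, as every edge has two endpoints.\<close>

lemma mean_mst_delete: "mean_mst n \<le> mean_mst (Suc n) + 14 / sqrt (Suc n)"
proof -
  let ?I = "{1..Suc n}"
  have fin: "finite ?I" by simp
  have "Suc n * mean_mst n = (\<Sum>i\<in>?I. \<integral>x. mst_length (x ` (?I - {i})) \<partial>sample ?I)"
    by (subst sum.cong[OF refl integral_mst_length[OF fin]]) (auto simp: card_Diff_singleton)
  also have "\<dots> = (\<integral>x. (\<Sum>i\<in>?I. mst_length (x ` (?I - {i}))) \<partial>sample ?I)"
    by (rule Bochner_Integration.integral_sum[symmetric]) (auto intro!: integrable_mst_length)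
  also have "\<dots> \<le> (\<integral>x. (Suc n + 2) * mst_length (x ` ?I) \<partial>sample ?I)"
  proof (rule integral_mono)
    fix x
    have "(\<Sum>i\<in>?I. mst_length (x ` (?I - {i})))
        \<le> (\<Sum>i\<in>?I. mst_length (x ` ?I) + \<bar>mst_length (x ` ?I) - mst_length (x ` (?I - {i}))\<bar>)"
      by (rule sum_mono) linarith
    also have "\<dots> \<le> (Suc n + 2) * mst_length (x ` ?I)"
      using sum_abs_mst_length_delete_le[of ?I x] by (simp add: sum.distrib algebra_simps)
    finally show "(\<Sum>i\<in>?I. mst_length (x ` (?I - {i}))) \<le> (Suc n + 2) * mst_length (x ` ?I)" .
  qed (auto intro!: integrable_mst_length)
  also have "\<dots> = (Suc n + 2) * mean_mst (Suc n)" by (simp add: mean_mst_def)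
  finally have "Suc n * mean_mst n \<le> Suc n * mean_mst (Suc n) + 2 * mean_mst (Suc n)"
    by (simp add: algebra_simps)
  then have "Suc n * mean_mst n \<le> Suc n * mean_mst (Suc n) + 2 * (7 * sqrt (Suc n))"
    using mean_mst_le[of "Suc n"] by linarith
  then have "mean_mst n \<le> (Suc n * mean_mst (Suc n) + 2 * (7 * sqrt (Suc n))) / Suc n"
    by (subst pos_le_divide_eq) (simp_all only: mult.commute of_nat_0_less_iff zero_less_Suc)
  also have "\<dots> = mean_mst (Suc n) + 14 * (sqrt (Suc n) / Suc n)"
    by (simp add: add_divide_distrib)
  also have "sqrt (Suc n) / Suc n = 1 / sqrt (Suc n)"
    by (simp add: real_div_sqrt field_simps)
  finally show ?thesis by simp
qed

text \<open>Summing the differences of the previous bound, as \<open>1 / sqrt (Suc n)\<close> is at most twice \<open>sqrt (Suc n) - sqrt n\<close>.\<close>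

lemma mean_mst_delete_many:
  assumes "l \<le> n"
  shows "mean_mst l \<le> mean_mst n + 28 * (sqrt n - sqrt l)"
  using assms
proof (induction n rule: dec_induct)
  case (step n)
  have "1 = (sqrt (Suc n) - sqrt n) * (sqrt (Suc n) + sqrt n)" by (simp add: algebra_simps)
  also have "\<dots> \<le> (sqrt (Suc n) - sqrt n) * (2 * sqrt (Suc n))"
    by (intro mult_left_mono) auto
  finally have "1 / sqrt (Suc n) \<le> 2 * (sqrt (Suc n) - sqrt n)" by (simp add: field_simps)
  then show ?case using step.IH mean_mst_delete[of n] by simp
qed simp

lemma sqrt_diff_le: "sqrt n - sqrt l \<le> sqrt (real (n - l))" if "l \<le> n" for l n :: nat
  using sqrt_add_le_add_sqrt[of "real (n - l)" l] that by (simp add: of_nat_diff)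

lemma abs_mean_mst_diff_le:
  assumes "l \<le> n"
  shows "\<bar>mean_mst n - mean_mst l\<bar> \<le> 28 * sqrt (real (n - l)) + 2"
proof -
  have "mean_mst l \<le> mean_mst n + 28 * sqrt (real (n - l))"
    using mean_mst_delete_many[OF assms] sqrt_diff_le[OF assms] by simp
  moreover have "mean_mst n \<le> mean_mst l + 7 * sqrt (real (n - l)) + 2"
  proof (cases "l = 0")
    case True
    then show ?thesis using mean_mst_le[of n] mean_mst_nonneg[of 0] by simp
  qed (use assms mean_mst_step in auto)
  ultimately show ?thesis by (simp add: abs_le_iff) (smt (verit) real_sqrt_ge_zero of_nat_0_le_iff)
qed

end

section \<open>Almost sure convergence from the squares\<close>

text \<open>Between \<open>k\<^sup>2\<close> and \<open>(k + 1)\<^sup>2\<close> the error terms are \<open>O (sqrt k)\<close>, while the normalisation is of order \<open>k\<close>.  The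
  hypothesis on \<open>z\<close> is one-sided: \<open>z n\<close> is bounded above through the square below \<open>n\<close> and bounded below through the
  square above \<open>n\<close>.  For the length of the tree this is essential, since adding points is always cheap, but
  removing them need not be.\<close>

lemma tendsto_zero_from_squares:
  fixes z \<mu> :: "nat \<Rightarrow> real"
  assumes z: "\<And>l n. 0 < l \<Longrightarrow> l \<le> n \<Longrightarrow> z n \<le> z l + B * sqrt (real (n - l)) + D"
    and \<mu>: "\<And>l n. l \<le> n \<Longrightarrow> \<bar>\<mu> n - \<mu> l\<bar> \<le> B * sqrt (real (n - l)) + D"
    and B: "0 \<le> B"
    and squares: "(\<lambda>k. (z (k\<^sup>2) - \<mu> (k\<^sup>2)) / k) \<longlonglongrightarrow> 0"
  shows "(\<lambda>n. (z n - \<mu> n) / sqrt n) \<longlonglongrightarrow> 0"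
proof -
  define y where "y k = \<bar>(z (k\<^sup>2) - \<mu> (k\<^sup>2)) / k\<bar>" for k :: nat
  define b where "b k = y k + y (Suc k) * (Suc k / k) + 2 * (B * sqrt (3 * k) + D) / k" for k :: nat
  define r where "r n = nat \<lfloor>sqrt n\<rfloor>" for n :: nat
  have y: "y \<longlonglongrightarrow> 0" unfolding y_def using squares by (rule tendsto_rabs_zero)
  have "(\<lambda>k. real (Suc k) / real k) \<longlonglongrightarrow> 1" by real_asymp
  from tendsto_mult[OF LIMSEQ_Suc[OF y] this] have "(\<lambda>k. y (Suc k) * (Suc k / k)) \<longlonglongrightarrow> 0" by simp
  moreover have "(\<lambda>k. 2 * (B * sqrt (3 * real k) + D) / real k) \<longlonglongrightarrow> 0" by real_asymp
  ultimately have b: "b \<longlonglongrightarrow> 0"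
    unfolding b_def using tendsto_add[OF tendsto_add[OF y]] by fastforce
  have "filterlim r at_top sequentially" unfolding r_def by real_asymp
  then have br: "(\<lambda>n. b (r n)) \<longlonglongrightarrow> 0" using b by (rule filterlim_compose[rotated])
  have bound: "\<bar>(z n - \<mu> n) / sqrt n\<bar> \<le> b (r n)" if n: "0 < n" for n
  proof -
    define k where "k = r n"
    have "1 \<le> sqrt n" using n by simp
    then have k: "1 \<le> k" "real k \<le> sqrt n" "sqrt n < k + 1" unfolding k_def r_def by linarith+
    have "(real k)\<^sup>2 \<le> (sqrt n)\<^sup>2" "(sqrt n)\<^sup>2 < (real (k + 1))\<^sup>2"
      using k by (intro power_mono power_strict_mono; simp)+
    then have "real (k\<^sup>2) \<le> real n" "real n < real ((Suc k)\<^sup>2)" by simp_all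
    then have kn: "k\<^sup>2 \<le> n" "n < (Suc k)\<^sup>2" by (simp_all only: of_nat_le_iff of_nat_less_iff)
    have "n - k\<^sup>2 \<le> 3 * k" "(Suc k)\<^sup>2 - n \<le> 3 * k"
      using kn k(1) by (simp_all add: power2_eq_square)
    then have "real (n - k\<^sup>2) \<le> 3 * real k" "real ((Suc k)\<^sup>2 - n) \<le> 3 * real k" by linarith+
    then have e: "B * sqrt (real (n - k\<^sup>2)) \<le> B * sqrt (3 * k)" "B * sqrt (real ((Suc k)\<^sup>2 - n)) \<le> B * sqrt (3 * k)"
      using B by (auto intro!: mult_left_mono)
    define e where "e = B * sqrt (3 * k) + D"
    have "z n \<le> z (k\<^sup>2) + (B * sqrt (3 * k) + D)" using z[of "k\<^sup>2" n] kn k(1) e by simp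
    moreover have "z ((Suc k)\<^sup>2) \<le> z n + (B * sqrt (3 * k) + D)" using z[of n "(Suc k)\<^sup>2"] kn n e by simp
    moreover have "\<bar>\<mu> n - \<mu> (k\<^sup>2)\<bar> \<le> B * sqrt (3 * k) + D" using \<mu>[of "k\<^sup>2" n] kn e by simp
    moreover have "\<bar>\<mu> ((Suc k)\<^sup>2) - \<mu> n\<bar> \<le> B * sqrt (3 * k) + D"
      using \<mu>[of n "(Suc k)\<^sup>2"] kn e by simp
    ultimately have "\<bar>z n - \<mu> n\<bar> \<le> \<bar>z (k\<^sup>2) - \<mu> (k\<^sup>2)\<bar> + \<bar>z ((Suc k)\<^sup>2) - \<mu> ((Suc k)\<^sup>2)\<bar> + 2 * e"
      unfolding e_def[symmetric] by linarith
    also have "\<bar>z (k\<^sup>2) - \<mu> (k\<^sup>2)\<bar> = y k * k"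
      using k(1) by (simp add: y_def abs_divide)
    also have "\<bar>z ((Suc k)\<^sup>2) - \<mu> ((Suc k)\<^sup>2)\<bar> = y (Suc k) * Suc k"
      by (simp add: y_def abs_divide)
    also have "y k * k + y (Suc k) * Suc k + 2 * e = b k * k"
      using k(1) by (simp add: b_def e_def distrib_right add_divide_distrib)
    finally have *: "\<bar>z n - \<mu> n\<bar> \<le> b k * k" .
    then have "0 \<le> b k * k" by linarith
    then have "0 \<le> b k" using k(1) by (simp add: zero_le_mult_iff)
    then have "b k * k \<le> b k * sqrt n" using k(2) by (intro mult_left_mono)
    with * have "\<bar>z n - \<mu> n\<bar> \<le> b k * sqrt n" by linarith
    then show ?thesis using n by (simp add: abs_divide field_simps k_def)
  qed
  show ?thesis
    by (rule tendsto_rabs_zero_cancel, rule tendsto_sandwich[OF _ _ tendsto_const br])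
      (use bound in \<open>auto simp: eventually_sequentially intro!: exI[of _ 1]\<close>)
qed

text \<open>The series of the squares has a finite mean, so it converges almost surely.\<close>

lemma (in prob_space) AE_tendsto_zero_summable_squares:
  fixes Y :: "nat \<Rightarrow> 'a \<Rightarrow> real"
  assumes Y: "\<And>k. bounded_measurable M (Y k)" and s: "summable (\<lambda>k. \<integral>\<omega>. (Y k \<omega>)\<^sup>2 \<partial>M)"
  shows "AE \<omega> in M. (\<lambda>k. Y k \<omega>) \<longlonglongrightarrow> 0"
proof -
  have [measurable]: "Y k \<in> borel_measurable M" for k using Y by (auto simp: bounded_measurable_def)
  have int: "integrable M (\<lambda>\<omega>. (Y k \<omega>)\<^sup>2)" for k
    using Y by (intro integrable_bounded_measurable bounded_measurable_square)
  have "(\<integral>\<^sup>+\<omega>. (\<Sum>k. ennreal ((Y k \<omega>)\<^sup>2)) \<partial>M) = (\<Sum>k. \<integral>\<^sup>+\<omega>. ennreal ((Y k \<omega>)\<^sup>2) \<partial>M)"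
    by (rule nn_integral_suminf) simp
  also have "\<dots> = (\<Sum>k. ennreal (\<integral>\<omega>. (Y k \<omega>)\<^sup>2 \<partial>M))"
    using int by (simp add: nn_integral_eq_integral)
  also have "\<dots> \<noteq> \<infinity>" using s by (simp add: ennreal_suminf_neq_top)
  finally have "AE \<omega> in M. (\<Sum>k. ennreal ((Y k \<omega>)\<^sup>2)) \<noteq> \<infinity>"
    by (intro nn_integral_noteq_infinite) auto
  then show ?thesis
  proof eventually_elim
    case (elim \<omega>)
    then have "summable (\<lambda>k. (Y k \<omega>)\<^sup>2)" by (intro summable_suminf_not_top) auto
    then have "(\<lambda>k. (Y k \<omega>)\<^sup>2) \<longlonglongrightarrow> 0" by (rule summable_LIMSEQ_zero)
    then have "(\<lambda>k. sqrt ((Y k \<omega>)\<^sup>2)) \<longlonglongrightarrow> sqrt 0" by (rule tendsto_real_sqrt)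
    then show ?case by (simp add: tendsto_rabs_zero_iff)
  qed
qed

section \<open>The uniform distribution\<close>

definition cells :: "nat \<Rightarrow> (real \<times> real) set" where
  "cells m = (real ` {..<m}) \<times> (real ` {..<m})"

definition into_cell :: "nat \<Rightarrow> real \<times> real \<Rightarrow> real \<times> real \<Rightarrow> real \<times> real" where
  "into_cell m q u = (1 / m) *\<^sub>R (q + u)"

lemma finite_cells [simp]: "finite (cells m)" and card_cells: "card (cells m) = m\<^sup>2"
  by (auto simp: cells_def card_cartesian_product card_image power2_eq_square)

lemma dist_into_cell: "dist (into_cell m q u) (into_cell m q v) = (1 / m) * dist u v"
  by (simp add: into_cell_def dist_norm flip: scaleR_diff_right)

lemma exists_cell_coordinate:
  fixes s :: real and m :: nat
  assumes m: "0 < m" and s: "0 \<le> s" "s \<le> 1"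
  shows "\<exists>i<m. i \<le> m * s \<and> m * s \<le> real i + 1"
proof (cases "s = 1")
  case True
  \<comment> \<open>The right end belongs to the last cell.\<close>
  then show ?thesis using m by (intro exI[of _ "m - 1"]) (auto simp: of_nat_diff)
next
  case False
  then have "real m * s < real m * 1" using m s by (intro mult_strict_left_mono) auto
  moreover have "0 \<le> real m * s" using s by simp
  ultimately show ?thesis by (intro exI[of _ "nat \<lfloor>m * s\<rfloor>"]) (simp; linarith)
qed

lemma nn_integral_lborel_affine:
  fixes f :: "real \<times> real \<Rightarrow> ennreal" and c :: real
  assumes [measurable]: "f \<in> borel_measurable borel" and c: "c \<noteq> 0"
  shows "(\<integral>\<^sup>+x. f x \<partial>lborel) = ennreal (c\<^sup>2) * (\<integral>\<^sup>+x. f (t + c *\<^sub>R x) \<partial>lborel)"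
proof -
  have "(\<integral>\<^sup>+x. f x \<partial>lborel)
      = (\<integral>\<^sup>+x. f x \<partial>density (distr lborel borel (\<lambda>x. t + c *\<^sub>R x)) (\<lambda>_. \<bar>c\<bar> ^ DIM(real \<times> real)))"
    by (subst lborel_affine[OF c, of t]) simp
  also have "\<dots> = ennreal (c\<^sup>2) * (\<integral>\<^sup>+x. f (t + c *\<^sub>R x) \<partial>lborel)"
    by (subst nn_integral_density) (auto simp: nn_integral_distr nn_integral_cmult power2_eq_square)
  finally show ?thesis .
qed

text \<open>A uniform point is obtained by choosing one of the \<open>m\<^sup>2\<close> cells and a uniform point in it.  The
  closed cells cover the square, and their overlaps only increase the right-hand side.\<close>

lemma uniform_le_mixture:
  fixes F :: "real \<times> real \<Rightarrow> ennreal"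
  assumes m: "0 < m" and F: "F \<in> borel_measurable (restrict_space lborel unit_square)"
  shows "(\<integral>\<^sup>+x. F x \<partial>restrict_space lborel unit_square)
    \<le> (\<Sum>q\<in>cells m. ennreal (1 / (real m)\<^sup>2) * (\<integral>\<^sup>+u. F (into_cell m q u) \<partial>restrict_space lborel unit_square))"
proof -
  have S [measurable]: "unit_square \<in> sets borel"
    unfolding unit_square_def by (intro borel_closed closed_Times) auto
  define g where "g x = F x * indicator unit_square x" for x
  have g [measurable]: "g \<in> borel_measurable borel"
    using F S unfolding g_def by (simp add: borel_measurable_restrict_space_iff_ennreal)
  have restrict: "(\<integral>\<^sup>+x. f x \<partial>restrict_space lborel unit_square) = (\<integral>\<^sup>+x. f x * indicator unit_square x \<partial>lborel)" for f
    by (rule nn_integral_restrict_space) simp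
  have in_square: "into_cell m q u \<in> unit_square" if q: "q \<in> cells m" and u: "u \<in> unit_square" for q u
  proof -
    have *: "0 \<le> real i + s" "real i + s \<le> m" if "i < m" "0 \<le> s" "s \<le> 1" for i s
      using that by linarith+
    obtain i j where "q = (real i, real j)" "i < m" "j < m" using q by (auto simp: cells_def)
    moreover obtain s t where "u = (s, t)" "0 \<le> s" "s \<le> 1" "0 \<le> t" "t \<le> 1"
      using u by (auto simp: unit_square_def)
    ultimately show ?thesis using * m by (simp add: into_cell_def unit_square_def field_simps)
  qed
  have covered: "1 \<le> (\<Sum>q\<in>cells m. indicator unit_square (m *\<^sub>R x - q) :: ennreal)"
    if x: "x \<in> unit_square" for x
  proof -
    obtain s t where st: "x = (s, t)" "0 \<le> s" "s \<le> 1" "0 \<le> t" "t \<le> 1"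
      using x by (auto simp: unit_square_def)
    obtain i j where "i < m" "real i \<le> m * s" "m * s \<le> real i + 1" "j < m" "real j \<le> m * t" "m * t \<le> real j + 1"
      using exists_cell_coordinate[OF m st(2,3)] exists_cell_coordinate[OF m st(4,5)] by blast
    then have q: "(real i, real j) \<in> cells m" and "m *\<^sub>R x - (real i, real j) \<in> unit_square"
      by (auto simp: cells_def unit_square_def st)
    then have "1 = (indicator unit_square (m *\<^sub>R x - (real i, real j)) :: ennreal)" by simp
    also have "\<dots> \<le> (\<Sum>q\<in>cells m. indicator unit_square (m *\<^sub>R x - q))"
      using q by (intro member_le_sum) auto
    finally show ?thesis .
  qed
  have "(\<integral>\<^sup>+x. F x \<partial>restrict_space lborel unit_square) = (\<integral>\<^sup>+x. g x \<partial>lborel)"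
    by (simp add: restrict g_def)
  also have "\<dots> \<le> (\<integral>\<^sup>+x. (\<Sum>q\<in>cells m. g x * indicator unit_square (m *\<^sub>R x - q)) \<partial>lborel)"
  proof (rule nn_integral_mono)
    fix x
    show "g x \<le> (\<Sum>q\<in>cells m. g x * indicator unit_square (m *\<^sub>R x - q))"
    proof (cases "x \<in> unit_square")
      case True
      then show ?thesis
        using mult_left_mono[OF covered[OF True], of "g x"] by (simp add: sum_distrib_left)
    qed (simp add: g_def)
  qed
  also have "\<dots> = (\<Sum>q\<in>cells m. \<integral>\<^sup>+x. g x * indicator unit_square (m *\<^sub>R x - q) \<partial>lborel)"
    by (rule nn_integral_sum) measurable
  also have "\<dots> = (\<Sum>q\<in>cells m. ennreal (1 / (real m)\<^sup>2) * (\<integral>\<^sup>+u. F (into_cell m q u) \<partial>restrict_space lborel unit_square))"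
  proof (rule sum.cong)
    fix q assume q: "q \<in> cells m"
    have g_ind: "(\<lambda>x. g x * indicator unit_square (m *\<^sub>R x - q)) \<in> borel_measurable borel"
      by measurable
    have "(\<integral>\<^sup>+x. g x * indicator unit_square (m *\<^sub>R x - q) \<partial>lborel)
      = ennreal ((1 / m)\<^sup>2) * (\<integral>\<^sup>+u. g ((1 / m) *\<^sub>R q + (1 / m) *\<^sub>R u)
          * indicator unit_square (m *\<^sub>R ((1 / m) *\<^sub>R q + (1 / m) *\<^sub>R u) - q) \<partial>lborel)"
      by (rule nn_integral_lborel_affine[OF g_ind]) (use m in simp)
    also have "\<dots> = ennreal (1 / (real m)\<^sup>2) * (\<integral>\<^sup>+u. F (into_cell m q u) * indicator unit_square u \<partial>lborel)"
    proof -
      have "g ((1 / m) *\<^sub>R q + (1 / m) *\<^sub>R u)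
          * indicator unit_square (m *\<^sub>R ((1 / m) *\<^sub>R q + (1 / m) *\<^sub>R u) - q)
        = F (into_cell m q u) * indicator unit_square u" for u
      proof -
        have "m *\<^sub>R ((1 / m) *\<^sub>R q + (1 / m) *\<^sub>R u) - q = u" using m by (simp add: scaleR_add_right)
        moreover have "(1 / m) *\<^sub>R q + (1 / m) *\<^sub>R u = into_cell m q u"
          by (simp add: into_cell_def scaleR_add_right)
        ultimately show ?thesis using in_square[OF q, of u] by (simp add: g_def indicator_def)
      qed
      then show ?thesis by (simp add: power_divide)
    qed
    finally show "(\<integral>\<^sup>+x. g x * indicator unit_square (m *\<^sub>R x - q) \<partial>lborel)
      = ennreal (1 / (real m)\<^sup>2) * (\<integral>\<^sup>+u. F (into_cell m q u) \<partial>restrict_space lborel unit_square)"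
      by (simp add: restrict)
  qed simp
  finally show ?thesis .
qed

lemma into_cell_measurable:
  assumes "0 < m" "q \<in> cells m"
  shows "into_cell m q \<in> measurable (restrict_space lborel unit_square) (restrict_space lborel unit_square)"
proof (rule measurable_restrict_space2)
  have *: "0 \<le> real i + s" "real i + s \<le> m" if "i < m" "0 \<le> s" "s \<le> 1" for i s
    using that by linarith+
  show "into_cell m q \<in> space (restrict_space lborel unit_square) \<rightarrow> unit_square"
    using assms * by (auto simp: space_restrict_space cells_def unit_square_def into_cell_def field_simps)
  show "into_cell m q \<in> measurable (restrict_space lborel unit_square) lborel"
    unfolding into_cell_def by (rule measurable_restrict_space1) simp
qed

text \<open>This bounds the mean of \<open>sqrt Y\<close> by the second moment of \<open>Y\<close>; if the latter is \<open>s\<^sup>4\<close>, then both terms have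
  mean \<open>s\<close>.\<close>

lemma sqrt_le_square_div_cube: "sqrt y \<le> y\<^sup>2 / s ^ 3 + s" if "0 \<le> y" "0 < s" for y s :: real
proof (cases "sqrt y \<le> s")
  case True
  then show ?thesis using that by (simp add: add_increasing)
next
  case False
  have "sqrt y * s ^ 3 \<le> sqrt y * (sqrt y) ^ 3"
    using False that by (intro mult_left_mono power_mono) auto
  also have "\<dots> = (sqrt y * sqrt y) * (sqrt y * sqrt y)" by (simp only: power3_eq_cube mult.assoc)
  also have "\<dots> = y\<^sup>2" using that by (simp only: real_sqrt_mult_self abs_of_nonneg power2_eq_square)
  finally have "sqrt y \<le> y\<^sup>2 / s ^ 3" using that by (simp add: field_simps)
  then show ?thesis using that by simp
qed

locale uniform_square = square_distribution "restrict_space lborel unit_square"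
begin

text \<open>Given the numbers of points in the \<open>m\<^sup>2\<close> cells, the points in each cell are a rescaled sample.  As
  these numbers deviate from \<open>k\<close> by about \<open>sqrt k\<close>, replacing them by \<open>k\<close> costs about \<open>k powr (1/4)\<close>
  per cell; connecting the trees of the cells costs a bounded amount per cell.\<close>

lemma mean_mst_scaling:
  assumes m: "0 < m" and k: "0 < k"
  shows "mean_mst (m\<^sup>2 * k) \<le> m * (mean_mst k + (9 + 56 * sqrt (sqrt k)))"
proof -
  define n where "n = m\<^sup>2 * k"
  let ?I = "{1..n}"
  define A where "A J q = {i\<in>?I. J i = q}" for J :: "nat \<Rightarrow> real \<times> real" and q
  define s where "s = sqrt (sqrt k)"
  have s: "0 < s" "s ^ 4 = k"
  proof -
    show "0 < s" using k by (simp add: s_def)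
    have "s ^ 4 = (s\<^sup>2)\<^sup>2" by simp
    then show "s ^ 4 = k" by (simp add: s_def)
  qed
  define b where "b J = (\<Sum>q\<in>cells m. (1 / m) * mean_mst (card (A J q))) + 7 * real m" for J
  let ?CJ = "?I \<rightarrow>\<^sub>E cells m"
  have finA: "finite (A J q)" for J q by (simp add: A_def)
  have pointwise: "mst_length ((\<lambda>i\<in>?I. into_cell m (J i) (u i)) ` ?I)
      \<le> (\<Sum>q\<in>cells m. (1 / m) * mst_length (u ` A J q)) + 7 * real m"
    if J: "J \<in> ?CJ" and u: "u \<in> space (sample ?I)" for J u
  proof -
    define V where "V q = into_cell m q ` (u ` A J q)" for q
    define Q where "Q = J ` ?I"
    have Q: "Q \<subseteq> cells m" using J by (auto simp: Q_def)
    have finQ: "finite Q" by (simp add: Q_def)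
    have V: "V q \<noteq> {}" if "q \<in> Q" for q using that by (auto simp: V_def A_def Q_def)
    define r where "r q = (SOME v. v \<in> V q)" for q
    have r: "r q \<in> V q" if "q \<in> Q" for q unfolding r_def using V[OF that] by (simp add: some_in_eq)
    have "(\<lambda>i\<in>?I. into_cell m (J i) (u i)) ` ?I = (\<Union>q\<in>Q. V q)"
    proof (intro equalityI subsetI)
      fix v assume "v \<in> (\<lambda>i\<in>?I. into_cell m (J i) (u i)) ` ?I"
      then obtain i where "i \<in> ?I" "v = into_cell m (J i) (u i)" by auto
      then have "v \<in> V (J i)" "J i \<in> Q" unfolding V_def Q_def A_def by blast+
      then show "v \<in> (\<Union>q\<in>Q. V q)" by blast
    next
      fix v assume "v \<in> (\<Union>q\<in>Q. V q)"
      then obtain q where "v \<in> V q" by blast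
      then obtain i where "i \<in> ?I" "J i = q" "v = into_cell m q (u i)"
        unfolding V_def A_def by blast
      then show "v \<in> (\<lambda>i\<in>?I. into_cell m (J i) (u i)) ` ?I"
        by (intro image_eqI[of _ _ i]) simp_all
    qed
    moreover have "mst_length (\<Union>q\<in>Q. V q) \<le> (\<Sum>q\<in>Q. mst_length (V q)) + mst_length (r ` Q)"
      using finQ r finA by (intro mst_length_partition_le) (auto simp: V_def)
    moreover have "(\<Sum>q\<in>Q. mst_length (V q)) \<le> (\<Sum>q\<in>Q. (1 / m) * mst_length (u ` A J q))"
      unfolding V_def using finA
      by (intro sum_mono mst_length_lipschitz_image) (auto simp: dist_into_cell)
    moreover have "\<dots> \<le> (\<Sum>q\<in>cells m. (1 / m) * mst_length (u ` A J q))"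
      using Q finA by (intro sum_mono2 mult_nonneg_nonneg mst_length_nonneg) auto
    moreover have "mst_length (r ` Q) \<le> 7 * sqrt (real (m\<^sup>2))"
    proof (rule mst_length_square_le_sqrt)
      show "r ` Q \<subseteq> unit_square"
      proof
        fix v assume "v \<in> r ` Q"
        then obtain q i where "q \<in> Q" "v = into_cell m q (u i)" "i \<in> ?I"
          using r by (fastforce simp: V_def A_def)
        then show "v \<in> unit_square"
          using measurable_space[OF into_cell_measurable[OF m], of q "u i"] Q
            sample_in_square[OF u order_refl] unfolding space_N by blast
      qed
      have "card (r ` Q) \<le> card Q" using finQ by (rule card_image_le)
      also have "\<dots> \<le> card (cells m)" using Q by (intro card_mono) auto
      finally show "card (r ` Q) \<le> m\<^sup>2" by (simp add: card_cells)
    qed (use finQ in auto)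
    ultimately show ?thesis by simp
  qed
  have bound: "(\<integral>\<^sup>+u. ennreal (mst_length ((\<lambda>i\<in>?I. into_cell m (J i) (u i)) ` ?I)) \<partial>sample ?I) \<le> ennreal (b J)"
    if J: "J \<in> ?CJ" for J
  proof -
    let ?R = "\<lambda>u. (\<Sum>q\<in>cells m. (1 / m) * mst_length (u ` A J q)) + 7 * real m"
    have sub: "A J q \<subseteq> ?I" for q by (auto simp: A_def)
    have int: "integrable (sample ?I) (\<lambda>u. (1 / m) * mst_length (u ` A J q))" for q
      using sub by (intro integrable_mult_right integrable_mst_length) auto
    have "(\<integral>\<^sup>+u. ennreal (mst_length ((\<lambda>i\<in>?I. into_cell m (J i) (u i)) ` ?I)) \<partial>sample ?I)
        \<le> (\<integral>\<^sup>+u. ennreal (?R u) \<partial>sample ?I)"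
      by (intro nn_integral_mono ennreal_leI pointwise[OF J])
    also have "\<dots> = ennreal (\<integral>u. ?R u \<partial>sample ?I)"
    proof (rule nn_integral_eq_integral)
      show "integrable (sample ?I) ?R"
        by (intro Bochner_Integration.integrable_add Bochner_Integration.integrable_sum int
            integrable_sample_const)
      have "0 \<le> ?R u" for u
        using finA by (intro add_nonneg_nonneg sum_nonneg mult_nonneg_nonneg mst_length_nonneg) auto
      then show "AE u in sample ?I. 0 \<le> ?R u" by (intro AE_I2)
    qed
    also have "(\<integral>u. ?R u \<partial>sample ?I) = b J"
      unfolding b_def
      by (subst Bochner_Integration.integral_add, intro Bochner_Integration.integrable_sum int)
        (use sub int integral_mst_length[OF finite_atLeastAtMost sub] in
          \<open>simp_all add: Bochner_Integration.integral_sum\<close>)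
    finally show ?thesis .
  qed
  have b0: "0 \<le> b J" for J
    unfolding b_def using mean_mst_nonneg by (auto intro!: add_nonneg_nonneg sum_nonneg)
  have "ennreal (mean_mst n) = (\<integral>\<^sup>+x. ennreal (mst_length (x ` ?I)) \<partial>sample ?I)"
    unfolding mean_mst_def
    by (intro nn_integral_eq_integral[symmetric] integrable_mst_length AE_I2 mst_length_nonneg) auto
  also have "\<dots> \<le> (\<Sum>J\<in>?CJ. (ennreal (1 / (real m)\<^sup>2)) ^ card ?I *
      (\<integral>\<^sup>+u. ennreal (mst_length ((\<lambda>i\<in>?I. into_cell m (J i) (u i)) ` ?I)) \<partial>sample ?I))"
  proof (rule nn_integral_PiM_le_mixture)
    show "(\<lambda>x. ennreal (mst_length (x ` ?I))) \<in> borel_measurable (sample ?I)"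
      using bounded_measurable_mst_length[of ?I ?I] unfolding bounded_measurable_def
      by (intro measurable_compose[OF _ measurable_ennreal]) blast
  qed (use m in \<open>auto intro: into_cell_measurable uniform_le_mixture prob_space_axioms\<close>)
  also have "\<dots> \<le> (\<Sum>J\<in>?CJ. (ennreal (1 / (real m)\<^sup>2)) ^ card ?I * ennreal (b J))"
    by (intro sum_mono mult_left_mono bound) auto
  also have "\<dots> = ennreal (\<Sum>J\<in>?CJ. (1 / (real m)\<^sup>2) ^ n * b J)"
    using b0 by (subst sum_ennreal[symmetric]) (auto simp: ennreal_mult ennreal_power)
  finally have "mean_mst n \<le> (\<Sum>J\<in>?CJ. (1 / (real m)\<^sup>2) ^ n * b J)"
    using b0 by (subst (asm) ennreal_le_iff) (auto intro!: sum_nonneg)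
  then have mean: "mean_mst n \<le> (1 / (real m)\<^sup>2) ^ n * (\<Sum>J\<in>?CJ. b J)" by (simp add: sum_distrib_left)
  have card_CJ: "real (card ?CJ) = ((real m)\<^sup>2) ^ n" by (simp add: card_PiE card_cells)
  have smooth: "mean_mst N \<le> mean_mst k + 2 + 28 * ((real N - k)\<^sup>2 / s ^ 3 + s)" for N
  proof -
    have "\<bar>mean_mst N - mean_mst k\<bar> \<le> 28 * sqrt \<bar>real N - k\<bar> + 2"
    proof (cases "N \<le> k")
      case True
      then show ?thesis using abs_mean_mst_diff_le[OF True] by (simp add: of_nat_diff abs_minus_commute)
    next
      case False
      then show ?thesis using abs_mean_mst_diff_le[of k N] by (simp add: of_nat_diff)
    qed
    moreover have "sqrt \<bar>real N - k\<bar> \<le> \<bar>real N - k\<bar>\<^sup>2 / s ^ 3 + s"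
      using s(1) by (intro sqrt_le_square_div_cube) auto
    ultimately show ?thesis by simp
  qed
  define \<alpha> where "\<alpha> = (1 / m) * (mean_mst k + 2 + 28 * s)"
  define \<beta> where "\<beta> = 28 / (m * s ^ 3)"
  have \<beta>: "0 \<le> \<beta>" using s(1) by (simp add: \<beta>_def)
  define dev where "dev J q = (real (card (A J q)) - k)\<^sup>2" for J q
  have "(\<Sum>J\<in>?CJ. b J) \<le> (\<Sum>J\<in>?CJ. (\<Sum>q\<in>cells m. (1 / m) * (mean_mst k + 2 + 28 * (dev J q / s ^ 3 + s))) + 7 * real m)"
    unfolding b_def dev_def by (intro sum_mono add_mono mult_left_mono smooth) auto
  also have "\<dots> = (\<Sum>J\<in>?CJ. (\<Sum>q\<in>cells m. \<alpha> + \<beta> * dev J q) + 7 * real m)"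
    using m s(1) by (simp add: \<alpha>_def \<beta>_def field_simps)
  also have "\<dots> = card ?CJ * (card (cells m) * \<alpha> + 7 * real m) + \<beta> * (\<Sum>J\<in>?CJ. \<Sum>q\<in>cells m. dev J q)"
    by (simp add: sum.distrib distrib_left flip: sum_distrib_left)
  also have "(\<Sum>J\<in>?CJ. \<Sum>q\<in>cells m. dev J q) = (\<Sum>q\<in>cells m. \<Sum>J\<in>?CJ. dev J q)"
    by (rule sum.swap)
  also have "(\<Sum>q\<in>cells m. \<Sum>J\<in>?CJ. dev J q) \<le> (\<Sum>q\<in>cells m. ((real m)\<^sup>2) ^ n * k)"
  proof (rule sum_mono)
    fix q assume "q \<in> cells m"
    then have "(\<Sum>J\<in>?CJ. dev J q) = real (card (cells m)) ^ card ?I *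
      ((card ?I / card (cells m) - k)\<^sup>2 + card ?I * (1 / card (cells m) * (1 - 1 / card (cells m))))"
      unfolding dev_def A_def by (intro sum_square_count_deviation) auto
    also have "\<dots> = ((real m)\<^sup>2) ^ n * (k * (1 - 1 / (real m)\<^sup>2))"
      using m by (simp add: card_cells n_def)
    also have "\<dots> \<le> ((real m)\<^sup>2) ^ n * (real k * 1)"
      by (intro mult_left_mono) auto
    finally show "(\<Sum>J\<in>?CJ. dev J q) \<le> ((real m)\<^sup>2) ^ n * k" by simp
  qed
  also have "(\<Sum>q\<in>cells m. ((real m)\<^sup>2) ^ n * k) = (real m)\<^sup>2 * (((real m)\<^sup>2) ^ n * k)" by (simp add: card_cells)
  finally have "(\<Sum>J\<in>?CJ. b J) \<le> card ?CJ * (card (cells m) * \<alpha> + 7 * real m)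
      + \<beta> * ((real m)\<^sup>2 * (((real m)\<^sup>2) ^ n * k))"
    using \<beta> by (simp add: mult_left_mono)
  also have "\<dots> = ((real m)\<^sup>2) ^ n * (m * (mean_mst k + (9 + 56 * s)))"
  proof -
    have "\<beta> * ((real m)\<^sup>2 * (((real m)\<^sup>2) ^ n * k)) = ((real m)\<^sup>2) ^ n * (m * (28 * s))"
      using m s(1) by (simp add: \<beta>_def s(2)[symmetric] field_simps power2_eq_square
          power3_eq_cube power4_eq_xxxx)
    moreover have "card (cells m) * \<alpha> = m * (mean_mst k + 2 + 28 * s)"
      using m by (simp add: \<alpha>_def card_cells power2_eq_square)
    ultimately show ?thesis unfolding card_CJ by (simp only: algebra_simps)
  qed
  finally have "(1 / (real m)\<^sup>2) ^ n * (\<Sum>J\<in>?CJ. b J)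
      \<le> (1 / (real m)\<^sup>2) ^ n * (((real m)\<^sup>2) ^ n * (m * (mean_mst k + (9 + 56 * s))))"
    by (intro mult_left_mono) auto
  also have "\<dots> = m * (mean_mst k + (9 + 56 * s))"
    using m by (simp add: power_one_over)
  finally show ?thesis using mean unfolding n_def s_def by simp
qed

lemma mean_mst_converges: "\<exists>L. (\<lambda>n. mean_mst n / sqrt n) \<longlonglongrightarrow> L"
proof (rule scaling_subadditive_convergent)
  show "(\<lambda>n. (9 + 56 * sqrt (sqrt (real n))) / sqrt (real n)) \<longlonglongrightarrow> 0" by real_asymp
  show "mean_mst (m\<^sup>2 * k) \<le> m * (mean_mst k + (9 + 56 * sqrt (sqrt k)))" if "0 < m" "0 < k" for m k
    using that by (rule mean_mst_scaling)
  show "mean_mst n \<le> mean_mst l + 7 * sqrt (real (n - l)) + 2" if "0 < l" "l \<le> n" for l n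
    using that by (rule mean_mst_step)
qed (auto intro: mean_mst_nonneg)

end

section \<open>The lower tail\<close>

locale bounded_square_distribution = square_distribution +
  fixes \<epsilon> :: real
  assumes \<epsilon>_pos: "0 < \<epsilon>"
    and measure_box_le: "\<And>a b c d. a \<le> b \<Longrightarrow> c \<le> d \<Longrightarrow>
      measure N ({a..b} \<times> {c..d} \<inter> unit_square) \<le> \<epsilon> * ((b - a) * (d - c))"
begin

definition grid_cell :: "nat \<Rightarrow> real \<times> real \<Rightarrow> int \<times> int" where
  "grid_cell m p = (\<lfloor>m * fst p\<rfloor>, \<lfloor>m * snd p\<rfloor>)"

definition grid_box :: "nat \<Rightarrow> int \<times> int \<Rightarrow> (real \<times> real) set" where
  "grid_box m q = {real_of_int (fst q) / m..(real_of_int (fst q) + 1) / m} \<times>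
    {real_of_int (snd q) / m..(real_of_int (snd q) + 1) / m} \<inter> unit_square"

lemma in_grid_box: "0 < m \<Longrightarrow> p \<in> unit_square \<Longrightarrow> p \<in> grid_box m (grid_cell m p)"
  by (cases p) (auto simp: grid_box_def grid_cell_def divide_le_eq le_divide_eq mult.commute
      intro: less_imp_le real_of_int_floor_add_one_gt)

lemma grid_box_sets [measurable]: "grid_box m q \<in> sets N"
proof -
  have "grid_box m q = unit_square \<inter> ({real_of_int (fst q) / m..(real_of_int (fst q) + 1) / m} \<times>
    {real_of_int (snd q) / m..(real_of_int (snd q) + 1) / m})" by (auto simp: grid_box_def)
  moreover have "{real_of_int (fst q) / m..(real_of_int (fst q) + 1) / m} \<times>
    {real_of_int (snd q) / m..(real_of_int (snd q) + 1) / m} \<in> sets borel"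
    by (intro borel_closed closed_Times closed_atLeastAtMost)
  ultimately show ?thesis unfolding sets_N sets_restrict_space by auto
qed

lemma measure_grid_boxes_le:
  assumes m: "0 < m" and D: "finite D"
  shows "measure N (\<Union>q\<in>D. grid_box m q) \<le> card D * (\<epsilon> / (real m)\<^sup>2)"
proof -
  have "measure N (grid_box m q) \<le> \<epsilon> / (real m)\<^sup>2" for q
  proof -
    have "measure N (grid_box m q)
        \<le> \<epsilon> * (((real_of_int (fst q) + 1) / m - real_of_int (fst q) / m) *
          ((real_of_int (snd q) + 1) / m - real_of_int (snd q) / m))"
      unfolding grid_box_def by (rule measure_box_le) (use m in \<open>auto simp: divide_right_mono\<close>)
    also have "\<dots> = \<epsilon> * (1 / m * (1 / m))" by (simp flip: diff_divide_distrib)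
    finally show ?thesis by (simp add: power2_eq_square)
  qed
  then have "(\<Sum>q\<in>D. measure N (grid_box m q)) \<le> (\<Sum>q\<in>D. \<epsilon> / (real m)\<^sup>2)" by (rule sum_mono)
  moreover have "measure N (\<Union>q\<in>D. grid_box m q) \<le> (\<Sum>q\<in>D. measure N (grid_box m q))"
    using D by (intro finite_measure_subadditive_finite) auto
  ultimately show ?thesis by simp
qed

text \<open>With about \<open>n\<close> cells, of side about \<open>1 / sqrt n\<close>, the sample is crowded if it fits into the closed boxes
  of at most \<open>n / (192 * \<epsilon>)\<close> cells.  Cells are half-open and boxes closed, so that the cells of a sample are
  well defined and \<open>crowded n\<close> is evidently measurable.\<close>

definition mesh :: "nat \<Rightarrow> nat" where
  "mesh n = nat \<lfloor>sqrt n\<rfloor>"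

definition few_cells :: "nat \<Rightarrow> (int \<times> int) set set" where
  "few_cells n = {D. D \<subseteq> {0..int (mesh n)} \<times> {0..int (mesh n)} \<and> card D \<le> n / (192 * \<epsilon>)}"

definition crowded :: "nat \<Rightarrow> (nat \<Rightarrow> real \<times> real) set" where
  "crowded n = (\<Union>D\<in>few_cells n. {1..n} \<rightarrow>\<^sub>E (\<Union>q\<in>D. grid_box (mesh n) q))"

lemma mesh_bounds:
  assumes "0 < n"
  shows "0 < mesh n" "real (mesh n) \<le> sqrt n" "real n \<le> 4 * (real (mesh n))\<^sup>2" "(real (mesh n))\<^sup>2 \<le> n"
proof -
  have s: "1 \<le> sqrt n" using assms by simp
  then have "1 \<le> mesh n" unfolding mesh_def by linarith
  moreover have "real (mesh n) \<le> sqrt n" "sqrt n \<le> real (mesh n) + 1"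
    unfolding mesh_def using s by linarith+
  ultimately have m: "1 \<le> real (mesh n)" "real (mesh n) \<le> sqrt n" "sqrt n \<le> real (mesh n) + 1"
    by simp_all
  show "0 < mesh n" "real (mesh n) \<le> sqrt n" using m by auto
  have "(sqrt n)\<^sup>2 \<le> (2 * real (mesh n))\<^sup>2" using m by (intro power_mono) auto
  then show "real n \<le> 4 * (real (mesh n))\<^sup>2" by (simp add: power_mult_distrib)
  have "(real (mesh n))\<^sup>2 \<le> (sqrt n)\<^sup>2" using m by (intro power_mono) auto
  then show "(real (mesh n))\<^sup>2 \<le> n" by simp
qed

lemma finite_few_cells: "finite (few_cells n)" "D \<in> few_cells n \<Longrightarrow> finite D"
proof -
  have "few_cells n \<subseteq> Pow ({0..int (mesh n)} \<times> {0..int (mesh n)})" by (auto simp: few_cells_def)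
  then show "finite (few_cells n)" by (rule finite_subset) simp
  show "D \<in> few_cells n \<Longrightarrow> finite D"
    unfolding few_cells_def by (auto intro: finite_subset[of D "{0..int (mesh n)} \<times> {0..int (mesh n)}"])
qed

lemma crowded_sets: "crowded n \<in> sets (sample {1..n})"
  unfolding crowded_def using finite_few_cells
  by (intro sets.finite_UN sets_PiM_I_finite) auto

text \<open>As the squared mesh is at least \<open>n / 4\<close>, each point lies in given \<open>n / (192 * \<epsilon>)\<close> boxes with probability at
  most \<open>4 / 192 = 1 / 48\<close>.  A union bound over the at most \<open>16 ^ n\<close> sets of cells leaves \<open>(1 / 3) ^ n\<close>.\<close>

lemma measure_crowded_le:
  assumes n: "0 < n"
  shows "measure (sample {1..n}) (crowded n) \<le> (1 / 3) ^ n"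
proof -
  interpret S: finite_product_prob_space "\<lambda>_. N" "{1..n}" by unfold_locales auto
  define m where "m = mesh n"
  note m = mesh_bounds[OF n, folded m_def]
  let ?C = "{0..int m} \<times> {0..int m}"
  have boxes: "(\<Union>q\<in>D. grid_box m q) \<in> sets N" if "D \<in> few_cells n" for D
    using finite_few_cells(2)[OF that] by (intro sets.finite_UN) auto
  have one: "measure N (\<Union>q\<in>D. grid_box m q) \<le> 1 / 48" if D: "D \<in> few_cells n" for D
  proof -
    have "measure N (\<Union>q\<in>D. grid_box m q) \<le> card D * (\<epsilon> / (real m)\<^sup>2)"
      using m(1) finite_few_cells(2)[OF D] by (rule measure_grid_boxes_le)
    also have "\<dots> \<le> n / (192 * \<epsilon>) * (\<epsilon> / (real m)\<^sup>2)"
      using D \<epsilon>_pos by (intro mult_right_mono) (auto simp: few_cells_def)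
    also have "\<dots> = (n / (real m)\<^sup>2) / 192" using \<epsilon>_pos by simp
    also have "\<dots> \<le> 4 / 192" using m(1,3) by (intro divide_right_mono) (auto simp: divide_le_eq)
    finally show ?thesis by simp
  qed
  have "measure (sample {1..n}) (crowded n)
      \<le> (\<Sum>D\<in>few_cells n. measure (sample {1..n}) ({1..n} \<rightarrow>\<^sub>E (\<Union>q\<in>D. grid_box m q)))"
    unfolding crowded_def m_def[symmetric] using finite_few_cells(1) boxes
    by (intro S.finite_measure_subadditive_finite) (auto intro!: sets_PiM_I_finite)
  also have "\<dots> \<le> (\<Sum>D\<in>few_cells n. (1 / 48) ^ n)"
  proof (rule sum_mono)
    fix D assume D: "D \<in> few_cells n"
    have "measure (sample {1..n}) ({1..n} \<rightarrow>\<^sub>E (\<Union>q\<in>D. grid_box m q))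
        = (measure N (\<Union>q\<in>D. grid_box m q)) ^ n"
      using boxes[OF D] by (subst S.prob_times) auto
    also have "\<dots> \<le> (1 / 48) ^ n" using one[OF D] by (intro power_mono) auto
    finally show "measure (sample {1..n}) ({1..n} \<rightarrow>\<^sub>E (\<Union>q\<in>D. grid_box m q)) \<le> (1 / 48) ^ n" .
  qed
  also have "\<dots> = card (few_cells n) * (1 / 48) ^ n" by simp
  also have "\<dots> \<le> 16 ^ n * (1 / 48) ^ n"
  proof (rule mult_right_mono)
    have "card (few_cells n) \<le> card (Pow ?C)"
      by (intro card_mono) (auto simp: few_cells_def m_def)
    also have "\<dots> = 2 ^ ((m + 1) * (m + 1))"
      by (simp add: card_Pow card_cartesian_product nat_add_distrib)
    also have "\<dots> \<le> 2 ^ (4 * n)"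
    proof (rule power_increasing)
      have "m + 1 \<le> 2 * m" using m(1) by simp
      then have "(m + 1) * (m + 1) \<le> (2 * m) * (2 * m)" by (intro mult_mono) auto
      moreover have "m * m \<le> n"
        using m(4) by (metis of_nat_le_iff of_nat_mult power2_eq_square)
      ultimately show "(m + 1) * (m + 1) \<le> 4 * n" by simp
    qed simp
    also have "\<dots> = 16 ^ n" by (simp add: power_mult)
    finally show "real (card (few_cells n)) \<le> 16 ^ n" by (metis of_nat_le_iff of_nat_numeral of_nat_power)
  qed simp
  also have "(16 :: real) ^ n * (1 / 48) ^ n = (1 / 3) ^ n" by (simp flip: power_mult_distrib)
  finally show ?thesis .
qed

text \<open>Choose a point in each occupied cell and let \<open>m\<close> be the mesh.  The balls of radius \<open>1 / m\<close> around the
  chosen points overlap at most nine times, as they only reach the neighbouring cells.  The constant is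
  \<open>3456 = 18 * 192\<close>.\<close>

lemma mst_length_ge_uncrowded:
  assumes n: "0 < n" "9 * (192 * \<epsilon>) \<le> n" and x: "x \<in> space (sample {1..n})" "x \<notin> crowded n"
  shows "sqrt n / (3456 * \<epsilon>) \<le> mst_length (x ` {1..n})"
proof -
  define m where "m = mesh n"
  note m = mesh_bounds[OF n(1), folded m_def]
  define V where "V = x ` {1..n}"
  have V: "V \<subseteq> unit_square" unfolding V_def by (rule sample_in_square[OF x(1)]) simp
  define D where "D = grid_cell m ` V"
  have finD: "finite D" by (simp add: D_def V_def)
  have "D \<subseteq> {0..int m} \<times> {0..int m}"
  proof
    fix q assume "q \<in> D"
    then obtain p where p: "p \<in> V" "q = grid_cell m p" by (auto simp: D_def)
    have "0 \<le> fst p" "fst p \<le> 1" "0 \<le> snd p" "snd p \<le> 1"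
      using V p(1) by (auto simp: unit_square_def)
    then have "0 \<le> m * fst p" "m * fst p \<le> m" "0 \<le> m * snd p" "m * snd p \<le> m"
      by (auto intro: mult_left_le)
    then have "0 \<le> \<lfloor>m * fst p\<rfloor>" "\<lfloor>m * fst p\<rfloor> \<le> m" "0 \<le> \<lfloor>m * snd p\<rfloor>" "\<lfloor>m * snd p\<rfloor> \<le> m"
      by linarith+
    then show "q \<in> {0..int m} \<times> {0..int m}" by (simp add: p(2) grid_cell_def)
  qed
  moreover have "D \<notin> few_cells n"
  proof
    assume "D \<in> few_cells n"
    moreover have "x \<in> {1..n} \<rightarrow>\<^sub>E (\<Union>q\<in>D. grid_box m q)"
    proof (rule PiE_I)
      fix i assume "i \<in> {1..n}"
      then have "x i \<in> V" by (simp add: V_def)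
      then show "x i \<in> (\<Union>q\<in>D. grid_box m q)"
        using in_grid_box[OF m(1), of "x i"] V by (auto simp: D_def)
    next
      fix i assume "i \<notin> {1..n}"
      then show "x i = undefined" using x(1) by (auto simp: space_PiM PiE_def extensional_def)
    qed
    ultimately have "x \<in> crowded n" unfolding crowded_def m_def[symmetric] by blast
    then show False using x(2) by simp
  qed
  ultimately have cardD: "n / (192 * \<epsilon>) < card D" by (auto simp: few_cells_def m_def)
  have "\<forall>q\<in>D. \<exists>p\<in>V. grid_cell m p = q" by (auto simp: D_def)
  then obtain w where w: "\<And>q. q \<in> D \<Longrightarrow> w q \<in> V" "\<And>q. q \<in> D \<Longrightarrow> grid_cell m (w q) = q" by metis
  define W where "W = w ` D"
  have "inj_on w D" using w(2) by (metis inj_onI)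
  then have cardW: "card W = card D" by (simp add: W_def card_image)
  have "inj_on (grid_cell m \<circ> w) D" using w(2) by (simp add: inj_on_def)
  then have injW: "inj_on (grid_cell m) W" unfolding W_def by (rule inj_on_imageI)
  have "card W * (1 / m) \<le> real (2 * 9) * mst_length V"
  proof (rule mst_length_ge_bumps)
    fix p assume "p \<in> V"
    obtain c d where cd: "grid_cell m p = (c, d)" by (cases "grid_cell m p")
    have "grid_cell m ` {v\<in>W. dist v p < 1 / m} \<subseteq> {c - 1..c + 1} \<times> {d - 1..d + 1}"
    proof
      fix q assume "q \<in> grid_cell m ` {v\<in>W. dist v p < 1 / m}"
      then obtain v where v: "dist v p < 1 / m" "q = grid_cell m v" by auto
      have "\<bar>fst v - fst p\<bar> < 1 / m" "\<bar>snd v - snd p\<bar> < 1 / m"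
        using dist_fst_le[of v p] dist_snd_le[of v p] v(1) by (auto simp: dist_real_def)
      then have "m * \<bar>fst v - fst p\<bar> < 1" "m * \<bar>snd v - snd p\<bar> < 1"
        using m(1) by (auto simp: field_simps)
      then have "\<bar>m * fst v - m * fst p\<bar> < 1" "\<bar>m * snd v - m * snd p\<bar> < 1"
        using m(1) by (simp_all only: abs_scaled_diff of_nat_0_less_iff)
      moreover have "c = \<lfloor>m * fst p\<rfloor>" "d = \<lfloor>m * snd p\<rfloor>" using cd by (auto simp: grid_cell_def)
      ultimately have "\<lfloor>m * fst v\<rfloor> \<in> {c - 1..c + 1}" "\<lfloor>m * snd v\<rfloor> \<in> {d - 1..d + 1}"
        unfolding atLeastAtMost_iff by linarith+
      then show "q \<in> {c - 1..c + 1} \<times> {d - 1..d + 1}" by (simp add: v(2) grid_cell_def)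
    qed
    then have "card {v\<in>W. dist v p < 1 / m} \<le> card ({c - 1..c + 1} \<times> {d - 1..d + 1})"
      using injW by (intro card_inj_on_le[of "grid_cell m"]) (auto intro: inj_on_subset)
    then show "card {v\<in>W. dist v p < 1 / m} \<le> 9" by (simp add: card_cartesian_product)
  next
    have "9 \<le> n / (192 * \<epsilon>)" using n(2) \<epsilon>_pos by (simp add: le_divide_eq)
    then show "9 < card W" using cardD cardW by linarith
  qed (use w(1) in \<open>auto simp: W_def V_def\<close>)
  moreover have "n / (192 * \<epsilon>) * (1 / sqrt n) \<le> card W * (1 / m)"
    using cardD cardW m(1,2) n(1) \<epsilon>_pos by (intro mult_mono) (auto simp: frac_le)
  moreover have "n / (192 * \<epsilon>) * (1 / sqrt n) = sqrt n / (192 * \<epsilon>)"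
  proof -
    have "n / (192 * \<epsilon>) * (1 / sqrt n) = (n / sqrt n) / (192 * \<epsilon>)" by simp
    then show ?thesis using n(1) by (simp only: real_div_sqrt of_nat_0_le_iff)
  qed
  ultimately have "sqrt n / (192 * \<epsilon>) \<le> 18 * mst_length V" by simp
  then show ?thesis using \<epsilon>_pos by (simp add: V_def field_simps)
qed

lemma long_tree_sets: "{x \<in> space (sample {1..n}). t \<le> mst_length (x ` {1..n})} \<in> sets (sample {1..n})"
proof -
  have [measurable]: "(\<lambda>x. mst_length (x ` {1..n})) \<in> borel_measurable (sample {1..n})"
    using bounded_measurable_mst_length[of "{1..n}" "{1..n}"] by (auto simp: bounded_measurable_def)
  show ?thesis by measurable
qed

lemma measure_mst_length_ge:
  assumes n: "0 < n" "9 * (192 * \<epsilon>) \<le> n"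
  shows "1 - (1 / 3) ^ n
    \<le> measure (sample {1..n}) {x \<in> space (sample {1..n}). sqrt n / (3456 * \<epsilon>) \<le> mst_length (x ` {1..n})}"
proof -
  interpret S: prob_space "sample {1..n}" by (rule prob_space_sample)
  have "1 - (1 / 3) ^ n \<le> 1 - measure (sample {1..n}) (crowded n)"
    using measure_crowded_le[OF n(1)] by simp
  also have "\<dots> = measure (sample {1..n}) (space (sample {1..n}) - crowded n)"
    by (rule S.prob_compl[OF crowded_sets, symmetric])
  also have "\<dots> \<le> measure (sample {1..n}) {x \<in> space (sample {1..n}). sqrt n / (3456 * \<epsilon>) \<le> mst_length (x ` {1..n})}"
    by (rule S.finite_measure_mono[OF _ long_tree_sets]) (use mst_length_ge_uncrowded[OF n] in auto)
  finally show ?thesis .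
qed

text \<open>The lower bound holds with probability at least 1/2, which doubles the constant.\<close>

lemma mean_mst_ge:
  assumes n: "0 < n" "9 * (192 * \<epsilon>) \<le> n"
  shows "sqrt n / (6912 * \<epsilon>) \<le> mean_mst n"
proof -
  interpret S: prob_space "sample {1..n}" by (rule prob_space_sample)
  define t where "t = sqrt n / (3456 * \<epsilon>)"
  define A where "A = {x \<in> space (sample {1..n}). t \<le> mst_length (x ` {1..n})}"
  have A [measurable]: "A \<in> sets (sample {1..n})" unfolding A_def by (rule long_tree_sets)
  have "0 \<le> t" using \<epsilon>_pos by (simp add: t_def)
  have "(1 / 3 :: real) ^ n \<le> 1 / 3" using power_decreasing[of 1 n "1 / 3 :: real"] n(1) by simp
  then have "1 / 2 \<le> measure (sample {1..n}) A"
    using measure_mst_length_ge[OF n] unfolding A_def t_def by linarith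
  then have "t * (1 / 2) \<le> t * measure (sample {1..n}) A" using \<open>0 \<le> t\<close> by (rule mult_left_mono)
  also have "\<dots> = (\<integral>x. t * indicator A x \<partial>sample {1..n})"
    by (simp only: integral_mult_right_zero Bochner_Integration.integral_indicator
        Int_absorb2[OF sets.sets_into_space[OF A]])
  also have "\<dots> \<le> mean_mst n"
    unfolding mean_mst_def
  proof (rule integral_mono)
    show "t * indicator A x \<le> mst_length (x ` {1..n})" for x
      by (auto simp: A_def indicator_def intro: mst_length_nonneg)
    show "integrable (sample {1..n}) (\<lambda>x. t * indicator A x)"
      by (intro integrable_mult_right integrable_real_indicator A)
        (use S.emeasure_finite[of A] in \<open>simp add: less_top\<close>)
  qed (rule integrable_mst_length; simp)
  finally show ?thesis by (simp add: t_def)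
qed

end

lemma ln_cube_ge: "ln (real n) \<le> (ln n) ^ 3 / (ln 2)\<^sup>2" if "2 \<le> n"
proof -
  have l: "0 < ln (2 :: real)" "ln 2 \<le> ln (real n)" "0 \<le> ln (real n)" using that by auto
  then have "ln n * (ln 2)\<^sup>2 \<le> ln n * (ln n)\<^sup>2" by (intro mult_left_mono power_mono) auto
  also have "\<dots> = (ln n) ^ 3" by (simp add: power2_eq_square power3_eq_cube)
  finally show ?thesis using l(1) by (simp add: le_divide_eq)
qed

text \<open>The mean square deviations along the squares are of order \<open>ln k / k\<^sup>2\<close> after normalisation.\<close>

lemma summable_ln_over_square: "summable (\<lambda>k. C * ln (real k + 1) / (real k)\<^sup>2)"
proof -
  have "summable (\<lambda>k. ln (real k + 1) / (real k)\<^sup>2)"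
  proof (rule summable_comparison_test_ev)
    show "eventually (\<lambda>k. norm (ln (real k + 1) / (real k)\<^sup>2) \<le> real k powr (- (3/2))) sequentially"
      unfolding real_norm_def by real_asymp
    show "summable (\<lambda>k. real k powr (- (3/2)))" by (simp add: summable_real_powr_iff)
  qed
  from summable_mult[OF this, of C] show ?thesis by simp
qed

section \<open>Random points with a bounded density\<close>

theorem theorem2:
  fixes M :: "'w measure"
    and X :: "nat \<Rightarrow> 'w \<Rightarrow> real \<times> real"
    and f :: "real \<times> real \<Rightarrow> real"
    and \<epsilon>1 \<epsilon>2 :: real
  assumes "prob_space M"
    and "0 < \<epsilon>1" and "\<epsilon>1 \<le> \<epsilon>2"
    and "\<And>x. x \<in> unit_square \<Longrightarrow> \<epsilon>1 \<le> f x \<and> f x \<le> \<epsilon>2"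
    and "\<And>i. 1 \<le> i \<Longrightarrow>
           distributed M (restrict_space lborel unit_square) (X i) (\<lambda>x. ennreal (f x))"
    and "prob_space.indep_vars M (\<lambda>_. restrict_space lborel unit_square) X {1..}"
  shows
    "(\<exists>C>0. \<forall>n\<ge>1.
        prob_space.expectation M
          (\<lambda>\<omega>. (MST X n \<omega> - prob_space.expectation M (MST X n))\<^sup>2)
        \<le> C * (ln (real n)) ^ 3)
     \<and> (AE \<omega> in M.
         (\<lambda>n. (1 / sqrt (real n)) * (MST X n \<omega> - prob_space.expectation M (MST X n)))
           \<longlonglongrightarrow> 0)
     \<and> (\<exists>\<theta>1>0. \<exists>\<theta>2>0. \<exists>\<theta>3>0. \<forall>\<^sub>F n in sequentially.
         \<theta>1 * sqrt (real n) \<le> prob_space.expectation M (MST X n)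
         \<and> prob_space.expectation M (MST X n) \<le> 3 * sqrt (real n)
         \<and> prob_space.prob M {\<omega> \<in> space M. MST X n \<omega> \<le> 3 * sqrt (real n)} = 1
         \<and> prob_space.prob M {\<omega> \<in> space M. MST X n \<omega> \<ge> \<theta>2 * sqrt (real n)}
             \<ge> 1 - exp (- (\<theta>3 * real n / ln (real n))))
     \<and> ((\<forall>x\<in>unit_square. f x = 1) \<longrightarrow>
         (\<exists>\<beta>>0. (\<lambda>n. prob_space.expectation M (MST X n) / sqrt (real n))
           \<longlonglongrightarrow> \<beta>))"
proof -
  interpret M: prob_space M by fact
  define U where "U = (restrict_space lborel unit_square :: (real \<times> real) measure)"
  define N where "N = density U (\<lambda>x. ennreal (f x))"
  have X: "X i \<in> measurable M U" and distr_X: "distr M U (X i) = N" and f: "(\<lambda>x. ennreal (f x)) \<in> borel_measurable U"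
    if "1 \<le> i" for i
    using assms(5)[OF that] by (auto simp: distributed_def U_def N_def)
  have sets_N: "sets N = sets U" by (simp add: N_def)
  have prob_N: "prob_space N" using M.prob_space_distr[OF X[of 1]] distr_X[of 1] by simp
  interpret N: square_distribution N
    using prob_N sets_N by (auto simp: square_distribution_def square_distribution_axioms_def U_def)
  have S: "unit_square \<in> sets (lborel :: (real \<times> real) measure)"
    unfolding unit_square_def by (simp add: borel_closed closed_Times)
  have \<epsilon>2: "0 < \<epsilon>2" using assms(2,3) by linarith
  \<comment> \<open>The upper bound of the density enters only through the probability of boxes.\<close>
  interpret N: bounded_square_distribution N \<epsilon>2
  proof unfold_locales
    show "0 < \<epsilon>2" by (rule \<epsilon>2)
    fix a b c d :: real assume abcd: "a \<le> b" "c \<le> d"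
    define B where "B = {a..b} \<times> {c..d}"
    have B: "B \<in> sets (lborel :: (real \<times> real) measure)"
      unfolding B_def by (simp add: borel_closed closed_Times)
    have BU: "B \<inter> unit_square \<in> sets U"
      using B unfolding U_def sets_restrict_space by (auto simp: Int_commute)
    have "emeasure N (B \<inter> unit_square) = (\<integral>\<^sup>+x. ennreal (f x) * indicator (B \<inter> unit_square) x \<partial>U)"
      unfolding N_def using f[of 1] BU by (simp add: emeasure_density)
    also have "\<dots> \<le> (\<integral>\<^sup>+x. ennreal \<epsilon>2 * indicator (B \<inter> unit_square) x \<partial>U)"
      using assms(4) by (intro nn_integral_mono) (auto simp: indicator_def intro: ennreal_leI)
    also have "\<dots> = ennreal \<epsilon>2 * emeasure U (B \<inter> unit_square)"
      using BU by (simp add: nn_integral_cmult_indicator)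
    also have "emeasure U (B \<inter> unit_square) = emeasure lborel (B \<inter> unit_square)"
      unfolding U_def using S by (intro emeasure_restrict_space) auto
    also have "\<dots> \<le> emeasure lborel B" using B by (intro emeasure_mono) auto
    also have "emeasure lborel B = ennreal ((b - a) * (d - c))"
      unfolding B_def lborel_prod[symmetric] using abcd
      by (subst lborel.emeasure_pair_measure_Times) (auto simp: ennreal_mult)
    finally have "emeasure N (B \<inter> unit_square) \<le> ennreal (\<epsilon>2 * ((b - a) * (d - c)))"
      using \<epsilon>2 abcd by (simp add: ennreal_mult mult_left_mono)
    then show "measure N ({a..b} \<times> {c..d} \<inter> unit_square) \<le> \<epsilon>2 * ((b - a) * (d - c))"
      using \<epsilon>2 abcd by (simp add: B_def N.emeasure_eq_measure)
  qed
  \<comment> \<open>Everything about \<open>MST X n\<close> can be computed in the product space of the joint distribution.\<close>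
  define pts where "pts n \<omega> = (\<lambda>i\<in>{1..n}. X i \<omega>)" for n \<omega>
  have pts: "pts n \<in> measurable M (N.sample {1..n})" for n
    unfolding pts_def using X sets_N
    by (intro measurable_restrict) (auto simp: measurable_cong_sets[OF refl sets_N])
  have distr_pts: "distr M (N.sample {1..n}) (pts n) = N.sample {1..n}" if "1 \<le> n" for n
  proof -
    have "M.indep_vars (\<lambda>_. U) X {1..n}"
      using M.indep_vars_subset[OF assms(6)] by (auto simp: U_def)
    then have "distr M (PiM {1..n} (\<lambda>_. U)) (pts n) = PiM {1..n} (\<lambda>i. distr M U (X i))"
      unfolding pts_def using that X by (subst (asm) M.indep_vars_iff_distr_eq_PiM') auto
    also have "PiM {1..n} (\<lambda>i. distr M U (X i)) = N.sample {1..n}"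
      using distr_X by (intro PiM_cong) auto
    finally show ?thesis
      using sets_PiM_cong[of "{1..n}" "{1..n}" "\<lambda>_. U" "\<lambda>_. N"] sets_N
      by (metis (no_types, lifting) distr_cong)
  qed
  have MST_pts: "MST X n \<omega> = mst_length (pts n \<omega> ` {1..n})" for n \<omega>
    by (simp add: MST_def pts_def)
  have transfer: "(\<integral>\<omega>. g (MST X n \<omega>) \<partial>M) = (\<integral>x. g (mst_length (x ` {1..n})) \<partial>N.sample {1..n})"
    if n: "1 \<le> n" and g: "g \<in> borel_measurable borel" for n and g :: "real \<Rightarrow> real"
  proof -
    have "(\<lambda>x. g (mst_length (x ` {1..n}))) \<in> borel_measurable (N.sample {1..n})"
      using N.bounded_measurable_mst_length[of "{1..n}" "{1..n}"] g
      unfolding bounded_measurable_def by (intro measurable_compose[OF _ g]) blast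
    from integral_distr[OF pts this] show ?thesis
      unfolding distr_pts[OF n] MST_pts by simp
  qed
  have mean: "M.expectation (MST X n) = N.mean_mst n" for n
  proof (cases "1 \<le> n")
    case True
    then show ?thesis using transfer[of n "\<lambda>t. t"] by (simp add: N.mean_mst_def)
  next
    case False
    then have "n = 0" by simp
    then show ?thesis using N.mean_mst_le[of 0] N.mean_mst_nonneg[of 0] by (simp add: MST_def[abs_def])
  qed
  have in_square: "(\<lambda>i. X i \<omega>) ` {1..n} \<subseteq> unit_square" if "\<omega> \<in> space M" for \<omega> n
    using N.sample_in_square[OF measurable_space[OF pts that], of "{1..n}" n] by (auto simp: pts_def)
  have variance: "M.expectation (\<lambda>\<omega>. (MST X n \<omega> - N.mean_mst n)\<^sup>2) \<le> 248848 * log 2 n" if "2 \<le> n" for n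
    using transfer[of n "\<lambda>t. (t - N.mean_mst n)\<^sup>2"] N.variance_mst_length_le[OF that] that by simp
  have bounded_MST: "bounded_measurable M (MST X n)" for n
  proof (rule bounded_measurableI)
    show "MST X n \<in> borel_measurable M"
      unfolding MST_pts[abs_def]
      using N.bounded_measurable_mst_length[of "{1..n}" "{1..n}"] unfolding bounded_measurable_def
      by (intro measurable_compose[OF pts]) blast
    show "\<bar>MST X n \<omega>\<bar> \<le> 7 * sqrt n" if "\<omega> \<in> space M" for \<omega>
      using mst_length_square_le_sqrt[OF _ in_square[OF that], of n n]
        mst_length_nonneg[of "(\<lambda>i. X i \<omega>) ` {1..n}"] card_image_le[of "{1..n}" "\<lambda>i. X i \<omega>"]
      by (simp add: MST_def)
  qed
  let ?C = "248848 / ln 2 / (ln 2)\<^sup>2 :: real"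
  have part1: "M.expectation (\<lambda>\<omega>. (MST X n \<omega> - M.expectation (MST X n))\<^sup>2) \<le> ?C * (ln n) ^ 3"
    if "1 \<le> n" for n
  proof (cases "n = 1")
    case True
    then have "MST X n = (\<lambda>_. 0)" by (simp add: MST_def fun_eq_iff)
    then show ?thesis using True by simp
  next
    case False
    then have n: "2 \<le> n" using that by simp
    have "248848 * log 2 n = 248848 / ln 2 * ln n" by (simp add: log_def)
    also have "\<dots> \<le> 248848 / ln 2 * ((ln n) ^ 3 / (ln 2)\<^sup>2)"
      using ln_cube_ge[OF n] by (intro mult_left_mono) auto
    finally show ?thesis using variance[OF n] unfolding mean by simp
  qed
  have part2: "AE \<omega> in M. (\<lambda>n. (1 / sqrt n) * (MST X n \<omega> - N.mean_mst n)) \<longlonglongrightarrow> 0"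
  proof -
    \<comment> \<open>Along the squares the second moments are summable.\<close>
    define Y where "Y k \<omega> = (MST X (k\<^sup>2) \<omega> - N.mean_mst (k\<^sup>2)) / k" for k :: nat and \<omega>
    have diff: "bounded_measurable M (\<lambda>\<omega>. MST X (k\<^sup>2) \<omega> - N.mean_mst (k\<^sup>2))" for k
      by (intro bounded_measurable_diff bounded_MST bounded_measurable_const)
    have Y: "bounded_measurable M (Y k)" for k
    proof -
      obtain B where B: "\<And>\<omega>. \<omega> \<in> space M \<Longrightarrow> \<bar>MST X (k\<^sup>2) \<omega> - N.mean_mst (k\<^sup>2)\<bar> \<le> B"
        using diff[of k] by (auto simp: bounded_measurable_def)
      show ?thesis
      proof (rule bounded_measurableI)
        show "Y k \<in> borel_measurable M"
          unfolding Y_def using diff[of k] by (auto simp: bounded_measurable_def)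
        show "\<bar>Y k \<omega>\<bar> \<le> B / k" if "\<omega> \<in> space M" for \<omega>
          using B[OF that] by (simp add: Y_def abs_divide divide_right_mono)
      qed
    qed
    have "norm (\<integral>\<omega>. (Y k \<omega>)\<^sup>2 \<partial>M) \<le> (2 * 248848 / ln 2) * ln (real k + 1) / (real k)\<^sup>2" if k: "2 \<le> k" for k
    proof -
      have "(\<integral>\<omega>. (Y k \<omega>)\<^sup>2 \<partial>M) = M.expectation (\<lambda>\<omega>. (MST X (k\<^sup>2) \<omega> - N.mean_mst (k\<^sup>2))\<^sup>2) / (real k)\<^sup>2"
        by (simp add: Y_def power_divide)
      also have "\<dots> \<le> 248848 * log 2 (k\<^sup>2) / (real k)\<^sup>2"
      proof (intro divide_right_mono variance)
        have "2 * 1 \<le> k * k" using k by (intro mult_mono) auto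
        then show "2 \<le> k\<^sup>2" by (simp add: power2_eq_square)
      qed simp
      also have "248848 * log 2 (k\<^sup>2) = (2 * 248848 / ln 2) * ln k"
        using k by (simp add: log_def ln_realpow)
      also have "\<dots> / (real k)\<^sup>2 \<le> (2 * 248848 / ln 2) * ln (real k + 1) / (real k)\<^sup>2"
        using k by (intro divide_right_mono mult_left_mono) auto
      finally show ?thesis by simp
    qed
    then have "summable (\<lambda>k. \<integral>\<omega>. (Y k \<omega>)\<^sup>2 \<partial>M)"
      by (intro summable_comparison_test[OF _ summable_ln_over_square]) blast
    from M.AE_tendsto_zero_summable_squares[OF Y this] show ?thesis
    proof (rule AE_mp, intro AE_I2 impI)
      fix \<omega> assume \<omega>: "\<omega> \<in> space M" and "(\<lambda>k. Y k \<omega>) \<longlonglongrightarrow> 0"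
      then have "(\<lambda>n. (MST X n \<omega> - N.mean_mst n) / sqrt n) \<longlonglongrightarrow> 0"
      proof (intro tendsto_zero_from_squares[where B = 28 and D = 2])
        fix l n :: nat assume l: "0 < l" "l \<le> n"
        have "0 \<le> sqrt (real (n - l))" by simp
        then show "MST X n \<omega> \<le> MST X l \<omega> + 28 * sqrt (real (n - l)) + 2"
          using N.mst_length_sample_step[OF in_square[OF \<omega>] l] unfolding MST_def by linarith
      next
        show "\<bar>N.mean_mst n - N.mean_mst l\<bar> \<le> 28 * sqrt (real (n - l)) + 2" if "l \<le> n" for l n
          using that by (rule N.abs_mean_mst_diff_le)
      qed (auto simp: Y_def)
      then show "(\<lambda>n. (1 / sqrt n) * (MST X n \<omega> - N.mean_mst n)) \<longlonglongrightarrow> 0" by simp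
    qed
  qed
  define \<theta>1 where "\<theta>1 = 1 / (6912 * \<epsilon>2)"
  define \<theta>2 where "\<theta>2 = 1 / (3456 * \<epsilon>2)"
  have \<theta>: "0 < \<theta>1" "0 < \<theta>2" using \<epsilon>2 by (auto simp: \<theta>1_def \<theta>2_def)
  define n0 where "n0 = max 600 (nat \<lceil>9 * (192 * \<epsilon>2)\<rceil>)"
  have large: "0 < n" "600 \<le> n" "9 * (192 * \<epsilon>2) \<le> n" if "n0 \<le> n" for n
    using that unfolding n0_def by linarith+
  have mean_ge: "\<theta>1 * sqrt n \<le> N.mean_mst n" if "n0 \<le> n" for n
    using N.mean_mst_ge[of n] large[OF that] by (simp add: \<theta>1_def)
  have le3: "MST X n \<omega> \<le> 3 * sqrt n" if "n0 \<le> n" "\<omega> \<in> space M" for n \<omega>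
    unfolding MST_def using in_square[OF that(2)] large[OF that(1)] card_image_le[of "{1..n}" "\<lambda>i. X i \<omega>"]
    by (intro mst_length_square_le_3_sqrt) auto
  have mean_le: "N.mean_mst n \<le> 3 * sqrt n" if "n0 \<le> n" for n
  proof -
    have "\<bar>MST X n \<omega>\<bar> \<le> 3 * sqrt n" if "\<omega> \<in> space M" for \<omega>
      using le3[OF \<open>n0 \<le> n\<close> that] mst_length_nonneg[of "(\<lambda>i. X i \<omega>) ` {1..n}"]
      by (simp add: MST_def)
    from M.abs_integral_le[OF bounded_MST this] show ?thesis unfolding mean by linarith
  qed
  have sure: "M.prob {\<omega> \<in> space M. MST X n \<omega> \<le> 3 * sqrt n} = 1" if "n0 \<le> n" for n
  proof -
    have "{\<omega> \<in> space M. MST X n \<omega> \<le> 3 * sqrt n} = space M" using le3[OF that] by blast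
    then show ?thesis by (simp add: M.prob_space)
  qed
  have tail: "1 - exp (- (1 * real n / ln n)) \<le> M.prob {\<omega> \<in> space M. MST X n \<omega> \<ge> \<theta>2 * sqrt n}"
    if "n0 \<le> n" for n
  proof -
    note n = large[OF that]
    let ?A = "{x \<in> space (N.sample {1..n}). sqrt n / (3456 * \<epsilon>2) \<le> mst_length (x ` {1..n})}"
    have "exp 1 \<le> real n" using exp_le n(2) by linarith
    then have "1 \<le> ln (real n)" using n(1) by (simp add: ln_ge_iff)
    then have "real n / ln n \<le> n" by (simp add: divide_le_eq mult_le_cancel_left1)
    have "(1 / 3 :: real) ^ n \<le> exp (- 1) ^ n"
      using exp_le by (intro power_mono) (auto simp: exp_minus field_simps)
    also have "\<dots> = exp (- real n)" by (simp flip: exp_of_nat_mult)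
    also have "\<dots> \<le> exp (- (1 * real n / ln n))" using \<open>real n / ln n \<le> n\<close> by simp
    finally have "1 - exp (- (1 * real n / ln n)) \<le> 1 - (1 / 3) ^ n" by simp
    also have "\<dots> \<le> measure (N.sample {1..n}) ?A" by (rule N.measure_mst_length_ge[OF n(1,3)])
    also have "\<dots> = measure (distr M (N.sample {1..n}) (pts n)) ?A"
      using distr_pts[of n] n(1) by simp
    also have "\<dots> = M.prob (pts n -` ?A \<inter> space M)"
      by (rule measure_distr[OF pts N.long_tree_sets])
    also have "pts n -` ?A \<inter> space M = {\<omega> \<in> space M. MST X n \<omega> \<ge> \<theta>2 * sqrt n}"
      using measurable_space[OF pts] by (auto simp: MST_pts \<theta>2_def)
    finally show ?thesis .
  qed
  have part3: "\<forall>\<^sub>F n in sequentially. \<theta>1 * sqrt n \<le> N.mean_mst n \<and> N.mean_mst n \<le> 3 * sqrt n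
      \<and> M.prob {\<omega> \<in> space M. MST X n \<omega> \<le> 3 * sqrt n} = 1
      \<and> M.prob {\<omega> \<in> space M. MST X n \<omega> \<ge> \<theta>2 * sqrt n} \<ge> 1 - exp (- (1 * real n / ln n))"
    using eventually_ge_at_top[of n0] by eventually_elim (use mean_ge mean_le sure tail in blast)
  have part4: "\<exists>\<beta>>0. (\<lambda>n. N.mean_mst n / sqrt n) \<longlonglongrightarrow> \<beta>" if "\<forall>x\<in>unit_square. f x = 1"
  proof -
    have "N = density U (\<lambda>_. 1)"
      unfolding N_def using f[of 1] that
      by (intro density_cong) (auto simp: U_def space_restrict_space intro!: AE_I2)
    then have NU: "N = restrict_space lborel unit_square" by (simp add: density_1 U_def)
    interpret uniform_square
      using N.square_distribution_axioms unfolding NU uniform_square_def .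
    obtain L where L: "(\<lambda>n. N.mean_mst n / sqrt n) \<longlonglongrightarrow> L"
      using mean_mst_converges unfolding NU by blast
    have "\<forall>\<^sub>F n in sequentially. \<theta>1 \<le> N.mean_mst n / sqrt n"
      using eventually_ge_at_top[of n0]
    proof eventually_elim
      case (elim n)
      then show ?case using mean_ge[OF elim] large(1)[OF elim] by (simp add: le_divide_eq)
    qed
    then have "\<theta>1 \<le> L" using L by (intro tendsto_lowerbound[OF L]) auto
    then show ?thesis using L \<theta>(1) by (intro exI[of _ L]) auto
  qed
  show ?thesis
    unfolding mean
  proof (intro conjI impI)
    have "0 < ?C" by simp
    then show "\<exists>C>0. \<forall>n\<ge>1. M.expectation (\<lambda>\<omega>. (MST X n \<omega> - N.mean_mst n)\<^sup>2) \<le> C * ln (real n) ^ 3"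
      using part1 unfolding mean by blast
    show "AE \<omega> in M. (\<lambda>n. 1 / sqrt (real n) * (MST X n \<omega> - N.mean_mst n)) \<longlonglongrightarrow> 0"
      by (rule part2)
    show "\<exists>\<theta>1>0. \<exists>\<theta>2>0. \<exists>\<theta>3>0. \<forall>\<^sub>F n in sequentially. \<theta>1 * sqrt (real n) \<le> N.mean_mst n
      \<and> N.mean_mst n \<le> 3 * sqrt (real n)
      \<and> M.prob {\<omega> \<in> space M. MST X n \<omega> \<le> 3 * sqrt (real n)} = 1
      \<and> 1 - exp (- (\<theta>3 * real n / ln (real n))) \<le> M.prob {\<omega> \<in> space M. \<theta>2 * sqrt (real n) \<le> MST X n \<omega>}"
      using \<theta> part3 zero_less_one by blast
  qed (rule part4)
qed

end
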